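(* Consider a branching random walk with offspring law $\{p_k\}_{k\ge 0}$ and step size $X$, with offspring numbers and displacements independent. Assume that (i) $m:=\sum_{k\ge 0}kp_k>1$ and $\sum_{k\ge 0}k^{1+\xi}p_k<\infty$ for some $\xi>0$; (ii) $\mathbb{E}[X]=0$ and, for some $K\in(0,\infty]$, $\psi(t):=\mathbb{E}[e^{tX}]<\infty$ for all $t\in(-K,K)$; (iii) there exists $\theta^*\in(0,\infty)$ such that $I(x^* )=\theta^*x^*-\log\psi(\theta^* )=\log m$; (iv) $\psi(t)<\infty$ for all $t\in(-K,\theta^*+\delta)$, for some $\delta>0$; (v) $b:=\min\{k\ge 0:p_k>0\}\ge 2$; (vi) $\mathbb{P}(X\le -z)=\Theta(1)\exp(-e^{z^\alpha})$ as $z\to+\infty$ for some constant $\alpha>0$. Let $D_\infty$ be the almost sure limit of the derivative martingale. Then $$\lim_{\varepsilon\to0+}\frac{1}{(-\log\varepsilon)^{\frac{\alpha}{\alpha+1}}}\log\bigl[-\log\mathbb{P}(D_\infty<\varepsilon)\bigr]=\Bigl(\frac{1+\alpha}{\theta^*\alpha}\log b\Bigr)^{\frac{\alpha}{\alpha+1}}.$$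
   Context: Branching random walk: $\mathcal{T}$ is a Galton–Watson tree with root $\rho$ and offspring distribution $\{p_k\}_{k\ge0}$. Given $\mathcal{T}$, the displacements $\{X_v: v\in\mathcal{T}\setminus\{\rho\}\}$ are i.i.d. copies of a real random variable $X$. The position of $v\in\mathcal{T}$ is $S_v:=\sum_{\rho\prec u\preceq v}X_u$ (sum over the vertices $u\neq\rho$ on the ancestral line of $v$, including $v$), with $S_\rho:=0$; $|v|$ is the generation of $v$. Rate function: $I(x):=\sup_{t\in\mathbb{R}}\{tx-\log\psi(t)\}$ for $x\in\mathbb{R}$, where $\psi(t)=\mathbb{E}[e^{tX}]\in(0,\infty]$. Speed: $x^*:=\sup\{x\ge0: I(x)\le\log m\}\in(0,\infty)$. Derivative martingale: $D_n:=\sum_{|u|=n}\theta^*(nx^*-S_u)e^{\theta^*(S_u-nx^* )}$, $n\ge1$. It is known that under (i)–(iv) $D_n$ converges almost surely to a non-negative random variable, denoted $D_\infty$, with $\{D_\infty>0\}=\{\mathcal{T}\text{ is infinite}\}$ a.s. $f=\Theta(1)g$ means that $f$ is bounded above and below by positive finite constant multiples of $g$. *)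

theory Defs
  imports "HOL-Probability.Probability" "HOL-Library.Sublist" "HOL-Library.Landau_Symbols"
begin

text \<open>
  Vertices carry Ulam--Harris labels: the root is \<open>[]\<close> and the children of \<open>v\<close> are
  \<open>v @ [i]\<close> for \<open>i < c v\<close>, where \<open>c v\<close> is the number of children of \<open>v\<close>. The generation of
  a vertex is its length, and the ancestor order is the prefix order on lists.
\<close>

inductive_set gw_tree :: "(nat list \<Rightarrow> nat) \<Rightarrow> nat list set" for c :: "nat list \<Rightarrow> nat" where
  root: "[] \<in> gw_tree c"
| child: "v \<in> gw_tree c \<Longrightarrow> i < c v \<Longrightarrow> v @ [i] \<in> gw_tree c"

text \<open>
  Offspring numbers \<open>N v\<close> and displacements \<open>X v\<close> are attached to all labels, and the tree at
  the sample point \<open>\<omega>\<close> is \<open>gw_tree (\<lambda>v. N v \<omega>)\<close>. The root has no displacement, so \<open>X []\<close> is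
  left unconstrained. The offspring numbers are embedded into the reals only in order to state
  that both families together are independent.
\<close>

locale branching_random_walk = prob_space M
  for M :: "'a measure"
  and N :: "nat list \<Rightarrow> 'a \<Rightarrow> nat"
  and X :: "nat list \<Rightarrow> 'a \<Rightarrow> real"
  and p :: "nat pmf"
  and \<mu> :: "real measure" +
  assumes offspring_measurable: "\<And>v. N v \<in> measurable M (count_space UNIV)"
    and offspring_law: "\<And>v. distr M (count_space UNIV) (N v) = measure_pmf p"
    and displacement_measurable: "\<And>v. v \<noteq> [] \<Longrightarrow> X v \<in> borel_measurable M"
    and displacement_law: "\<And>v. v \<noteq> [] \<Longrightarrow> distr M borel (X v) = \<mu>"
    and independent: "indep_vars (\<lambda>_. borel)
          (case_sum (\<lambda>v \<omega>. real (N v \<omega>)) X) (UNIV <+> {v. v \<noteq> []})"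

definition position :: "(nat list \<Rightarrow> 'a \<Rightarrow> real) \<Rightarrow> nat list \<Rightarrow> 'a \<Rightarrow> real" where
  "position X v \<omega> = (\<Sum>u | strict_prefix [] u \<and> prefix u v. X u \<omega>)"

definition offspring_mean :: "nat pmf \<Rightarrow> real" where
  "offspring_mean p = (\<Sum>k. real k * pmf p k)"

definition min_offspring :: "nat pmf \<Rightarrow> nat" where
  "min_offspring p = (LEAST k. pmf p k > 0)"

definition mgf :: "real measure \<Rightarrow> real \<Rightarrow> ennreal" where
  "mgf \<mu> t = (\<integral>\<^sup>+ x. ennreal (exp (t * x)) \<partial>\<mu>)"

definition ext_ln :: "ennreal \<Rightarrow> ereal" where
  "ext_ln y = (if y = 0 then -\<infinity> else if y = \<infinity> then \<infinity> else ereal (ln (enn2real y)))"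

definition rate_function :: "real measure \<Rightarrow> real \<Rightarrow> ereal" where
  "rate_function \<mu> x = (SUP t::real. ereal (t * x) - ext_ln (mgf \<mu> t))"

definition speed :: "nat pmf \<Rightarrow> real measure \<Rightarrow> real" where
  "speed p \<mu> = Sup {x. 0 \<le> x \<and> rate_function \<mu> x \<le> ereal (ln (offspring_mean p))}"

definition derivative_martingale ::
  "(nat list \<Rightarrow> 'a \<Rightarrow> nat) \<Rightarrow> (nat list \<Rightarrow> 'a \<Rightarrow> real) \<Rightarrow> real \<Rightarrow> real \<Rightarrow> nat \<Rightarrow> 'a \<Rightarrow> real" where
  "derivative_martingale N X \<theta> s n \<omega> =
     (\<Sum>u \<in> {u \<in> gw_tree (\<lambda>v. N v \<omega>). length u = n}.
        \<theta> * (real n * s - position X u \<omega>) * exp (\<theta> * (position X u \<omega> - real n * s)))"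

end

theory Submission
  imports Defs "HOL-Real_Asymp.Real_Asymp"
begin

text \<open>
  Write \<open>V = \<theta> (x\<^sup>* - X)\<close> for the displacement of a child in the critical normalisation and let \<open>D\<close> be
  the limit. Decomposing at the first generation gives \<open>D = (\<Sum>i<N. exp (- V\<^sub>i) D\<^sub>i)\<close> with independent
  copies \<open>D\<^sub>i\<close> of \<open>D\<close>, so \<open>q L = P (D < exp (- L))\<close> satisfies
  \<open>p\<^sub>b (P (V \<ge> v) q (L - v + ln b))\<^sup>b \<le> q L \<le> (q (L - v) + P (V \<ge> v))\<^sup>b\<close> for every \<open>v\<close>. Choosing \<open>v\<close> in
  the \<open>k\<close>-th step so that \<open>P (V \<ge> v)\<close> is about \<open>exp (- b\<^sup>k)\<close>, that is \<open>v \<approx> \<theta> (k ln b) powr (1 / \<alpha>)\<close>,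
  iteration shows that \<open>- ln (q L)\<close> is about \<open>b\<^sup>k\<close> when \<open>L\<close> is the sum of the first \<open>k\<close> steps.

  The recursion needs \<open>D > 0\<close> almost surely. Both this and the absence of a contribution of the additive
  martingale \<open>W\<close> to the fixed point equation are read off Laplace transforms, which satisfy a
  one-generation recursion. For \<open>W\<close>, the limit transform gives a bounded monotone subharmonic function of
  a centred random walk whose defect must vanish, hence \<open>W \<rightarrow> 0\<close> in probability. For \<open>D\<close>, an explicit
  subsolution, preserved by the recursion thanks to the \<open>1 + \<xi>\<close> moment, bounds the transforms from below.
\<close>

section \<open>The environment and its decomposition at the root\<close>

text \<open>The constant comes from balancing generations. The cheapest way to make D small is a
  tree with b children everywhere and large V on every line. If n generations are used and the one
  at height k above the last has displacements of size v_k, its roughly b^(n-k) vertices cost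
  b^(n-k) exp ((v_k / \<theta>)^\<alpha>) in the exponent. All generations cost the same order b^n
  when v_k = \<theta> (k ln b)^(1/\<alpha>), and the sum of these v_k grows like
  \<open>\<kappa> * n powr \<gamma>\<close>. Solving L = \<open>\<kappa> * n powr \<gamma>\<close>
  for n gives the limit. The obstacle is qualitative. Only the almost sure convergence of D_n is
  assumed, and since V is centred under the tilted law, D_n has mean 0: expectations reveal neither
  the sign of the limit nor that it is nonzero. The quantities 1 - exp (- sum) are bounded, pass to
  limits by dominated convergence, and turn the independence of subtrees into the generating
  function of \<open>p\<close>. The work is done on one product space because the environment below
  a child has the same law there as the whole environment, so every recursion concerns a single
  measure.\<close>

text \<open>\<^term>\<open>Inl v\<close> indexes the offspring number of \<open>v\<close> (as a real number), \<^term>\<open>Inr v\<close> its displacement;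
  the unconstrained displacement of the root is left out.\<close>

definition brw_index :: "(nat list + nat list) set" where
  "brw_index = UNIV <+> {v. v \<noteq> []}"

definition env_marginal :: "nat pmf \<Rightarrow> real measure \<Rightarrow> nat list + nat list \<Rightarrow> real measure" where
  "env_marginal p \<mu> = case_sum (\<lambda>_. distr (measure_pmf p) borel real) (\<lambda>_. \<mu>)"

definition env_law :: "nat pmf \<Rightarrow> real measure \<Rightarrow> (nat list + nat list \<Rightarrow> real) measure" where
  "env_law p \<mu> = PiM brw_index (env_marginal p \<mu>)"

text \<open>Offspring numbers are real coordinates of the environment. Under \<open>env_law\<close>
  they are almost surely natural numbers, so rounding loses nothing.\<close>

definition root_offspring :: "(nat list + nat list \<Rightarrow> real) \<Rightarrow> nat" where
  "root_offspring z = nat \<lfloor>z (Inl [])\<rfloor>"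

definition child_step :: "nat \<Rightarrow> (nat list + nat list \<Rightarrow> real) \<Rightarrow> real" where
  "child_step i z = z (Inr [i])"

text \<open>Points of a product measure are extensional functions, hence the restriction. As
  \<open>Inr []\<close> is not an index, \<open>Inr [i]\<close> is not copied: the displacement of
  child i is kept apart from its subtree.\<close>

definition subtree_env :: "nat \<Rightarrow> (nat list + nat list \<Rightarrow> real) \<Rightarrow> nat list + nat list \<Rightarrow> real" where
  "subtree_env i z = (\<lambda>j\<in>brw_index. z (map_sum ((#) i) ((#) i) j))"

lemma brw_index_simps [simp]:
  "Inl v \<in> brw_index" "Inr v \<in> brw_index \<longleftrightarrow> v \<noteq> []" "brw_index \<noteq> {}"
  by (auto simp: brw_index_def)

lemma brw_index_shift [simp]: "j \<in> brw_index \<Longrightarrow> map_sum ((#) i) ((#) i) j \<in> brw_index"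
  by (cases j) auto

lemma prob_space_env_marginal:
  assumes "prob_space \<mu>"
  shows "prob_space (env_marginal p \<mu> j)"
  using assms
  by (auto simp: env_marginal_def split: sum.split intro!: prob_space.prob_space_distr prob_space_measure_pmf)

lemma sets_env_marginal [measurable_cong]:
  "sets \<mu> = sets borel \<Longrightarrow> sets (env_marginal p \<mu> j) = sets borel"
  by (auto simp: env_marginal_def split: sum.split)

lemma prob_space_env_law:
  "prob_space \<mu> \<Longrightarrow> prob_space (env_law p \<mu>)"
  unfolding env_law_def by (intro prob_space_PiM prob_space_env_marginal)

lemma sets_env_law [measurable_cong]:
  assumes "sets \<mu> = sets borel"
  shows "sets (env_law p \<mu>) = sets (PiM brw_index (\<lambda>_. borel))"
  unfolding env_law_def by (intro sets_PiM_cong refl sets_env_marginal assms)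

context
  fixes p :: "nat pmf" and \<mu> :: "real measure"
  assumes prob_mu: "prob_space \<mu>" and sets_mu [measurable_cong]: "sets \<mu> = sets borel"
begin

interpretation E: prob_space "env_law p \<mu>"
  by (rule prob_space_env_law) (rule prob_mu)

lemmas sets_env_law' [measurable_cong] = sets_env_law[OF sets_mu, of p]

lemma measurable_env_component:
  "j \<in> brw_index \<Longrightarrow> (\<lambda>z. z j) \<in> borel_measurable (env_law p \<mu>)"
  by measurable

lemma measurable_root_offspring [measurable]:
  "root_offspring \<in> measurable (env_law p \<mu>) (count_space UNIV)"
proof -
  have [measurable]: "(\<lambda>z. z (Inl [])) \<in> borel_measurable (env_law p \<mu>)"
    by (simp add: measurable_env_component)
  show ?thesis unfolding root_offspring_def[abs_def] by measurable
qed

lemma measurable_child_step [measurable]: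
  "child_step i \<in> borel_measurable (env_law p \<mu>)"
  unfolding child_step_def[abs_def] by (simp add: measurable_env_component)

lemma measurable_subtree_env [measurable]:
  "subtree_env i \<in> measurable (env_law p \<mu>) (env_law p \<mu>)"
proof -
  have "subtree_env i \<in> measurable (env_law p \<mu>) (PiM brw_index (\<lambda>_. borel))"
    unfolding subtree_env_def[abs_def] by (intro measurable_restrict measurable_env_component) simp
  then show ?thesis
    by (subst measurable_cong_sets[OF refl sets_env_law']) 
qed

text \<open>Prefixing labels by i is injective and keeps the two kinds of index apart. The marginals
  depend only on the kind, so the product measure reproduces itself.\<close>

lemma distr_subtree_env: "distr (env_law p \<mu>) (env_law p \<mu>) (subtree_env i) = env_law p \<mu>"
proof -
  let ?f = "map_sum ((#) i) ((#) i)"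
  have "distr (PiM brw_index (env_marginal p \<mu>)) (PiM brw_index (\<lambda>j. env_marginal p \<mu> (?f j)))
      (\<lambda>z. \<lambda>j\<in>brw_index. z (?f j)) = PiM brw_index (\<lambda>j. env_marginal p \<mu> (?f j))"
    by (rule distr_PiM_reindex)
      (auto intro!: prob_space_env_marginal prob_mu inj_onI simp: map_sum_def split: sum.splits)
  also have "(\<lambda>j. env_marginal p \<mu> (?f j)) = env_marginal p \<mu>"
    by (auto simp: fun_eq_iff env_marginal_def split: sum.splits)
  finally show ?thesis
    by (simp add: env_law_def subtree_env_def[abs_def] restrict_def)
qed

lemma distr_env_component:
  "j \<in> brw_index \<Longrightarrow> distr (env_law p \<mu>) borel (\<lambda>z. z j) = env_marginal p \<mu> j"
  using distr_PiM_component[of brw_index "env_marginal p \<mu>" j] prob_space_env_marginal[OF prob_mu]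
  by (simp add: env_law_def sets_env_marginal[OF sets_mu] cong: distr_cong)

lemma indep_env_components: "E.indep_vars (\<lambda>_. borel) (\<lambda>j z. z j) brw_index"
proof (subst E.indep_vars_iff_distr_eq_PiM')
  have "distr (env_law p \<mu>) (Pi\<^sub>M brw_index (\<lambda>_. borel)) (\<lambda>z. \<lambda>j\<in>brw_index. z j)
      = distr (env_law p \<mu>) (env_law p \<mu>) (\<lambda>z. z)"
    by (rule distr_cong) (auto simp: sets_env_law', auto simp: env_law_def space_PiM PiE_def extensional_restrict)
  also have "\<dots> = env_law p \<mu>" by (rule distr_id)
  also have "\<dots> = Pi\<^sub>M brw_index (\<lambda>i. distr (env_law p \<mu>) borel (\<lambda>z. z i))"
    unfolding env_law_def[of p \<mu>] by (intro PiM_cong refl) (simp add: distr_env_component[symmetric] env_law_def)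
  finally show "distr (env_law p \<mu>) (Pi\<^sub>M brw_index (\<lambda>_. borel)) (\<lambda>z. \<lambda>j\<in>brw_index. z j) = \<dots>" .
qed (auto simp: brw_index_simps)

text \<open>The branch \<^term>\<open>None\<close> carries the offspring number of the root, \<^term>\<open>Some i\<close> the
  displacement of its \<open>i\<close>-th child together with the environment of the subtree of that child.\<close>

definition branch_index :: "nat option \<Rightarrow> (nat list + nat list) set" where
  "branch_index k = (case k of None \<Rightarrow> {Inl []}
     | Some i \<Rightarrow> {Inr [i]} \<union> map_sum ((#) i) ((#) i) ` brw_index)"

lemma indep_branches:
  "E.indep_vars (\<lambda>k. PiM (branch_index k) (\<lambda>_. borel)) (\<lambda>k z. \<lambda>j\<in>branch_index k. z j) UNIV"
proof (rule E.indep_vars_restrict[OF indep_env_components])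
  show "branch_index k \<subseteq> brw_index" for k
    by (auto simp: branch_index_def split: option.splits)
  show "disjoint_family_on branch_index UNIV"
    by (auto simp: disjoint_family_on_def branch_index_def brw_index_def split: option.splits)
qed

text \<open>The coordinate \<open>Inr [i]\<close> would be the image of the missing index
  \<open>Inr []\<close>, so it is disjoint from the coordinates of the subtree and the joint law
  factorises.\<close>

lemma distr_child_pair:
  "distr (env_law p \<mu>) (\<mu> \<Otimes>\<^sub>M env_law p \<mu>) (\<lambda>z. (child_step i z, subtree_env i z)) = \<mu> \<Otimes>\<^sub>M env_law p \<mu>"
proof -
  let ?E = "env_law p \<mu>" and ?f = "map_sum ((#) i) ((#) i)"
  let ?A = "{Inr [i] :: nat list + nat list}" and ?B = "?f ` brw_index"
  let ?PA = "PiM ?A (\<lambda>_. borel :: real measure)" and ?PB = "PiM ?B (\<lambda>_. borel :: real measure)"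
  let ?rA = "\<lambda>z :: nat list + nat list \<Rightarrow> real. \<lambda>j\<in>?A. z j" and ?rB = "\<lambda>z :: nat list + nat list \<Rightarrow> real. \<lambda>j\<in>?B. z j"
  let ?hA = "\<lambda>g :: nat list + nat list \<Rightarrow> real. g (Inr [i])"
  let ?hB = "\<lambda>g :: nat list + nat list \<Rightarrow> real. \<lambda>j\<in>brw_index. g (?f j)"
  have indep: "E.indep_var ?PA ?rA ?PB ?rB"
    by (rule E.indep_var_restrict[OF indep_env_components]) (auto simp: brw_index_def)
  note rA [measurable] = E.indep_var_rv1[OF indep] and rB [measurable] = E.indep_var_rv2[OF indep]
  have hA [measurable]: "?hA \<in> ?PA \<rightarrow>\<^sub>M \<mu>"
    by (subst measurable_cong_sets[OF refl sets_mu]) measurable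
  have hB [measurable]: "?hB \<in> ?PB \<rightarrow>\<^sub>M ?E"
    by (subst measurable_cong_sets[OF refl sets_env_law'])
      (intro measurable_restrict measurable_component_singleton, auto)
  have A: "distr (distr ?E ?PA ?rA) \<mu> ?hA = \<mu>"
    using distr_env_component[of "Inr [i]"]
    by (subst distr_distr) (simp_all add: env_marginal_def comp_def sets_mu cong: distr_cong)
  have hrB: "?hB (?rB z) = subtree_env i z" for z
    by (auto simp: subtree_env_def fun_eq_iff restrict_def)
  have B: "distr (distr ?E ?PB ?rB) ?E ?hB = ?E"
    by (subst distr_distr) (simp_all add: comp_def hrB distr_subtree_env del: restrict_apply)
  have "\<mu> \<Otimes>\<^sub>M ?E = distr (distr ?E ?PA ?rA) \<mu> ?hA \<Otimes>\<^sub>M distr (distr ?E ?PB ?rB) ?E ?hB"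
    by (simp only: A B)
  also have "\<dots> = distr (distr ?E ?PA ?rA \<Otimes>\<^sub>M distr ?E ?PB ?rB) (\<mu> \<Otimes>\<^sub>M ?E) (\<lambda>(x, y). (?hA x, ?hB y))"
    by (rule pair_measure_distr)
      (simp_all only: B measurable_distr_eq1 hA hB prob_space_imp_sigma_finite E.prob_space_axioms)
  also have "distr ?E ?PA ?rA \<Otimes>\<^sub>M distr ?E ?PB ?rB = distr ?E (?PA \<Otimes>\<^sub>M ?PB) (\<lambda>z. (?rA z, ?rB z))"
    using indep by (simp add: E.indep_var_distribution_eq)
  also have "distr (distr ?E (?PA \<Otimes>\<^sub>M ?PB) (\<lambda>z. (?rA z, ?rB z))) (\<mu> \<Otimes>\<^sub>M ?E) (\<lambda>(x, y). (?hA x, ?hB y))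
      = distr ?E (\<mu> \<Otimes>\<^sub>M ?E) (\<lambda>z. (?hA (?rA z), ?hB (?rB z)))"
    by (subst distr_distr) (simp_all add: comp_def del: restrict_apply)
  also have "\<dots> = distr ?E (\<mu> \<Otimes>\<^sub>M ?E) (\<lambda>z. (child_step i z, subtree_env i z))"
    by (simp only: hrB) (simp add: child_step_def[abs_def])
  finally show ?thesis by simp
qed

lemma distr_root_offspring: "distr (env_law p \<mu>) (count_space UNIV) root_offspring = measure_pmf p"
proof -
  have "distr (env_law p \<mu>) (count_space UNIV) root_offspring
      = distr (distr (env_law p \<mu>) borel (\<lambda>z. z (Inl []))) (count_space UNIV) (\<lambda>x. nat \<lfloor>x\<rfloor>)"
    by (subst distr_distr) (simp_all add: root_offspring_def[abs_def] comp_def)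
  also have "\<dots> = distr (distr (measure_pmf p) borel real) (count_space UNIV) (\<lambda>x. nat \<lfloor>x\<rfloor>)"
    by (simp add: distr_env_component env_marginal_def)
  also have "\<dots> = distr (measure_pmf p) (count_space UNIV) (\<lambda>k. nat \<lfloor>real k\<rfloor>)"
    by (subst distr_distr) (simp_all add: comp_def)
  also have "\<dots> = measure_pmf p"
    by (simp add: distr_id2)
  finally show ?thesis .
qed

text \<open>The random number of factors is resolved by summing over its value n: for fixed n, the
  event that the root has n children and the n child factors live on disjoint branches. The weight
  \<open>c\<close> is 1 for generating functions and an indicator when exactly b children are
  demanded.\<close>

theorem nn_integral_branching:
  fixes c :: "nat \<Rightarrow> ennreal" and g :: "real \<times> (nat list + nat list \<Rightarrow> real) \<Rightarrow> ennreal"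
  assumes [measurable]: "g \<in> borel_measurable (\<mu> \<Otimes>\<^sub>M env_law p \<mu>)"
  shows "(\<integral>\<^sup>+z. c (root_offspring z)
             * (\<Prod>i<root_offspring z. g (child_step i z, subtree_env i z)) \<partial>env_law p \<mu>)
       = (\<integral>\<^sup>+k. c k * (\<integral>\<^sup>+y. g y \<partial>(\<mu> \<Otimes>\<^sub>M env_law p \<mu>)) ^ k \<partial>measure_pmf p)"
proof -
  let ?E = "env_law p \<mu>"
  let ?G = "\<integral>\<^sup>+y. g y \<partial>(\<mu> \<Otimes>\<^sub>M env_law p \<mu>)"
  define F :: "nat \<Rightarrow> nat option \<Rightarrow> (nat list + nat list \<Rightarrow> real) \<Rightarrow> ennreal" where
    "F n k z = (case k of None \<Rightarrow> indicator {n} (root_offspring z)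
        | Some i \<Rightarrow> g (child_step i z, subtree_env i z))" for n k z
  have F_indep: "E.indep_vars (\<lambda>_. borel) (F n) UNIV" for n
  proof -
    \<comment> \<open>\<open>H\<close> computes each factor from the coordinates of its own branch,
      which transfers independence from branches to factors.\<close>
    define H :: "nat option \<Rightarrow> (nat list + nat list \<Rightarrow> real) \<Rightarrow> ennreal" where
      "H k f = (case k of None \<Rightarrow> indicator {n} (nat \<lfloor>f (Inl [])\<rfloor>)
        | Some i \<Rightarrow> g (f (Inr [i]), \<lambda>j\<in>brw_index. f (map_sum ((#) i) ((#) i) j)))" for k f
    have H: "H k \<in> borel_measurable (PiM (branch_index k) (\<lambda>_. borel))" for k
    proof (cases k)
      case None
      have "(\<lambda>f :: nat list + nat list \<Rightarrow> real. f (Inl [])) \<in> borel_measurable (PiM {Inl []} (\<lambda>_. borel))"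
        by (rule measurable_component_singleton) simp
      then have "(\<lambda>f :: nat list + nat list \<Rightarrow> real. nat \<lfloor>f (Inl [])\<rfloor>) \<in> PiM {Inl []} (\<lambda>_. borel) \<rightarrow>\<^sub>M count_space UNIV"
        by measurable
      then have "(\<lambda>f :: nat list + nat list \<Rightarrow> real. indicator {n} (nat \<lfloor>f (Inl [])\<rfloor>) :: ennreal)
          \<in> borel_measurable (PiM {Inl []} (\<lambda>_. borel))"
        by (rule measurable_compose) simp
      then show ?thesis by (simp only: H_def[abs_def] None option.case branch_index_def)
    next
      case (Some i)
      have "(\<lambda>f. (f (Inr [i]), \<lambda>j\<in>brw_index. f (map_sum ((#) i) ((#) i) j)))
          \<in> PiM (branch_index k) (\<lambda>_. borel) \<rightarrow>\<^sub>M \<mu> \<Otimes>\<^sub>M ?E"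
      proof (rule measurable_Pair)
        show "(\<lambda>f. f (Inr [i])) \<in> PiM (branch_index k) (\<lambda>_. borel) \<rightarrow>\<^sub>M \<mu>"
          by (subst measurable_cong_sets[OF refl sets_mu]) (simp add: Some branch_index_def)
        show "(\<lambda>f. \<lambda>j\<in>brw_index. f (map_sum ((#) i) ((#) i) j)) \<in> PiM (branch_index k) (\<lambda>_. borel) \<rightarrow>\<^sub>M ?E"
          by (subst measurable_cong_sets[OF refl sets_env_law'])
            (intro measurable_restrict measurable_component_singleton, auto simp: Some branch_index_def)
      qed
      then show ?thesis unfolding H_def[abs_def] Some by simp
    qed
    have "(\<lambda>k z. H k (\<lambda>j\<in>branch_index k. z j)) = F n"
      by (auto simp: H_def F_def fun_eq_iff branch_index_def root_offspring_def child_step_def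
          subtree_env_def restrict_def image_iff Bex_def intro!: arg_cong[of _ _ g] split: option.splits)
    with E.indep_vars_compose2[OF indep_branches H] show ?thesis by simp
  qed
  have F_meas [measurable]: "F n k \<in> borel_measurable ?E" for n k
    using F_indep[of n] unfolding E.indep_vars_def by blast
  have F_None: "(\<integral>\<^sup>+z. F n None z \<partial>?E) = pmf p n" for n
  proof -
    have "(\<integral>\<^sup>+z. F n None z \<partial>?E) = (\<integral>\<^sup>+k. indicator {n} k \<partial>distr ?E (count_space UNIV) root_offspring)"
      by (subst nn_integral_distr) (simp_all add: F_def[abs_def])
    then show ?thesis by (simp add: distr_root_offspring emeasure_pmf_single)
  qed
  have F_Some: "(\<integral>\<^sup>+z. F n (Some i) z \<partial>?E) = ?G" for n i
  proof -
    have "(\<integral>\<^sup>+z. F n (Some i) z \<partial>?E)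
        = (\<integral>\<^sup>+y. g y \<partial>distr ?E (\<mu> \<Otimes>\<^sub>M ?E) (\<lambda>z. (child_step i z, subtree_env i z)))"
      by (subst nn_integral_distr) (simp_all add: F_def[abs_def])
    then show ?thesis by (simp only: distr_child_pair)
  qed
  have g_meas [measurable]: "(\<lambda>z. g (child_step i z, subtree_env i z)) \<in> borel_measurable ?E" for i
    by measurable
  have level_meas: "(\<lambda>z. indicator {n} (root_offspring z) * (\<Prod>i<n. g (child_step i z, subtree_env i z)))
      \<in> borel_measurable ?E" for n
    by (intro borel_measurable_times_ennreal borel_measurable_prod_ennreal g_meas
        measurable_compose[OF measurable_root_offspring]) simp
  have level: "(\<integral>\<^sup>+z. indicator {n} (root_offspring z) * (\<Prod>i<n. g (child_step i z, subtree_env i z)) \<partial>?E)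
      = pmf p n * ?G ^ n" for n
  proof -
    let ?K = "insert None (Some ` {..<n})"
    have "(\<integral>\<^sup>+z. (\<Prod>k\<in>?K. F n k z) \<partial>?E) = (\<Prod>k\<in>?K. \<integral>\<^sup>+z. F n k z \<partial>?E)"
      by (rule E.indep_vars_nn_integral) (auto intro: E.indep_vars_subset[OF F_indep])
    also have "\<dots> = pmf p n * ?G ^ n"
      by (subst prod.insert) (auto simp: prod.reindex F_None F_Some)
    also have "(\<lambda>z. \<Prod>k\<in>?K. F n k z)
       = (\<lambda>z. indicator {n} (root_offspring z) * (\<Prod>i<n. g (child_step i z, subtree_env i z)))"
      by (subst prod.insert) (auto simp: prod.reindex F_def fun_eq_iff)
    finally show ?thesis .
  qed
  have "(\<integral>\<^sup>+z. c (root_offspring z) * (\<Prod>i<root_offspring z. g (child_step i z, subtree_env i z)) \<partial>?E)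
      = (\<integral>\<^sup>+z. (\<Sum>n. c n * (indicator {n} (root_offspring z) * (\<Prod>i<n. g (child_step i z, subtree_env i z)))) \<partial>?E)"
  proof (rule nn_integral_cong)
    fix z
    have "(\<Sum>n. c n * (indicator {n} (root_offspring z) * (\<Prod>i<n. g (child_step i z, subtree_env i z))))
       = (\<Sum>n\<in>{root_offspring z}. c n * (indicator {n} (root_offspring z) * (\<Prod>i<n. g (child_step i z, subtree_env i z))))"
      by (rule suminf_finite) auto
    then show "c (root_offspring z) * (\<Prod>i<root_offspring z. g (child_step i z, subtree_env i z)) =
        (\<Sum>n. c n * (indicator {n} (root_offspring z) * (\<Prod>i<n. g (child_step i z, subtree_env i z))))"
      by simp
  qed
  also have "\<dots> = (\<Sum>n. c n * (pmf p n * ?G ^ n))"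
    by (simp add: nn_integral_suminf nn_integral_cmult level_meas borel_measurable_times_ennreal level)
  also have "\<dots> = (\<integral>\<^sup>+k. ennreal (pmf p k) * (c k * ?G ^ k) \<partial>count_space UNIV)"
    by (simp add: nn_integral_count_space_nat mult_ac)
  also have "\<dots> = (\<integral>\<^sup>+k. c k * ?G ^ k \<partial>measure_pmf p)"
    by (subst nn_integral_measure_pmf) simp
  finally show ?thesis .
qed

end

section \<open>Iterating the recursion for the small values\<close>

text \<open>Mean value theorem with a monotone derivative. It converts the levels
  \<open>\<kappa>' * k powr \<gamma>\<close> into increments of order k^(1/\<alpha>);
  differentiability is taken in the open interval only, so that x = 0 is covered.\<close>

lemma powr_diff_bounds:
  fixes x \<gamma> :: real
  assumes "x \<ge> 0" "\<gamma> > 1"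
  shows "\<gamma> * x powr (\<gamma> - 1) \<le> (x + 1) powr \<gamma> - x powr \<gamma>"
    and "(x + 1) powr \<gamma> - x powr \<gamma> \<le> \<gamma> * (x + 1) powr (\<gamma> - 1)"
proof -
  have d: "((\<lambda>t. t powr \<gamma>) has_real_derivative \<gamma> * y powr (\<gamma> - 1)) (at y)" if "x < y" for y
    using assms that by (auto intro!: derivative_eq_intros)
  have "\<exists>l z. x < z \<and> z < x + 1 \<and> DERIV (\<lambda>t. t powr \<gamma>) z :> l
      \<and> (x + 1) powr \<gamma> - x powr \<gamma> = (x + 1 - x) * l"
  proof (rule MVT)
    show "continuous_on {x..x + 1} (\<lambda>t. t powr \<gamma>)"
      using assms by (intro continuous_on_powr' continuous_intros) auto
    show "(\<lambda>t. t powr \<gamma>) differentiable (at y)" if "x < y" "y < x + 1" for y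
      using d[OF that(1)] by (auto simp: real_differentiable_def)
  qed simp
  then obtain l z where z0: "x < z" "z < x + 1" "DERIV (\<lambda>t. t powr \<gamma>) z :> l"
    "(x + 1) powr \<gamma> - x powr \<gamma> = (x + 1 - x) * l"
    by blast
  then have z: "x < z" "z < x + 1" "(x + 1) powr \<gamma> - x powr \<gamma> = \<gamma> * z powr (\<gamma> - 1)"
    using DERIV_unique[OF z0(3) d[OF z0(1)]] by simp_all
  have "x powr (\<gamma> - 1) \<le> z powr (\<gamma> - 1)" "z powr (\<gamma> - 1) \<le> (x + 1) powr (\<gamma> - 1)"
    using z assms by (auto intro!: powr_mono2)
  then show "\<gamma> * x powr (\<gamma> - 1) \<le> (x + 1) powr \<gamma> - x powr \<gamma>"
    "(x + 1) powr \<gamma> - x powr \<gamma> \<le> \<gamma> * (x + 1) powr (\<gamma> - 1)"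
    using z(3) assms by (auto intro!: mult_left_mono)
qed

text \<open>Here \<open>q L\<close> stands for the probability that the limit is below \<open>exp (- L)\<close> and \<open>T z\<close> for the
  probability of a displacement below \<open>- z\<close>; a displacement \<open>- z\<close> contributes \<open>v = \<theta> (z + s)\<close> to \<open>L\<close>.
  With \<open>L\<close> growing like \<open>\<kappa>' k powr \<gamma>\<close> the increments are \<open>\<kappa>' \<gamma> k powr (1 / \<alpha>)\<close>, so \<open>\<kappa>\<close> below is the constant
  for which the cost of the \<open>k\<close>-th increment is \<open>exp (- b\<^sup>k)\<close>.\<close>

locale tail_recursion =
  fixes q T :: "real \<Rightarrow> real" and b :: nat and \<alpha> \<theta> s c\<^sub>0 c\<^sub>1 c\<^sub>2 z\<^sub>0 :: real
  assumes b2: "b \<ge> 2" and \<alpha>: "\<alpha> > 0" and \<theta>: "\<theta> > 0"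
    and c0: "c\<^sub>0 > 0" and c1: "c\<^sub>1 > 0" and c2: "c\<^sub>2 > 0"
    and q_antimono: "antimono q"
    and q_nonneg: "\<And>L. 0 \<le> q L"
    and q_vanish: "(q \<longlongrightarrow> 0) at_top"
    and q_pos_somewhere: "\<exists>L. q L > 0"
    and T_nonneg: "\<And>z. 0 \<le> T z"
    and T_upper: "\<And>z. z \<ge> z\<^sub>0 \<Longrightarrow> T z \<le> c\<^sub>2 * exp (- exp (z powr \<alpha>))"
    and T_lower: "\<And>z. z \<ge> z\<^sub>0 \<Longrightarrow> c\<^sub>1 * exp (- exp (z powr \<alpha>)) \<le> T z"
    and rec_upper: "\<And>L v. q L \<le> (q (L - v) + T (v / \<theta> - s)) ^ b"
    and rec_lower: "\<And>L v. c\<^sub>0 * (T (v / \<theta> - s) * q (L - v + ln (real b))) ^ b \<le> q L"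
begin

text \<open>\<open>\<gamma>\<close> is the exponent with which the sum of j^(1/\<alpha>) over j
  \<le> k grows, and its inverse is \<alpha> / (\<alpha> + 1). The division by
  \<open>\<gamma>\<close> in \<open>\<kappa>\<close> is the constant of that sum.\<close>

definition "\<gamma> = 1 + 1 / \<alpha>"
definition "\<kappa> = \<theta> * ln b powr (1 / \<alpha>) / \<gamma>"

lemma \<gamma>_gt_1: "\<gamma> > 1" and \<gamma>_minus: "\<gamma> - 1 = 1 / \<alpha>"
  using \<alpha> by (auto simp: \<gamma>_def)

lemma ln_b_pos: "ln (real b) > 0"
  using b2 by auto

lemma \<kappa>_pos: "\<kappa> > 0"
  using \<gamma>_gt_1 \<theta> ln_b_pos by (simp add: \<kappa>_def)

text \<open>One use of the lower recursion, with v so large that the tail bound applies and the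
  remaining level drops below one where \<open>q\<close> is known to be positive. Positivity is what
  permits logarithms of \<open>q\<close> at every level.\<close>

lemma q_pos: "q L > 0"
proof -
  obtain L1 where L1: "q L1 > 0" using q_pos_somewhere by auto
  define v where "v = max (\<theta> * (z\<^sub>0 + s)) (L - L1 + ln b)"
  have "v \<ge> \<theta> * (z\<^sub>0 + s)" by (simp add: v_def)
  then have "v / \<theta> - s \<ge> z\<^sub>0" using \<theta> by (simp add: field_simps)
  then have "T (v / \<theta> - s) > 0" using T_lower[of "v / \<theta> - s"] c1
    by (smt (verit) exp_gt_zero mult_pos_pos)
  moreover have "q (L - v + ln b) \<ge> q L1"
    by (intro antimonoD[OF q_antimono]) (auto simp: v_def)
  ultimately have "0 < c\<^sub>0 * (T (v / \<theta> - s) * q (L - v + ln b)) ^ b"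
    using L1 c0 by simp
  with rec_lower[of v L] show ?thesis by linarith
qed

text \<open>For \<kappa>' > \<kappa> the increments are long enough that a displacement covering one
  of them costs at least exp (- b^k). Both ways to be small, through the subtree or through the
  displacement, then obey the same bound.\<close>

lemma q_upper_sequence:
  assumes "\<kappa>' > \<kappa>"
  obtains L0 :: real and n0 :: nat
  where "L0 \<ge> 0" "\<And>k::nat. q (L0 + \<kappa>' * (real k + real n0) powr \<gamma>) \<le> exp (- (real b ^ k + 2))"
proof -
  let ?\<beta> = "1 / \<alpha>"
  have \<kappa>': "\<kappa>' > 0" using assms \<kappa>_pos by linarith
  \<comment> \<open>The surplus of \<kappa>' over \<kappa>, per unit of k^(1/\<alpha>); for large k
    it absorbs the constant shift \<open>s\<close>.\<close>
  define \<rho> where "\<rho> = \<kappa>' * \<gamma> / \<theta> - ln b powr ?\<beta>"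
  have \<rho>: "\<rho> > 0" using assms \<theta> \<gamma>_gt_1 by (auto simp: \<rho>_def \<kappa>_def field_simps)
  have "eventually (\<lambda>n::nat. \<rho> * real n powr ?\<beta> \<ge> \<bar>s\<bar>) at_top"
    using \<rho> \<alpha> by real_asymp
  moreover have "eventually (\<lambda>n::nat. (ln b * real n) powr ?\<beta> \<ge> max 0 z\<^sub>0) at_top"
    using ln_b_pos \<alpha> by real_asymp
  \<comment> \<open>The offset n0 multiplies b^k in the tail exponent by b^n0. Having 3 plus the
    logarithmic term there leaves room for b^k, for the constant 2 and for the factor
    \<open>c\<^sub>2\<close>.\<close>
  moreover have "eventually (\<lambda>n::nat. exp (ln b * real n) \<ge> 3 + \<bar>ln c\<^sub>2\<bar>) at_top"
    using ln_b_pos by real_asymp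
  ultimately have "eventually (\<lambda>n::nat. \<rho> * real n powr ?\<beta> \<ge> \<bar>s\<bar> \<and> (ln b * real n) powr ?\<beta> \<ge> max 0 z\<^sub>0
      \<and> exp (ln b * real n) \<ge> 3 + \<bar>ln c\<^sub>2\<bar>) at_top"
    by (intro eventually_conj)
  then obtain n0 :: nat where n0: "\<rho> * real n0 powr ?\<beta> \<ge> \<bar>s\<bar>" "(ln b * real n0) powr ?\<beta> \<ge> max 0 z\<^sub>0"
    "exp (ln b * real n0) \<ge> 3 + \<bar>ln c\<^sub>2\<bar>"
    using eventually_happens' sequentially_bot by blast
  \<comment> \<open>The exponent 3 is b^0 + 2, the start of the induction.\<close>
  have "eventually (\<lambda>L. q L < exp (-3)) at_top"
    using q_vanish by (rule order_tendstoD) simp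
  then have "eventually (\<lambda>L. q L < exp (-3) \<and> L \<ge> 0) at_top"
    using eventually_ge_at_top by (rule eventually_conj)
  then obtain L0 where L0: "q L0 < exp (-3)" "L0 \<ge> 0"
    using eventually_happens' trivial_limit_at_top_linorder by blast
  define L where "L k = L0 + \<kappa>' * (real k + real n0) powr \<gamma>" for k :: nat
  have "q (L k) \<le> exp (- (real b ^ k + 2))" for k
  proof (induction k)
    case 0
    have "q (L 0) \<le> q L0"
      using \<kappa>' by (intro antimonoD[OF q_antimono]) (simp add: L_def)
    then show ?case using L0 by simp
  next
    case (Suc k)
    define v where "v = L (Suc k) - L k"
    define x where "x = real k + real n0"
    have x: "x \<ge> real n0" "x \<ge> 0" by (auto simp: x_def)
    have "v = \<kappa>' * ((x + 1) powr \<gamma> - x powr \<gamma>)"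
      by (simp add: v_def L_def x_def algebra_simps)
    also have "\<dots> \<ge> \<kappa>' * (\<gamma> * x powr ?\<beta>)"
      using powr_diff_bounds(1)[OF x(2) \<gamma>_gt_1] \<kappa>' by (simp add: \<gamma>_minus)
    finally have "\<kappa>' * (\<gamma> * x powr ?\<beta>) / \<theta> \<le> v / \<theta>"
      using \<theta> by (intro divide_right_mono) auto
    then have "v / \<theta> - s \<ge> (\<kappa>' * \<gamma> / \<theta>) * x powr ?\<beta> - \<bar>s\<bar>"
      by (simp add: mult.assoc)
    also have "(\<kappa>' * \<gamma> / \<theta>) * x powr ?\<beta> - \<bar>s\<bar> = (ln b powr ?\<beta>) * x powr ?\<beta> + (\<rho> * x powr ?\<beta> - \<bar>s\<bar>)"
      by (simp add: \<rho>_def algebra_simps)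
    also have "\<dots> \<ge> (ln b * x) powr ?\<beta>"
    proof -
      have "real n0 powr ?\<beta> \<le> x powr ?\<beta>" using x \<alpha> by (intro powr_mono2) auto
      then have "\<rho> * real n0 powr ?\<beta> \<le> \<rho> * x powr ?\<beta>" using \<rho> by simp
      then have "\<rho> * x powr ?\<beta> \<ge> \<bar>s\<bar>" using n0(1) by linarith
      then show ?thesis using ln_b_pos x by (simp add: powr_mult)
    qed
    finally have z: "v / \<theta> - s \<ge> (ln b * x) powr ?\<beta>" .
    have "(ln b * real n0) powr ?\<beta> \<le> (ln b * x) powr ?\<beta>"
      using x \<alpha> ln_b_pos by (intro powr_mono2) auto
    with z n0(2) have z0: "v / \<theta> - s \<ge> z\<^sub>0" "v / \<theta> - s \<ge> 0" by linarith+
    have "ln b * x = ((ln b * x) powr ?\<beta>) powr \<alpha>"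
      using \<alpha> ln_b_pos x by (simp add: powr_powr)
    also have "\<dots> \<le> (v / \<theta> - s) powr \<alpha>"
      using z \<alpha> by (intro powr_mono2) auto
    finally have "exp (ln b * x) \<le> exp ((v / \<theta> - s) powr \<alpha>)" by simp
    moreover have "exp (ln b * x) = real b ^ k * exp (ln b * real n0)"
      using b2 by (simp add: x_def ring_distribs exp_add exp_of_nat2_mult[symmetric] exp_of_nat_mult[symmetric] ln_realpow[symmetric] mult.commute)
    moreover have "real b ^ k * (3 + \<bar>ln c\<^sub>2\<bar>) \<le> real b ^ k * exp (ln b * real n0)"
      using n0(3) by (intro mult_left_mono) auto
    moreover have "real b ^ k + (2 + \<bar>ln c\<^sub>2\<bar>) \<le> real b ^ k * (3 + \<bar>ln c\<^sub>2\<bar>)"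
    proof -
      have "1 * (2 + \<bar>ln c\<^sub>2\<bar>) \<le> real b ^ k * (2 + \<bar>ln c\<^sub>2\<bar>)"
        using b2 by (intro mult_right_mono) auto
      then show ?thesis by (simp add: algebra_simps)
    qed
    ultimately have e: "exp ((v / \<theta> - s) powr \<alpha>) \<ge> real b ^ k + 2 + ln c\<^sub>2"
      by linarith
    have "T (v / \<theta> - s) \<le> c\<^sub>2 * exp (- exp ((v / \<theta> - s) powr \<alpha>))"
      by (rule T_upper[OF z0(1)])
    also have "\<dots> = exp (ln c\<^sub>2 - exp ((v / \<theta> - s) powr \<alpha>))"
      using c2 by (simp add: exp_diff exp_minus field_simps)
    also have "\<dots> \<le> exp (- (real b ^ k + 2))" using e by simp
    finally have T: "T (v / \<theta> - s) \<le> exp (- (real b ^ k + 2))" .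
    have "q (L (Suc k)) \<le> (q (L (Suc k) - v) + T (v / \<theta> - s)) ^ b" by (rule rec_upper)
    also have "\<dots> \<le> (2 * exp (- (real b ^ k + 2))) ^ b"
      using Suc T T_nonneg q_nonneg by (intro power_mono add_nonneg_nonneg) (auto simp: v_def)
    also have "\<dots> = exp (real b * (ln 2 - (real b ^ k + 2)))"
    proof -
      have "2 * exp (- (real b ^ k + 2)) = exp (ln 2 - (real b ^ k + 2))"
        by (simp only: exp_diff exp_minus) (simp add: divide_inverse)
      then show ?thesis by (simp only: exp_of_nat_mult)
    qed
    \<comment> \<open>This is why the claim carries the constant 2: the power b turns 2 - ln 2 into
      b (2 - ln 2), which is again at least 2.\<close>
    also have "\<dots> \<le> exp (- (real b ^ Suc k + 2))"
    proof -
      have "2 * (1::real) \<le> real b * (2 - ln 2)"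
        using b2 ln_2_less_1 by (intro mult_mono) auto
      then show ?thesis by (simp add: algebra_simps)
    qed
    finally show ?case .
  qed
  then show ?thesis using L0 that unfolding L_def by blast
qed

text \<open>By monotonicity of \<open>q\<close> the bound along the sequence extends to every large
  L, rounding down to the last level of the sequence below L.\<close>

lemma eventually_rate_lower:
  assumes "\<kappa>' > \<kappa>" "a < ln b * \<kappa>' powr (- (1 / \<gamma>))"
  shows "eventually (\<lambda>L. a < ln (- ln (q L)) / L powr (1 / \<gamma>)) at_top"
proof -
  obtain L0 n0 where L0: "L0 \<ge> 0" and seq: "\<And>k::nat. q (L0 + \<kappa>' * (real k + real n0) powr \<gamma>) \<le> exp (- (real b ^ k + 2))"
    using q_upper_sequence[OF assms(1)] by blast
  have \<kappa>': "\<kappa>' > 0" using assms \<kappa>_pos by linarith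
  \<comment> \<open>The power 1/\<gamma> inverts the sequence of levels. The offset n0 and the loss
    1 from rounding vanish after division by L^(1/\<gamma>).\<close>
  define h where "h L = (((L - L0) / \<kappa>') powr (1 / \<gamma>) - real n0 - 1) * ln b" for L
  have "eventually (\<lambda>L. h L \<le> ln (- ln (q L))) at_top"
  proof -
    have "eventually (\<lambda>L. ((L - L0) / \<kappa>') powr (1 / \<gamma>) \<ge> real n0 + 1) at_top"
      using \<kappa>' \<gamma>_gt_1 by real_asymp
    moreover have "eventually (\<lambda>L. L \<ge> L0) at_top" by (rule eventually_ge_at_top)
    ultimately show ?thesis
    proof eventually_elim
      case (elim L)
      define y where "y = ((L - L0) / \<kappa>') powr (1 / \<gamma>)"
      define k where "k = nat \<lfloor>y\<rfloor> - n0"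
      have fl: "y - 1 < real (nat \<lfloor>y\<rfloor>)" "real (nat \<lfloor>y\<rfloor>) \<le> y"
        using elim(1) unfolding y_def[symmetric] by linarith+
      have "n0 \<le> nat \<lfloor>y\<rfloor>" using elim(1) unfolding y_def[symmetric] by linarith
      then have k: "real k + real n0 = real (nat \<lfloor>y\<rfloor>)" by (simp add: k_def)
      have "\<kappa>' * (real k + real n0) powr \<gamma> \<le> \<kappa>' * y powr \<gamma>"
        using fl \<kappa>' \<gamma>_gt_1 by (intro mult_left_mono powr_mono2) (auto simp: k)
      also have "\<dots> = L - L0"
        using \<kappa>' \<gamma>_gt_1 elim(2) by (simp add: y_def powr_powr)
      finally have "q L \<le> q (L0 + \<kappa>' * (real k + real n0) powr \<gamma>)"
        by (intro antimonoD[OF q_antimono]) simp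
      also have "\<dots> \<le> exp (- (real b ^ k + 2))" by (rule seq)
      finally have "ln (q L) \<le> - (real b ^ k + 2)"
        using q_pos[of L] by (metis ln_exp ln_mono)
      then have "- ln (q L) \<ge> real b ^ k" by linarith
      then have "ln (- ln (q L)) \<ge> ln (real b ^ k)"
        using b2 by (intro ln_mono) auto
      moreover have "ln (real b ^ k) \<ge> h L"
        unfolding h_def y_def[symmetric] using k fl(1) ln_b_pos b2
        by (subst ln_realpow) (auto intro!: mult_right_mono)
      ultimately show ?case by linarith
    qed
  qed
  moreover have "((\<lambda>L. h L / L powr (1 / \<gamma>)) \<longlongrightarrow> ln b * \<kappa>' powr (- (1 / \<gamma>))) at_top"
    unfolding h_def using \<kappa>' \<gamma>_gt_1 ln_b_pos by (real_asymp simp: powr_minus powr_divide field_simps)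
  then have "eventually (\<lambda>L. a < h L / L powr (1 / \<gamma>)) at_top"
    using assms(2) by (rule order_tendstoD)
  moreover have "eventually (\<lambda>L::real. L > 0) at_top" by (rule eventually_gt_at_top)
  ultimately show ?thesis
    by eventually_elim (auto elim!: order.strict_trans2 intro!: divide_right_mono)
qed

text \<open>Step k adds a cost of order b^(k+1) and multiplies the earlier cost by b, so all steps
  contribute equally to the total; this is the factor k + 1. It is invisible after two
  logarithms.\<close>

lemma q_lower_sequence:
  assumes "0 < \<kappa>'" "\<kappa>' < \<kappa>"
  obtains K :: real and k0 :: nat
  where "K > 0" "\<And>k. k \<ge> k0 \<Longrightarrow> - ln (q (\<kappa>' * real k powr \<gamma>)) \<le> K * (real k + 1) * real b ^ k"
proof -
  let ?\<beta> = "1 / \<alpha>"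
  \<comment> \<open>Here \<kappa>' falls short of \<kappa>, and the deficit pays for the shift
    \<open>s\<close> and for the extra ln b / \<theta> of the lower recursion.\<close>
  define \<rho> where "\<rho> = ln b powr ?\<beta> - \<kappa>' * \<gamma> / \<theta>"
  have \<rho>: "\<rho> > 0" using assms \<theta> \<gamma>_gt_1 by (auto simp: \<rho>_def \<kappa>_def field_simps)
  have "eventually (\<lambda>k::nat. \<rho> * (real k + 1) powr ?\<beta> \<ge> ln b / \<theta> + \<bar>s\<bar>) at_top"
    using \<rho> \<alpha> by real_asymp
  moreover have "eventually (\<lambda>k::nat. \<kappa>' * \<gamma> / \<theta> * real k powr ?\<beta> - \<bar>s\<bar> \<ge> max 0 z\<^sub>0) at_top"
    using \<alpha> assms \<theta> \<gamma>_gt_1 by real_asymp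
  ultimately have "eventually (\<lambda>k::nat. \<rho> * (real k + 1) powr ?\<beta> \<ge> ln b / \<theta> + \<bar>s\<bar>
      \<and> \<kappa>' * \<gamma> / \<theta> * real k powr ?\<beta> - \<bar>s\<bar> \<ge> max 0 z\<^sub>0) at_top"
    by (rule eventually_conj)
  then obtain k0 :: nat where k0: "\<And>k. k \<ge> k0 \<Longrightarrow> \<rho> * (real k + 1) powr ?\<beta> \<ge> ln b / \<theta> + \<bar>s\<bar>"
    "\<And>k. k \<ge> k0 \<Longrightarrow> \<kappa>' * \<gamma> / \<theta> * real k powr ?\<beta> - \<bar>s\<bar> \<ge> max 0 z\<^sub>0"
    unfolding eventually_at_top_linorder by blast
  define L where "L k = \<kappa>' * real k powr \<gamma>" for k :: nat
  \<comment> \<open>The first three terms bound the cost added in one step: two prefactors and the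
    tail exponent. The last one covers the starting level.\<close>
  define K where "K = \<bar>ln c\<^sub>0\<bar> + real b * \<bar>ln c\<^sub>1\<bar> + real b + \<bar>ln (q (L k0))\<bar>"
  have "0 \<le> real b * \<bar>ln c\<^sub>1\<bar>" "real b > 0" using b2 by simp_all
  then have K: "K > 0" unfolding K_def by linarith
  have "- ln (q (L k)) \<le> K * (real k + 1) * real b ^ k" if "k \<ge> k0" for k
    using that
  proof (induction k rule: dec_induct)
    case base
    have "0 \<le> real b * \<bar>ln c\<^sub>1\<bar>" by simp
    then have "- ln (q (L k0)) \<le> K" unfolding K_def by linarith
    also have "K \<le> K * ((real k0 + 1) * real b ^ k0)"
    proof -
      have "1 * 1 \<le> (real k0 + 1) * real b ^ k0" using b2 by (intro mult_mono) auto
      then show ?thesis using K by simp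
    qed
    finally show ?case by (simp add: mult_ac)
  next
    case (step k)
    \<comment> \<open>The summand ln b cancels the one in \<open>rec_lower\<close>, so that the
      recursion leads exactly to level k.\<close>
    define v where "v = L (Suc k) - L k + ln b"
    define z where "z = v / \<theta> - s"
    have pd: "\<gamma> * real k powr ?\<beta> \<le> (real k + 1) powr \<gamma> - real k powr \<gamma>"
      "(real k + 1) powr \<gamma> - real k powr \<gamma> \<le> \<gamma> * (real k + 1) powr ?\<beta>"
      using powr_diff_bounds[of "real k" \<gamma>] \<gamma>_gt_1 by (simp_all add: \<gamma>_minus)
    have v: "v = \<kappa>' * ((real k + 1) powr \<gamma> - real k powr \<gamma>) + ln b"
      by (simp add: v_def L_def algebra_simps)
    have "\<kappa>' * (\<gamma> * real k powr ?\<beta>) \<le> v" "v \<le> \<kappa>' * (\<gamma> * (real k + 1) powr ?\<beta>) + ln b"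
      unfolding v using assms ln_b_pos mult_left_mono[OF pd(1), of \<kappa>'] mult_left_mono[OF pd(2), of \<kappa>'] by linarith+
    then have "\<kappa>' * (\<gamma> * real k powr ?\<beta>) / \<theta> \<le> v / \<theta>" "v / \<theta> \<le> (\<kappa>' * (\<gamma> * (real k + 1) powr ?\<beta>) + ln b) / \<theta>"
      using \<theta> by (auto intro!: divide_right_mono)
    then have z_bounds: "\<kappa>' * \<gamma> / \<theta> * real k powr ?\<beta> - \<bar>s\<bar> \<le> z"
      "z \<le> \<kappa>' * \<gamma> / \<theta> * (real k + 1) powr ?\<beta> + ln b / \<theta> + \<bar>s\<bar>"
      unfolding z_def by (auto simp: add_divide_distrib mult.assoc)
    have z0: "z \<ge> z\<^sub>0" "z \<ge> 0" using z_bounds(1) k0(2)[OF step(1)] by auto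
    have "z \<le> ln b powr ?\<beta> * (real k + 1) powr ?\<beta>"
      using z_bounds(2) k0(1)[OF step(1)] by (simp add: \<rho>_def algebra_simps)
    also have "\<dots> = (ln b * (real k + 1)) powr ?\<beta>"
      using ln_b_pos by (simp add: powr_mult)
    finally have "z powr \<alpha> \<le> ((ln b * (real k + 1)) powr ?\<beta>) powr \<alpha>"
      using z0 \<alpha> by (intro powr_mono2) auto
    also have "\<dots> = ln b * (real k + 1)" using \<alpha> ln_b_pos by (simp add: powr_powr)
    finally have "exp (z powr \<alpha>) \<le> exp (ln b * (real k + 1))" by simp
    also have "\<dots> = real b ^ Suc k"
      using b2 exp_of_nat_mult[of "Suc k" "ln (real b)"] by (simp add: mult.commute add.commute)
    finally have e: "exp (z powr \<alpha>) \<le> real b ^ Suc k" .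
    have "c\<^sub>1 * exp (- (real b ^ Suc k)) \<le> c\<^sub>1 * exp (- exp (z powr \<alpha>))" using e c1 by simp
    also have "\<dots> \<le> T z" by (rule T_lower[OF z0(1)])
    finally have T: "c\<^sub>1 * exp (- (real b ^ Suc k)) \<le> T z" .
    have "c\<^sub>0 * (c\<^sub>1 * exp (- (real b ^ Suc k)) * q (L k)) ^ b \<le> c\<^sub>0 * (T z * q (L k)) ^ b"
      using T c0 c1 q_pos[of "L k"] by (intro mult_left_mono power_mono mult_right_mono) auto
    also have "\<dots> \<le> q (L (Suc k))"
      using rec_lower[of v "L (Suc k)"] by (simp add: z_def v_def)
    finally have "ln (c\<^sub>0 * (c\<^sub>1 * exp (- (real b ^ Suc k)) * q (L k)) ^ b) \<le> ln (q (L (Suc k)))"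
      using c0 c1 q_pos[of "L k"] by (intro ln_mono) auto
    also have "ln (c\<^sub>0 * (c\<^sub>1 * exp (- (real b ^ Suc k)) * q (L k)) ^ b)
        = ln c\<^sub>0 + real b * (ln c\<^sub>1 - real b ^ Suc k + ln (q (L k)))"
      using c0 c1 q_pos[of "L k"] by (simp add: ln_mult_pos ln_realpow)
    finally have "- ln (q (L (Suc k))) \<le> - ln c\<^sub>0 - real b * ln c\<^sub>1 + real b * real b ^ Suc k + real b * (- ln (q (L k)))"
      by (simp add: algebra_simps)
    also have "\<dots> \<le> \<bar>ln c\<^sub>0\<bar> + real b * \<bar>ln c\<^sub>1\<bar> + real b * real b ^ Suc k + real b * (K * (real k + 1) * real b ^ k)"
    proof -
      have "real b * (- ln c\<^sub>1) \<le> real b * \<bar>ln c\<^sub>1\<bar>" by (intro mult_left_mono) auto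
      moreover have "real b * (- ln (q (L k))) \<le> real b * (K * (real k + 1) * real b ^ k)"
        using step by (intro mult_left_mono) auto
      ultimately show ?thesis by linarith
    qed
    also have "\<dots> \<le> (\<bar>ln c\<^sub>0\<bar> + real b * \<bar>ln c\<^sub>1\<bar> + real b) * real b ^ Suc k + K * (real k + 1) * real b ^ Suc k"
    proof -
      have "(\<bar>ln c\<^sub>0\<bar> + real b * \<bar>ln c\<^sub>1\<bar>) * 1 \<le> (\<bar>ln c\<^sub>0\<bar> + real b * \<bar>ln c\<^sub>1\<bar>) * real b ^ Suc k"
        using b2 one_le_power[of "real b" "Suc k"] by (intro mult_left_mono) auto
      then show ?thesis by (simp add: algebra_simps)
    qed
    also have "\<dots> \<le> K * real b ^ Suc k + K * (real k + 1) * real b ^ Suc k"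
      by (intro add_right_mono mult_right_mono) (auto simp: K_def)
    also have "\<dots> = K * (real (Suc k) + 1) * real b ^ Suc k"
      by (simp add: algebra_simps)
    finally show ?case .
  qed
  then show ?thesis using K that unfolding L_def by blast
qed

text \<open>The counterpart with rounding up. The polynomial prefactor enters \<open>h\<close> only
  as a logarithm of the level index.\<close>

lemma eventually_rate_upper:
  assumes "0 < \<kappa>'" "\<kappa>' < \<kappa>" "a > ln b * \<kappa>' powr (- (1 / \<gamma>))"
  shows "eventually (\<lambda>L. ln (- ln (q L)) / L powr (1 / \<gamma>) < a) at_top"
proof -
  obtain K k0 where K: "K > 0"
    and seq: "\<And>k. k \<ge> k0 \<Longrightarrow> - ln (q (\<kappa>' * real k powr \<gamma>)) \<le> K * (real k + 1) * real b ^ k"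
    using q_lower_sequence[OF assms(1,2)] by blast
  define h where "h L = ln K + ln ((L / \<kappa>') powr (1 / \<gamma>) + 2) + ((L / \<kappa>') powr (1 / \<gamma>) + 1) * ln b" for L
  have "eventually (\<lambda>L. ln (- ln (q L)) \<le> h L) at_top"
  proof -
    have "eventually (\<lambda>L. (L / \<kappa>') powr (1 / \<gamma>) \<ge> real k0) at_top"
      using assms \<gamma>_gt_1 by real_asymp
    moreover have "eventually (\<lambda>L::real. L \<ge> 0) at_top" by (rule eventually_ge_at_top)
    moreover have "eventually (\<lambda>L. q L < 1) at_top" using q_vanish by (rule order_tendstoD) simp
    ultimately show ?thesis
    proof eventually_elim
      case (elim L)
      define y where "y = (L / \<kappa>') powr (1 / \<gamma>)"
      define k where "k = nat \<lceil>y\<rceil>"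
      have y: "y \<ge> 0" by (simp add: y_def)
      have k: "y \<le> real k" "real k \<le> y + 1" "k \<ge> k0"
        using elim(1) y unfolding k_def y_def[symmetric] by linarith+
      have "L = \<kappa>' * y powr \<gamma>"
        using assms \<gamma>_gt_1 elim(2) by (simp add: y_def powr_powr)
      also have "\<dots> \<le> \<kappa>' * real k powr \<gamma>"
        using k y assms \<gamma>_gt_1 by (intro mult_left_mono powr_mono2) auto
      finally have "q (\<kappa>' * real k powr \<gamma>) \<le> q L"
        by (intro antimonoD[OF q_antimono])
      then have "ln (q (\<kappa>' * real k powr \<gamma>)) \<le> ln (q L)"
        using q_pos by (intro ln_mono)
      then have "- ln (q L) \<le> K * (real k + 1) * real b ^ k" using seq[OF k(3)] by linarith
      moreover have "- ln (q L) > 0" using elim(3) q_pos[of L] by simp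
      ultimately have "ln (- ln (q L)) \<le> ln (K * (real k + 1) * real b ^ k)"
        by (intro ln_mono)
      also have "\<dots> = ln K + ln (real k + 1) + real k * ln b"
        using K b2 by (simp add: ln_mult_pos ln_realpow add_pos_nonneg)
      also have "\<dots> \<le> ln K + ln (y + 2) + (y + 1) * ln b"
      proof -
        have "ln (real k + 1) \<le> ln (y + 2)" using k(2) by (intro ln_mono) auto
        moreover have "real k * ln b \<le> (y + 1) * ln b" using k(2) ln_b_pos by (intro mult_right_mono) auto
        ultimately show ?thesis by linarith
      qed
      finally show ?case by (simp add: h_def y_def)
    qed
  qed
  moreover have "((\<lambda>L. h L / L powr (1 / \<gamma>)) \<longlongrightarrow> ln b * \<kappa>' powr (- (1 / \<gamma>))) at_top"
    unfolding h_def using assms \<gamma>_gt_1 ln_b_pos K by (real_asymp simp: powr_minus powr_divide field_simps)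
  then have "eventually (\<lambda>L. h L / L powr (1 / \<gamma>) < a) at_top"
    using assms(3) by (rule order_tendstoD)
  moreover have "eventually (\<lambda>L::real. L > 0) at_top" by (rule eventually_gt_at_top)
  ultimately show ?thesis
    by eventually_elim (auto elim!: order.strict_trans1[rotated] intro!: divide_right_mono)
qed

text \<open>Both one-sided rates are continuous in \<kappa>', so letting \<kappa>' approach \<kappa>
  from above and from below squeezes the limit. The rest is the algebra that turns ln b *
  \<kappa>^(-1/\<gamma>) into the stated constant.\<close>

theorem double_exponential_rate:
  "((\<lambda>L. ln (- ln (q L)) / L powr (\<alpha> / (\<alpha> + 1)))
     \<longlongrightarrow> ((1 + \<alpha>) / (\<theta> * \<alpha>) * ln b) powr (\<alpha> / (\<alpha> + 1))) at_top"
proof -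
  let ?e = "1 / \<gamma>"
  have e: "\<alpha> / (\<alpha> + 1) = ?e" using \<alpha> by (simp add: \<gamma>_def field_simps)
  have R: "ln b * \<kappa> powr (- ?e) = ((1 + \<alpha>) / (\<theta> * \<alpha>) * ln b) powr ?e"
  proof -
    have "ln b = (ln b powr \<gamma>) powr ?e"
      using ln_b_pos \<gamma>_gt_1 by (simp add: powr_powr)
    then have "ln b * \<kappa> powr (- ?e) = (ln b powr \<gamma>) powr ?e * (1 / \<kappa>) powr ?e"
      using \<kappa>_pos by (simp add: powr_minus powr_divide field_simps)
    also have "\<dots> = (ln b powr \<gamma> * (1 / \<kappa>)) powr ?e"
      using \<kappa>_pos by (subst powr_mult) auto
    also have "ln b powr \<gamma> * (1 / \<kappa>) = \<gamma> / \<theta> * ln b"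
    proof -
      have "ln b powr \<gamma> = ln b * ln b powr (1 / \<alpha>)"
        using ln_b_pos unfolding \<gamma>_def by (simp only: powr_add) simp
      then show ?thesis using ln_b_pos by (simp add: \<kappa>_def)
    qed
    also have "\<gamma> / \<theta> = (1 + \<alpha>) / (\<theta> * \<alpha>)"
      using \<alpha> \<theta> by (simp add: \<gamma>_def field_simps)
    finally show ?thesis .
  qed
  have cont: "((\<lambda>x. ln b * x powr (- ?e)) \<longlongrightarrow> ln b * \<kappa> powr (- ?e)) (at \<kappa>)"
    using \<kappa>_pos by (intro tendsto_intros) auto
  show ?thesis unfolding e
  proof (rule order_tendstoI)
    fix a assume "a < ((1 + \<alpha>) / (\<theta> * \<alpha>) * ln b) powr ?e"
    then have "eventually (\<lambda>x. a < ln b * x powr (- ?e)) (at_right \<kappa>)"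
      using cont unfolding R[symmetric]
      by (intro order_tendstoD[OF tendsto_within_subset[OF _ subset_UNIV]])
    moreover have "eventually (\<lambda>x. x > \<kappa>) (at_right \<kappa>)" by (rule eventually_at_right_less)
    ultimately have "eventually (\<lambda>x. a < ln b * x powr (- ?e) \<and> x > \<kappa>) (at_right \<kappa>)"
      by (rule eventually_conj)
    then obtain x where "x > \<kappa>" "a < ln b * x powr (- ?e)"
      using eventually_happens' trivial_limit_at_right_real by blast
    then show "eventually (\<lambda>L. a < ln (- ln (q L)) / L powr ?e) at_top"
      by (rule eventually_rate_lower)
  next
    fix a assume "a > ((1 + \<alpha>) / (\<theta> * \<alpha>) * ln b) powr ?e"
    then have "eventually (\<lambda>x. a > ln b * x powr (- ?e)) (at_left \<kappa>)"
      using cont unfolding R[symmetric]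
      by (intro order_tendstoD[OF tendsto_within_subset[OF _ subset_UNIV]])
    moreover have "eventually (\<lambda>x. x \<in> {0<..<\<kappa>}) (at_left \<kappa>)" using \<kappa>_pos by (rule eventually_at_left_real)
    ultimately have "eventually (\<lambda>x. a > ln b * x powr (- ?e) \<and> x \<in> {0<..<\<kappa>}) (at_left \<kappa>)"
      by (rule eventually_conj)
    then obtain x where "x > 0" "x < \<kappa>" "a > ln b * x powr (- ?e)"
      using eventually_happens' trivial_limit_at_left_real by (metis (no_types, lifting) greaterThanLessThan_iff)
    then show "eventually (\<lambda>L. ln (- ln (q L)) / L powr ?e < a) at_top"
      by (rule eventually_rate_upper)
  qed
qed

end

section \<open>Subharmonic functions of a centred random walk\<close>

text \<open>Integrate the defect over \<open>{..x}\<close>: with \<open>f\<close> the primitive of \<open>h\<close> vanishing at \<open>- \<infinity>\<close>, the total defect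
  is at most the mean of \<open>f (x + y) - f x\<close>, which tends to \<open>(\<integral>y. y \<partial>Q) * Sup (range h) = 0\<close>.\<close>

lemma subharmonic_deficit_zero:
  fixes Q :: "real measure" and h d :: "real \<Rightarrow> real"
  assumes Q: "prob_space Q" and sets_Q [measurable_cong]: "sets Q = sets borel"
    and mean: "integrable Q (\<lambda>y. y)" "(\<integral>y. y \<partial>Q) = 0"
    and expo: "integrable Q exp"
    and h: "mono h" "\<And>x. 0 \<le> h x" "\<And>x. h x \<le> 1" "\<And>x. h x \<le> exp x"
    and d: "d \<in> borel_measurable borel" "\<And>x. 0 \<le> d x"
    and sub: "\<And>x. h x + d x \<le> (\<integral>y. h (x + y) \<partial>Q)"
  shows "AE x in lborel. d x = 0"
proof -
  interpret Q: prob_space Q by (rule Q)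
  have h_meas [measurable]: "h \<in> borel_measurable borel" using h(1) by (rule borel_measurable_mono)
  note d(1) [measurable]
  define F where "F x = (\<integral>\<^sup>+t. ennreal (h t) * indicator {..x} t \<partial>lborel)" for x
  have F_exp: "F x \<le> ennreal (exp x)" for x
  proof -
    have "F x \<le> (\<integral>\<^sup>+t. ennreal (exp t) * indicator {..x} t \<partial>lborel)"
      unfolding F_def using h by (intro nn_integral_mono mult_right_mono) (auto simp: ennreal_leI)
    also have "\<dots> = ennreal (exp x)"
    proof -
      have "(\<integral>\<^sup>+t. ennreal (exp t) * indicator {..x} t \<partial>lborel)
          = (\<integral>\<^sup>+t. ennreal (exp (x - t)) * indicator {..x} (x - t) \<partial>lborel)"
        by (subst nn_integral_real_affine[where c="-1" and t=x]) auto
      also have "\<dots> = (\<integral>\<^sup>+t. ennreal (exp (x - t)) * indicator {0..} t \<partial>lborel)"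
        by (intro nn_integral_cong) (auto split: split_indicator)
      also have "\<dots> = ennreal (0 - (- exp (x - 0)))"
      proof (rule nn_integral_FTC_atLeast)
        show "((\<lambda>t. - exp (x - t)) \<longlongrightarrow> 0) at_top" by real_asymp
      qed (auto intro!: derivative_eq_intros)
      finally show ?thesis by simp
    qed
    finally show ?thesis .
  qed
  define f where "f x = enn2real (F x)" for x
  have Ff: "F x = ennreal (f x)" for x
    unfolding f_def using F_exp[of x] by (metis ennreal_enn2real ennreal_less_top less_le_not_le order_le_less_trans)
  have f_nonneg: "0 \<le> f x" for x by (simp add: f_def)
  have f_exp: "f x \<le> exp x" for x using F_exp[of x] by (simp add: Ff)
  define w where "w = Sup (range h)"
  have bdd: "bdd_above (range h)" using h(3) by (auto intro!: bdd_aboveI[of _ 1])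
  have h_w: "h x \<le> w" for x unfolding w_def by (rule cSup_upper[OF _ bdd]) simp
  have w1: "w \<le> 1" unfolding w_def using h(3) by (intro cSup_least) auto
  have h_lim: "(h \<longlongrightarrow> w) at_top"
  proof (rule order_tendstoI)
    fix a assume "a < w"
    then obtain x where "a < h x" unfolding w_def using less_cSup_iff[OF _ bdd] by auto
    then show "eventually (\<lambda>x. a < h x) at_top"
      by (intro eventually_mono[OF eventually_ge_at_top[of x]]) (meson h(1) monoD order_less_le_trans)
  next
    fix a assume "a > w"
    then have "h x < a" for x by (rule order_le_less_trans[OF h_w])
    then show "eventually (\<lambda>x. h x < a) at_top" by simp
  qed
  \<comment> \<open>The primitive of a monotone function has slopes between the value at the left
    end and the supremum w.\<close>
  have incr: "h x * (x' - x) \<le> f x' - f x" "f x' - f x \<le> w * (x' - x)" if "x \<le> x'" for x x'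
  proof -
    have split: "F x' = F x + (\<integral>\<^sup>+t. ennreal (h t) * indicator {x<..x'} t \<partial>lborel)"
      unfolding F_def using that by (subst nn_integral_add[symmetric])
        (auto intro!: nn_integral_cong split: split_indicator)
    have c: "(\<integral>\<^sup>+t. ennreal c * indicator {x<..x'} t \<partial>lborel) = ennreal (c * (x' - x))" if "c \<ge> 0" for c
      using that \<open>x \<le> x'\<close> by (subst nn_integral_cmult_indicator) (auto simp: ennreal_mult)
    have "ennreal (h x * (x' - x)) \<le> (\<integral>\<^sup>+t. ennreal (h t) * indicator {x<..x'} t \<partial>lborel)"
      unfolding c[OF h(2), symmetric]
      by (intro nn_integral_mono) (auto intro!: ennreal_leI monoD[OF h(1)] split: split_indicator)
    then have "F x + ennreal (h x * (x' - x)) \<le> F x'" unfolding split by (rule add_left_mono)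
    then show "h x * (x' - x) \<le> f x' - f x"
      using that h(2)[of x] f_nonneg by (simp add: Ff ennreal_plus[symmetric] del: ennreal_plus)
    have w0: "w \<ge> 0" using h_w[of 0] h(2)[of 0] by simp
    have "(\<integral>\<^sup>+t. ennreal (h t) * indicator {x<..x'} t \<partial>lborel) \<le> ennreal (w * (x' - x))"
      unfolding c[OF w0, symmetric]
      by (intro nn_integral_mono) (auto intro!: ennreal_leI h_w split: split_indicator)
    then have "F x' \<le> F x + ennreal (w * (x' - x))" unfolding split by (rule add_left_mono)
    then show "f x' - f x \<le> w * (x' - x)"
      using that w0 f_nonneg by (simp add: Ff ennreal_plus[symmetric] del: ennreal_plus)
  qed
  have f_mono: "mono f"
  proof
    fix x y :: real assume "x \<le> y"
    then show "f x \<le> f y" using incr(1)[of x y] h(2)[of x] by (smt (verit) mult_nonneg_nonneg)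
  qed
  then have f_meas [measurable]: "f \<in> borel_measurable borel" by (rule borel_measurable_mono)
  \<comment> \<open>For either sign of y, the increment deviates from slope w by at most w minus
    \<open>h\<close> at the leftmost point involved, which vanishes far to the right.\<close>
  have g_bound: "\<bar>f (x + y) - f x - w * y\<bar> \<le> \<bar>y\<bar> * (w - h (min x (x + y)))" for x y
  proof (cases "y \<ge> 0")
    case True
    then show ?thesis using incr[of x "x + y"] by (simp add: algebra_simps)
  next
    case False
    then show ?thesis using incr[of "x + y" x] by (simp add: algebra_simps)
  qed
  have int_f: "integrable Q (\<lambda>y. f (x + y))" for x
  proof (rule Bochner_Integration.integrable_bound)
    show "integrable Q (\<lambda>y. exp x * exp y)" using expo by simp
    show "AE y in Q. norm (f (x + y)) \<le> norm (exp x * exp y)"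
      using f_nonneg f_exp by (auto simp: exp_add[symmetric])
  qed measurable
  \<comment> \<open>The increments are at most 2 times the absolute value of y, so dominated
    convergence applies; the limit is w times the mean, that is 0.\<close>
  have lim: "(\<lambda>n. \<integral>y. f (real n + y) - f (real n) \<partial>Q) \<longlonglongrightarrow> (\<integral>y. w * y \<partial>Q)"
  proof (rule integral_dominated_convergence[where w="\<lambda>y. 2 * \<bar>y\<bar>"])
    show "integrable Q (\<lambda>y. 2 * \<bar>y\<bar>)" using mean(1) by simp
    show "AE y in Q. (\<lambda>n. f (real n + y) - f (real n)) \<longlonglongrightarrow> w * y"
    proof (rule AE_I2)
      fix y
      have "(\<lambda>n. h (min (real n) (real n + y))) \<longlonglongrightarrow> w"
      proof (rule filterlim_compose[OF h_lim])
        have "filterlim (\<lambda>n. real n + c) at_top sequentially" for c by real_asymp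
        moreover have "min (real n) (real n + y) = real n + min 0 y" for n by simp
        ultimately show "filterlim (\<lambda>n. min (real n) (real n + y)) at_top sequentially" by simp
      qed
      then have "(\<lambda>n. \<bar>y\<bar> * (w - h (min (real n) (real n + y)))) \<longlonglongrightarrow> \<bar>y\<bar> * (w - w)"
        by (intro tendsto_intros)
      then have *: "(\<lambda>n. \<bar>y\<bar> * (w - h (min (real n) (real n + y)))) \<longlonglongrightarrow> 0" by (simp only: diff_self mult_zero_right)
      have "(\<lambda>n. f (real n + y) - f (real n) - w * y) \<longlonglongrightarrow> 0"
        by (rule Lim_null_comparison[OF _ *]) (intro always_eventually allI, simp only: real_norm_def g_bound)
      then show "(\<lambda>n. f (real n + y) - f (real n)) \<longlonglongrightarrow> w * y"
        by (simp add: LIM_zero_iff)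
    qed
    show "AE y in Q. norm (f (real n + y) - f (real n)) \<le> 2 * \<bar>y\<bar>" for n
    proof (rule AE_I2)
      fix y
      have "\<bar>y\<bar> * (w - h (min (real n) (real n + y))) \<le> \<bar>y\<bar> * 1"
        using w1 h(2)[of "min (real n) (real n + y)"] by (intro mult_left_mono) auto
      moreover have "\<bar>w * y\<bar> \<le> 1 * \<bar>y\<bar>"
        unfolding abs_mult using w1 h_w[of 0] h(2)[of 0] by (intro mult_right_mono) auto
      ultimately show "norm (f (real n + y) - f (real n)) \<le> 2 * \<bar>y\<bar>"
        using g_bound[of "real n" y] unfolding real_norm_def by linarith
    qed
  qed measurable
  define \<Delta> where "\<Delta> x = (\<integral>\<^sup>+t. ennreal (d t) * indicator {..x} t \<partial>lborel)" for x
  have int_h: "integrable Q (\<lambda>y. h (x + y))" for x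
    by (rule Q.integrable_const_bound[of _ 1]) (use h in auto)
  \<comment> \<open>Subharmonicity is integrated over t \<le> x. After Fubini the right side is the
    mean of the primitive at x + y; the primitive is finite because \<open>h\<close> is below
    exp.\<close>
  have \<Delta>_le: "\<Delta> x \<le> ennreal (\<integral>y. f (x + y) - f x \<partial>Q)" for x
  proof -
    have "F x + \<Delta> x = (\<integral>\<^sup>+t. ennreal (h t + d t) * indicator {..x} t \<partial>lborel)"
      unfolding F_def \<Delta>_def using h d
      by (subst nn_integral_add[symmetric]) (auto simp: distrib_right)
    also have "\<dots> \<le> (\<integral>\<^sup>+t. (\<integral>\<^sup>+y. ennreal (h (t + y)) \<partial>Q) * indicator {..x} t \<partial>lborel)"
      using sub h int_h
      by (intro nn_integral_mono mult_right_mono)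
         (auto simp: nn_integral_eq_integral ennreal_leI)
    also have "\<dots> = (\<integral>\<^sup>+t. (\<integral>\<^sup>+y. ennreal (h (t + y)) * indicator {..x} t \<partial>Q) \<partial>lborel)"
      by (subst nn_integral_multc) auto
    also have "\<dots> = (\<integral>\<^sup>+y. (\<integral>\<^sup>+t. ennreal (h (t + y)) * indicator {..x} t \<partial>lborel) \<partial>Q)"
    proof -
      interpret P: pair_sigma_finite lborel Q ..
      show ?thesis by (rule P.Fubini'[symmetric]) measurable
    qed
    also have "\<dots> = (\<integral>\<^sup>+y. F (x + y) \<partial>Q)"
    proof (rule nn_integral_cong)
      fix y
      have "F (x + y) = (\<integral>\<^sup>+t. ennreal (h (y + t)) * indicator {..x + y} (y + t) \<partial>lborel)"
        unfolding F_def by (subst nn_integral_real_affine[where c=1 and t=y]) auto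
      also have "\<dots> = (\<integral>\<^sup>+t. ennreal (h (t + y)) * indicator {..x} t \<partial>lborel)"
        by (intro nn_integral_cong) (auto split: split_indicator simp: add.commute)
      finally show "(\<integral>\<^sup>+t. ennreal (h (t + y)) * indicator {..x} t \<partial>lborel) = F (x + y)" by simp
    qed
    also have "\<dots> = ennreal (\<integral>y. f (x + y) \<partial>Q)"
      unfolding Ff using f_nonneg int_f by (intro nn_integral_eq_integral) auto
    finally have *: "ennreal (f x) + \<Delta> x \<le> ennreal (\<integral>y. f (x + y) \<partial>Q)" by (simp add: Ff)
    then have "\<Delta> x \<noteq> \<top>" by (auto simp: top_unique)
    then obtain r where r: "\<Delta> x = ennreal r" "r \<ge> 0" by (cases "\<Delta> x") auto
    have "0 \<le> (\<integral>y. f (x + y) \<partial>Q)" using f_nonneg by simp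
    then have "f x + r \<le> (\<integral>y. f (x + y) \<partial>Q)"
      using * r f_nonneg[of x] by (simp add: ennreal_plus[symmetric] del: ennreal_plus)
    then show ?thesis using int_f by (simp add: r Q.prob_space ennreal_leI)
  qed
  \<comment> \<open>The accumulated defect increases with x, so the vanishing bound at infinity
    kills it everywhere.\<close>
  have "\<Delta> x = 0" for x
  proof -
    have "(\<lambda>n. ennreal (\<integral>y. f (real n + y) - f (real n) \<partial>Q)) \<longlonglongrightarrow> ennreal 0"
      using lim mean by (intro tendsto_ennrealI) simp
    moreover have "eventually (\<lambda>n. \<Delta> x \<le> ennreal (\<integral>y. f (real n + y) - f (real n) \<partial>Q)) sequentially"
      using eventually_ge_at_top[of "nat \<lceil>x\<rceil>"]
    proof eventually_elim
      case (elim n)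
      then have "x \<le> real n" by linarith
      then have "\<Delta> x \<le> \<Delta> (real n)"
        unfolding \<Delta>_def by (intro nn_integral_mono) (auto split: split_indicator)
      also have "\<dots> \<le> ennreal (\<integral>y. f (real n + y) - f (real n) \<partial>Q)" by (rule \<Delta>_le)
      finally show ?case .
    qed
    ultimately have "\<Delta> x \<le> ennreal 0"
      by (intro tendsto_lowerbound) auto
    then show ?thesis by simp
  qed
  then have "AE t in lborel. ennreal (d t) * indicator {..real n} t = 0" for n :: nat
    unfolding \<Delta>_def by (subst (asm) nn_integral_0_iff_AE) auto
  then have "AE t in lborel. \<forall>n::nat. ennreal (d t) * indicator {..real n} t = 0"
    by (subst AE_all_countable) auto
  then show ?thesis
  proof eventually_elim
    case (elim t)
    obtain n :: nat where "t \<le> real n" using real_arch_simple by blast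
    with elim d(2)[of t] show ?case by (auto dest!: spec[of _ n])
  qed
qed

text \<open>The function \<open>x - A c + A exp (- r x)\<close> is strictly subharmonic with margin of order \<open>exp (- r x)\<close>. Since
  \<open>c\<close> is large, it only exceeds \<open>0\<close> on the negative axis far away, so killing there costs less than the margin.\<close>

lemma killed_subsolution:
  fixes Q :: "real measure" and r r' C :: real
  assumes Q: "prob_space Q" and sets_Q [measurable_cong]: "sets Q = sets borel"
    and mean: "integrable Q (\<lambda>y. y)" "(\<integral>y. y \<partial>Q) = 0"
    and r: "0 < r" "r < r'"
    and expo: "integrable Q (\<lambda>y. exp (- r * y))" "integrable Q (\<lambda>y. exp (- r' * y))"
    and M: "(\<integral>y. exp (- r * y) \<partial>Q) > 1"
  obtains A c :: real
  where "A > 0" "c > 1" "A * (c - 1) \<ge> 2"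
    "\<And>x. x \<ge> 0 \<Longrightarrow> x - A * c + A * exp (- r * x) + C * exp (- r * x)
        \<le> (\<integral>y. (if x + y \<ge> 0 then max 0 (x + y - A * c + A * exp (- r * (x + y))) else 0) \<partial>Q)"
proof -
  interpret Q: prob_space Q by (rule Q)
  define M1 where "M1 = (\<integral>y. exp (- r * y) \<partial>Q)"
  define M2 where "M2 = (\<integral>y. exp (- r' * y) \<partial>Q)"
  have M1: "M1 > 1" using M by (simp add: M1_def)
  have M2: "M2 \<ge> 0" by (simp add: M2_def)
  \<comment> \<open>Below -\<tau> the exponential of rate r is dominated by that of rate r' times
    exp (- (r' - r) \<tau>). For large \<tau> the resulting error is less than half of the gain M1 -
    1.\<close>
  have "((\<lambda>t. M2 * exp (- (r' - r) * t)) \<longlongrightarrow> 0) at_top" using r by real_asymp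
  then have "eventually (\<lambda>t. M2 * exp (- (r' - r) * t) < (M1 - 1) / 2) at_top"
    using M1 by (intro order_tendstoD) auto
  moreover have "eventually (\<lambda>t. exp (r * t) \<ge> 2) at_top" using r by real_asymp
  moreover have "eventually (\<lambda>t::real. t \<ge> 0) at_top" by (rule eventually_ge_at_top)
  ultimately have "eventually (\<lambda>t. M2 * exp (- (r' - r) * t) < (M1 - 1) / 2 \<and> exp (r * t) \<ge> 2 \<and> t \<ge> 0) at_top"
    by (intro eventually_conj)
  then obtain \<tau> where \<tau>: "M2 * exp (- (r' - r) * \<tau>) < (M1 - 1) / 2" "exp (r * \<tau>) \<ge> 2" "\<tau> \<ge> 0"
    using eventually_happens' trivial_limit_at_top_linorder by blast
  \<comment> \<open>\<open>c\<close> is exp (- r z) at z = -\<tau>, so the function is nonpositive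
    on [-\<tau>, 0] and killing costs nothing there. \<open>A\<close> makes one half of the margin
    cover \<open>C\<close>; the other half pays for killing below -\<tau>.\<close>
  define c where "c = exp (r * \<tau>)"
  define A where "A = max 2 (2 * C / (M1 - 1))"
  have c: "c \<ge> 2" using \<tau> by (simp add: c_def)
  have A: "A \<ge> 2" "A * (M1 - 1) / 2 \<ge> C"
  proof -
    show "A \<ge> 2" by (simp add: A_def)
    have "A \<ge> 2 * C / (M1 - 1)" by (simp add: A_def)
    then show "A * (M1 - 1) / 2 \<ge> C" using M1 by (simp add: field_simps)
  qed
  let ?k = "\<lambda>z. if z \<ge> 0 then max 0 (z - A * c + A * exp (- r * z)) else 0 :: real"
  let ?e = "exp (- (r' - r) * \<tau>)"
  \<comment> \<open>A pointwise minorant built only from terms with explicit means: the last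
    exponential overcompensates the part removed by killing.\<close>
  have k_lower: "z - A * c + A * exp (- r * z) - A * ?e * exp (- r' * z) \<le> ?k z" for z
  proof (cases "z \<ge> - \<tau>")
    case True
    have pos: "A * ?e * exp (- r' * z) \<ge> 0" using A by simp
    show ?thesis
    proof (cases "z \<ge> 0")
      case False
      have "exp (- r * z) \<le> c" unfolding c_def using True r mult_left_mono[of "- z" \<tau> r] by simp
      then have "A * exp (- r * z) \<le> A * c" using A by (intro mult_left_mono) auto
      then show ?thesis using False pos by auto
    qed (use pos in auto)
  next
    case False
    then have z: "z < - \<tau>" "z < 0" using \<tau> by auto
    have "exp (- r * z) \<le> ?e * exp (- r' * z)"
      unfolding exp_add[symmetric]
    proof -
      have "(r' - r) * \<tau> \<le> (r' - r) * (- z)" using z r by (intro mult_left_mono) auto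
      then show "exp (- r * z) \<le> exp (- (r' - r) * \<tau> + - r' * z)" by (simp add: algebra_simps)
    qed
    then have "A * exp (- r * z) \<le> A * (?e * exp (- r' * z))" using A by (intro mult_left_mono) auto
    moreover have "A * c \<ge> 0" using A c by simp
    ultimately have "z - A * c + A * exp (- r * z) - A * ?e * exp (- r' * z) \<le> 0"
      using z by (simp add: mult.assoc)
    then show ?thesis using z by simp
  qed
  have k_upper: "0 \<le> ?k z" "?k z \<le> \<bar>z\<bar>" for z
  proof -
    show "0 \<le> ?k z" by auto
    have "exp (- r * z) \<le> c" if "z \<ge> 0"
    proof -
      have "exp (- r * z) \<le> exp 0" unfolding exp_le_cancel_iff using that r by simp
      then show ?thesis using c by (simp only: exp_zero)
    qed
    then have "A * exp (- r * z) \<le> A * c" if "z \<ge> 0" using A that by (intro mult_left_mono) auto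
    then show "?k z \<le> \<bar>z\<bar>" by (cases "z \<ge> 0") auto
  qed
  show ?thesis
  proof (rule that)
    show "A > 0" "c > 1" using A c by auto
    have "2 * 1 \<le> A * (c - 1)" using A c by (intro mult_mono) auto
    then show "A * (c - 1) \<ge> 2" by simp
    fix x :: real assume x: "x \<ge> 0"
    have int_exp: "integrable Q (\<lambda>y. exp (- t * (x + y)))"
        "(\<integral>y. exp (- t * (x + y)) \<partial>Q) = exp (- t * x) * (\<integral>y. exp (- t * y) \<partial>Q)"
      if "integrable Q (\<lambda>y. exp (- t * y))" for t
    proof -
      have eq: "(\<lambda>y. exp (- t * (x + y))) = (\<lambda>y. exp (- t * x) * exp (- t * y))"
        by (auto simp: exp_add[symmetric] algebra_simps)
      show "integrable Q (\<lambda>y. exp (- t * (x + y)))" unfolding eq using that by simp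
      show "(\<integral>y. exp (- t * (x + y)) \<partial>Q) = exp (- t * x) * (\<integral>y. exp (- t * y) \<partial>Q)"
        unfolding eq by simp
    qed
    have int_k: "integrable Q (\<lambda>y. ?k (x + y))"
    proof (rule Bochner_Integration.integrable_bound)
      show "integrable Q (\<lambda>y. \<bar>x + y\<bar>)" using mean by simp
      show "AE y in Q. norm (?k (x + y)) \<le> norm \<bar>x + y\<bar>"
      proof (rule AE_I2)
        fix y show "norm (?k (x + y)) \<le> norm \<bar>x + y\<bar>" using k_upper[of "x + y"] by auto
      qed
    qed measurable
    have "x - A * c + A * exp (- r * x) + C * exp (- r * x)
        \<le> x - A * c + A * exp (- r * x) + A * (M1 - 1) / 2 * exp (- r * x)"
      using A by (intro add_left_mono mult_right_mono) auto
    also have "\<dots> = x - A * c + A * (exp (- r * x) * M1) - A * (exp (- r * x) * ((M1 - 1) / 2))"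
      by (simp add: field_simps)
    also have "\<dots> \<le> x - A * c + A * (exp (- r * x) * M1) - A * (exp (- r' * x) * (M2 * ?e))"
    proof -
      have "exp (- r' * x) * (M2 * ?e) \<le> exp (- r * x) * ((M1 - 1) / 2)"
        using \<tau> M1 M2 r x by (intro mult_mono) (auto intro!: mult_right_mono)
      then show ?thesis using A by (intro diff_left_mono mult_left_mono) auto
    qed
    also have "\<dots> = (\<integral>y. (x + y) - A * c + A * exp (- r * (x + y)) - A * ?e * exp (- r' * (x + y)) \<partial>Q)"
      using mean int_exp[OF expo(1)] int_exp[OF expo(2)]
      by (simp add: Q.prob_space M1_def M2_def)
    also have "\<dots> \<le> (\<integral>y. ?k (x + y) \<partial>Q)"
      using mean int_exp[OF expo(1)] int_exp[OF expo(2)] int_k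
      by (intro integral_mono k_lower) auto
    finally show "x - A * c + A * exp (- r * x) + C * exp (- r * x) \<le> (\<integral>y. ?k (x + y) \<partial>Q)" .
  qed
qed

section \<open>Elementary inequalities and moments\<close>

lemma one_minus_power_upper:
  fixes a :: real
  assumes "0 \<le> a" "a \<le> 1" "k \<ge> 2"
  shows "1 - (1 - a) ^ k \<le> real k * a - a\<^sup>2"
  using assms(3)
proof (induction k rule: dec_induct)
  case base
  show ?case by (simp add: power2_eq_square algebra_simps)
next
  case (step k)
  have "(1 - a) * (1 - real k * a + a\<^sup>2) \<le> (1 - a) * (1 - a) ^ k"
    using step assms by (intro mult_left_mono) auto
  moreover have "a\<^sup>2 * a \<le> a\<^sup>2 * real k" using assms step by (intro mult_left_mono) auto
  ultimately show ?case by (simp add: algebra_simps power2_eq_square)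
qed

lemma exp_minus_upper:
  fixes t :: real
  assumes "0 \<le> t" "t \<le> 1"
  shows "exp (- t) \<le> 1 - t + t\<^sup>2"
proof -
  have "0 \<le> t ^ 3" using assms by simp
  then have "1 \<le> (1 - t + t\<^sup>2) * (1 + t)"
    by (simp add: power2_eq_square power3_eq_cube algebra_simps)
  also have "\<dots> \<le> (1 - t + t\<^sup>2) * exp t"
    using assms exp_ge_add_one_self[of t] by (intro mult_left_mono) auto
  finally show ?thesis by (simp add: exp_minus field_simps)
qed

text \<open>The natural error is (k a)^2, but offspring numbers have only a moment of order q. For k
  a \<le> 1 a smaller exponent gives a larger error term; for k a > 1 the left side is already
  nonpositive.\<close>

lemma one_minus_power_lower:
  fixes a q :: real
  assumes "0 \<le> a" "a \<le> 1" "1 \<le> q" "q \<le> 2"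
  shows "real k * a - (real k * a) powr q \<le> 1 - (1 - a) ^ k"
proof -
  let ?t = "real k * a"
  have t: "?t \<ge> 0" using assms by simp
  have "(1 - a) ^ k \<le> exp (- a) ^ k"
    using assms exp_ge_add_one_self[of "- a"] by (intro power_mono) auto
  also have "\<dots> = exp (- ?t)" by (simp add: exp_of_nat_mult[symmetric])
  finally have e: "(1 - a) ^ k \<le> exp (- ?t)" .
  show ?thesis
  proof (cases "?t \<le> 1")
    case True
    have "exp (- ?t) \<le> 1 - ?t + ?t\<^sup>2" using t True by (rule exp_minus_upper)
    moreover have "?t powr q \<ge> ?t powr 2"
      using t True assms by (intro powr_mono') auto
    ultimately show ?thesis using e t by (simp add: powr_numeral)
  next
    case False
    have "?t powr 1 \<le> ?t powr q" using False assms by (intro powr_mono) auto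
    moreover have "(1 - a) ^ k \<le> 1" using assms by (intro power_le_one) auto
    ultimately show ?thesis using t by simp
  qed
qed

lemma abs_exp_minus_one_le:
  fixes u :: real
  shows "\<bar>exp u - 1\<bar> \<le> \<bar>u\<bar> * exp \<bar>u\<bar>"
proof (cases "u \<ge> 0")
  case True
  have "(1 - u) * exp u \<le> exp (- u) * exp u"
    using exp_ge_add_one_self[of "- u"] by (intro mult_right_mono) auto
  then show ?thesis using True by (simp add: exp_minus algebra_simps)
next
  case False
  have "1 - exp u \<le> - u" using exp_ge_add_one_self[of u] by linarith
  also have "- u * 1 \<le> - u * exp (- u)" using False by (intro mult_left_mono) auto
  finally show ?thesis using False by simp
qed

lemma one_plus_less_exp:
  fixes u :: real
  assumes "u \<noteq> 0"
  shows "1 + u < exp u"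
proof (cases "u \<ge> - 2")
  case True
  have "1 + u < (1 + u / 2)\<^sup>2" using assms zero_less_power2[of u] by (simp add: power2_sum power_divide)
  also have "\<dots> \<le> (exp (u / 2))\<^sup>2"
    using exp_ge_add_one_self[of "u / 2"] True by (intro power_mono) auto
  also have "\<dots> = exp u" by (simp add: power2_eq_square exp_add[symmetric])
  finally show ?thesis .
next
  case False
  then have "1 + u < 0" by simp
  also have "0 < exp u" by simp
  finally show ?thesis .
qed

lemma (in prob_space) exp_jensen:
  fixes Y :: "'a \<Rightarrow> real"
  assumes "integrable M Y" "\<And>x. 0 \<le> Y x"
  shows "exp (- (\<integral>x. Y x \<partial>M)) \<le> (\<integral>x. exp (- Y x) \<partial>M)"
proof -
  let ?y = "\<integral>x. Y x \<partial>M"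
  have [measurable]: "Y \<in> borel_measurable M" using assms by auto
  have "exp (- ?y) = (\<integral>x. exp (- ?y) * (1 + (?y - Y x)) \<partial>M)"
    using assms by (simp add: prob_space)
  also have "\<dots> \<le> (\<integral>x. exp (- Y x) \<partial>M)"
  proof (rule integral_mono)
    show "integrable M (\<lambda>x. exp (- Y x))"
      by (rule integrable_const_bound[of _ 1]) (use assms in auto)
    show "exp (- ?y) * (1 + (?y - Y x)) \<le> exp (- Y x)" for x
    proof -
      have "exp (- ?y) * (1 + (?y - Y x)) \<le> exp (- ?y) * exp (?y - Y x)"
        using exp_ge_add_one_self[of "?y - Y x"] by (intro mult_left_mono) auto
      then show ?thesis by (simp add: exp_add[symmetric])
    qed
  qed (use assms in simp)
  finally show ?thesis .
qed

lemma one_minus_exp_scaled: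
  fixes l y :: real
  assumes "0 \<le> l" "l \<le> 1"
  shows "l * (1 - exp (- y)) \<le> 1 - exp (- (l * y))"
  using convex_onD[OF exp_convex, of l 0 "- y"] assms by (simp add: algebra_simps)

lemma pmf_nat_series:
  fixes f :: "nat \<Rightarrow> real" and p :: "nat pmf"
  assumes "\<And>k. 0 \<le> f k" "summable (\<lambda>k. f k * pmf p k)"
  shows "integrable (measure_pmf p) f" "(\<integral>k. f k \<partial>measure_pmf p) = (\<Sum>k. f k * pmf p k)"
proof -
  have int: "integrable (count_space UNIV) (\<lambda>k. pmf p k * f k)"
    using assms by (simp add: integrable_count_space_nat_iff mult.commute abs_mult)
  show "integrable (measure_pmf p) f"
    unfolding measure_pmf_eq_density using int by (subst integrable_density) auto
  show "(\<integral>k. f k \<partial>measure_pmf p) = (\<Sum>k. f k * pmf p k)"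
    unfolding measure_pmf_eq_density using int
    by (subst integral_density) (auto simp: integral_count_space_nat mult.commute)
qed

lemma summable_lower_moment:
  fixes p :: "nat pmf" and r r' :: real
  assumes "summable (\<lambda>k. real k powr r' * pmf p k)" "0 < r" "r \<le> r'"
  shows "summable (\<lambda>k. real k powr r * pmf p k)"
proof (rule summable_comparison_test'[OF assms(1), of 0])
  fix k
  have "real k powr r \<le> real k powr r'"
    using assms by (cases "k = 0") (auto intro!: powr_mono)
  then show "norm (real k powr r * pmf p k) \<le> real k powr r' * pmf p k"
    by (auto intro!: mult_right_mono)
qed

lemma ext_ln_mgf:
  assumes "prob_space \<mu>" and [measurable_cong]: "sets \<mu> = sets borel" and fin: "mgf \<mu> t < \<infinity>"
  shows "integrable \<mu> (\<lambda>x. exp (t * x))" "0 < (\<integral>x. exp (t * x) \<partial>\<mu>)"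
    "ext_ln (mgf \<mu> t) = ereal (ln (\<integral>x. exp (t * x) \<partial>\<mu>))"
proof -
  interpret prob_space \<mu> by fact
  show int: "integrable \<mu> (\<lambda>x. exp (t * x))"
    using fin by (intro integrableI_nonneg) (auto simp: mgf_def)
  have "(\<integral>x. exp (t * x) \<partial>\<mu>) \<noteq> 0"
  proof
    assume "(\<integral>x. exp (t * x) \<partial>\<mu>) = 0"
    then have "AE x in \<mu>. exp (t * x) = 0"
      using int by (subst (asm) integral_nonneg_eq_0_iff_AE) auto
    then show False by simp
  qed
  moreover have "0 \<le> (\<integral>x. exp (t * x) \<partial>\<mu>)" by simp
  ultimately show pos: "0 < (\<integral>x. exp (t * x) \<partial>\<mu>)" by linarith
  have "mgf \<mu> t = ennreal (\<integral>x. exp (t * x) \<partial>\<mu>)"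
    unfolding mgf_def using int by (intro nn_integral_eq_integral) auto
  then show "ext_ln (mgf \<mu> t) = ereal (ln (\<integral>x. exp (t * x) \<partial>\<mu>))"
    using pos by (simp add: ext_ln_def)
qed

section \<open>The tilted displacement law\<close>

text \<open>Hypothesis (iii) in normalised form: with V = \<theta> (s - x), the function m E exp (-
  t V) equals 1 at t = 1 and is at least 1 around it. So t = 1 is a minimum, the source of
  centredness. \<open>nondegenerate\<close> says that V is unbounded above, which follows from the
  left tail of the displacement.\<close>

locale critical_brw =
  fixes p :: "nat pmf" and \<mu> :: "real measure" and \<theta> s m q \<rho> :: real
  assumes prob_mu: "prob_space \<mu>" and sets_mu [measurable_cong]: "sets \<mu> = sets borel"
    and \<theta>_pos: "\<theta> > 0" and \<rho>_pos: "\<rho> > 0" and q: "1 < q" "q \<le> 2"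
    and offspring_ge_2: "\<And>k. k \<in> set_pmf p \<Longrightarrow> k \<ge> 2"
    and offspring_mean: "integrable (measure_pmf p) real" "(\<integral>k. real k \<partial>measure_pmf p) = m"
    and offspring_moment: "integrable (measure_pmf p) (\<lambda>k. real k powr q)"
    and expo: "\<And>t. 0 < t \<Longrightarrow> t < 1 + \<rho> \<Longrightarrow> integrable \<mu> (\<lambda>x. exp (- t * (\<theta> * (s - x))))"
    and normalised: "m * (\<integral>x. exp (- (\<theta> * (s - x))) \<partial>\<mu>) = 1"
    and critical: "\<And>t. 0 < t \<Longrightarrow> t < 1 + \<rho> \<Longrightarrow> m * (\<integral>x. exp (- t * (\<theta> * (s - x))) \<partial>\<mu>) \<ge> 1"
    and nondegenerate: "\<And>v. \<exists>w>v. \<not> (AE x in \<mu>. \<theta> * (s - x) < w)"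
begin

definition V :: "real \<Rightarrow> real" where "V x = \<theta> * (s - x)"

lemma V_measurable [measurable]: "V \<in> borel_measurable borel"
  unfolding V_def[abs_def] by measurable

sublocale mu: prob_space \<mu> by (rule prob_mu)

definition pgf :: "real \<Rightarrow> real" where
  "pgf t = (\<integral>k. t ^ k \<partial>measure_pmf p)"

lemma integrable_pgf [simp]:
  fixes t :: real
  assumes "0 \<le> t" "t \<le> 1"
  shows "integrable (measure_pmf p) (\<lambda>k. t ^ k)"
proof (rule measure_pmf.integrable_const_bound)
  show "AE k in measure_pmf p. norm (t ^ k) \<le> 1" using assms by (simp add: power_le_one)
qed simp

lemma m_pos: "m > 0"
proof -
  have "(\<integral>k. 2 \<partial>measure_pmf p) \<le> (\<integral>k. real k \<partial>measure_pmf p)"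
    using offspring_mean(1) offspring_ge_2 by (intro integral_mono_AE) (auto simp: AE_measure_pmf_iff)
  then show ?thesis by (simp add: offspring_mean)
qed

lemma pgf_mono: "0 \<le> t \<Longrightarrow> t \<le> u \<Longrightarrow> u \<le> 1 \<Longrightarrow> pgf t \<le> pgf u"
  unfolding pgf_def by (intro integral_mono integrable_pgf power_mono) auto

lemma pgf_bounds: "0 \<le> t \<Longrightarrow> t \<le> 1 \<Longrightarrow> 0 \<le> pgf t \<and> pgf t \<le> 1"
proof (intro conjI)
  assume t: "0 \<le> t" "t \<le> 1"
  show "0 \<le> pgf t" unfolding pgf_def using t by (intro integral_nonneg_AE) auto
  have "pgf t \<le> (\<integral>k. 1 \<partial>measure_pmf p)"
    unfolding pgf_def using t by (intro integral_mono) (auto simp: power_le_one)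
  then show "pgf t \<le> 1" by simp
qed

text \<open>The quadratic gain exists because there are always at least two children. It is the
  strict defect that drives the additive martingale to 0.\<close>

lemma pgf_upper:
  fixes a :: real
  assumes "0 \<le> a" "a \<le> 1"
  shows "1 - pgf (1 - a) \<le> m * a - a\<^sup>2"
proof -
  have "1 - pgf (1 - a) = (\<integral>k. 1 - (1 - a) ^ k \<partial>measure_pmf p)"
    unfolding pgf_def using assms by simp
  also have "\<dots> \<le> (\<integral>k. real k * a - a\<^sup>2 \<partial>measure_pmf p)"
    using assms offspring_mean(1) offspring_ge_2
    by (intro integral_mono_AE) (auto simp: AE_measure_pmf_iff intro!: one_minus_power_upper)
  also have "\<dots> = m * a - a\<^sup>2"
    using offspring_mean by simp
  finally show ?thesis .
qed

definition moment :: real where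
  "moment = (\<integral>k. real k powr q \<partial>measure_pmf p)"

lemma moment_nonneg: "moment \<ge> 0"
  by (simp add: moment_def)

lemma pgf_lower:
  fixes a :: real
  assumes "0 \<le> a" "a \<le> 1"
  shows "m * a - moment * a powr q \<le> 1 - pgf (1 - a)"
proof -
  have "m * a - moment * a powr q = (\<integral>k. real k * a - real k powr q * a powr q \<partial>measure_pmf p)"
    using offspring_mean offspring_moment by (simp add: moment_def)
  also have "\<dots> \<le> (\<integral>k. 1 - (1 - a) ^ k \<partial>measure_pmf p)"
    using assms offspring_mean(1) offspring_moment q
    by (intro integral_mono) (auto simp: powr_mult[symmetric] intro!: one_minus_power_lower,
      auto simp: powr_mult)
  also have "\<dots> = 1 - pgf (1 - a)"
    unfolding pgf_def using assms by simp
  finally show ?thesis .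
qed

text \<open>The many-to-one law of one step, under which \<open>V\<close> is centred because \<open>\<theta>\<close> minimises the normalised
  moment generating function.\<close>

definition tilted :: "real measure" where
  "tilted = distr (density \<mu> (\<lambda>x. ennreal (m * exp (- V x)))) borel V"

lemma sets_tilted [simp, measurable_cong]: "sets tilted = sets borel"
  by (simp add: tilted_def)

lemma integrable_tilted:
  assumes [measurable]: "f \<in> borel_measurable borel"
  shows "integrable tilted f \<longleftrightarrow> integrable \<mu> (\<lambda>x. m * exp (- V x) * f (V x))"
  unfolding tilted_def using m_pos
  by (subst integrable_distr_eq) (auto simp: integrable_density)

lemma integral_tilted:
  fixes f :: "real \<Rightarrow> real"
  assumes [measurable]: "f \<in> borel_measurable borel"
  shows "(\<integral>y. f y \<partial>tilted) = (\<integral>x. m * exp (- V x) * f (V x) \<partial>\<mu>)"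
  unfolding tilted_def using m_pos
  by (subst integral_distr) (auto simp: integral_density)

lemma exp_shift: "exp (- V x) * exp (- r * V x) = exp (- (1 + r) * (\<theta> * (s - x)))"
  by (simp add: V_def exp_add[symmetric] algebra_simps)

text \<open>The weight exp (- V) raises the order of an exponential moment by one, so these are
  \<open>expo\<close> and \<open>critical\<close> with the exponent moved by 1.\<close>

lemma tilted_expo:
  assumes "-1 < r" "r < \<rho>"
  shows "integrable tilted (\<lambda>y. exp (- r * y))" "(\<integral>y. exp (- r * y) \<partial>tilted) \<ge> 1"
proof -
  have eq: "m * exp (- V x) * exp (- r * V x) = m * exp (- (1 + r) * (\<theta> * (s - x)))" for x
    by (simp only: mult.assoc exp_shift)
  show "integrable tilted (\<lambda>y. exp (- r * y))"
    using expo[of "1 + r"] assms by (subst integrable_tilted) (auto simp only: eq, auto)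
  show "(\<integral>y. exp (- r * y) \<partial>tilted) \<ge> 1"
    using critical[of "1 + r"] assms by (subst integral_tilted) (auto simp only: eq, auto)
qed

lemma prob_space_tilted: "prob_space tilted"
proof
  have "emeasure tilted (space tilted) = (\<integral>\<^sup>+x. ennreal (m * exp (- V x)) \<partial>\<mu>)"
    by (simp add: tilted_def emeasure_distr emeasure_density)
  also have "\<dots> = ennreal (\<integral>x. m * exp (- V x) \<partial>\<mu>)"
    using expo[of 1] \<rho>_pos m_pos by (intro nn_integral_eq_integral) (auto simp: V_def)
  also have "(\<integral>x. m * exp (- V x) \<partial>\<mu>) = 1"
    using normalised by (simp add: V_def)
  finally show "emeasure tilted (space tilted) = 1" by simp
qed

sublocale tilted: prob_space tilted by (rule prob_space_tilted)

lemma tilted_exp: "integrable tilted exp"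
proof -
  have "integrable tilted (\<lambda>y. exp y) \<longleftrightarrow> integrable \<mu> (\<lambda>x. m)"
    by (subst integrable_tilted) (auto simp: mult.assoc exp_add[symmetric])
  then show ?thesis by simp
qed

text \<open>The map r \<mapsto> E exp (- r y) has a minimum at 0. Its difference quotients are
  nonnegative on the right and nonpositive on the left, and both converge to minus the mean.\<close>

lemma tilted_mean: "integrable tilted (\<lambda>y. y)" "(\<integral>y. y \<partial>tilted) = 0"
proof -
  \<comment> \<open>A third, so that the exponents 2 c and - 2 c both stay inside the interval where
    moments exist; the extra c absorbs the linear factor in the dominating function
    \<open>B\<close>.\<close>
  define c where "c = min 1 \<rho> / 3"
  have c: "c > 0" "2 * c < 1" "2 * c < \<rho>" using \<rho>_pos by (auto simp: c_def)
  define B where "B y = (exp (- (2 * c) * y) + exp (- (- (2 * c)) * y)) / c" for y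
  have B_int: "integrable tilted B"
    unfolding B_def[abs_def] using c
    by (intro Bochner_Integration.integrable_divide Bochner_Integration.integrable_add tilted_expo) auto
  have B_bound: "\<bar>y\<bar> * exp (c * \<bar>y\<bar>) \<le> B y" for y
  proof -
    have "c * \<bar>y\<bar> \<le> exp (c * \<bar>y\<bar>)" using exp_ge_add_one_self[of "c * \<bar>y\<bar>"] by linarith
    then have "c * \<bar>y\<bar> * exp (c * \<bar>y\<bar>) \<le> exp (c * \<bar>y\<bar>) * exp (c * \<bar>y\<bar>)" by (intro mult_right_mono) auto
    also have "\<dots> = exp (2 * c * \<bar>y\<bar>)" by (simp add: exp_add[symmetric])
    also have "\<dots> \<le> exp (- (2 * c) * y) + exp (- (- (2 * c)) * y)"
      by (cases "y \<ge> 0") auto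
    finally show ?thesis using c by (simp add: B_def field_simps)
  qed
  have y_bound: "\<bar>y\<bar> \<le> B y" for y
  proof -
    have "\<bar>y\<bar> * 1 \<le> \<bar>y\<bar> * exp (c * \<bar>y\<bar>)" using c by (intro mult_left_mono) auto
    with B_bound[of y] show ?thesis by simp
  qed
  show int: "integrable tilted (\<lambda>y. y)"
    by (rule Bochner_Integration.integrable_bound[OF B_int]) (auto intro!: AE_I2 order_trans[OF y_bound])
  define r where "r n = c / real (Suc n)" for n
  have r: "0 < r n" "r n \<le> c" for n using c by (auto simp: r_def divide_le_eq mult_le_cancel_left1)
  have r_lim: "r \<longlonglongrightarrow> 0" unfolding r_def by real_asymp
  \<comment> \<open>The sign \<sigma> treats the right and the left derivative together.\<close>
  have lim: "(\<lambda>n. \<integral>y. (exp (- (\<sigma> * r n) * y) - 1) / (\<sigma> * r n) \<partial>tilted) \<longlonglongrightarrow> (\<integral>y. - y \<partial>tilted)"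
    if \<sigma>: "\<bar>\<sigma>\<bar> = 1" for \<sigma> :: real
  proof (rule integral_dominated_convergence[OF _ _ B_int])
    show "AE y in tilted. (\<lambda>n. (exp (- (\<sigma> * r n) * y) - 1) / (\<sigma> * r n)) \<longlonglongrightarrow> - y"
    proof (rule AE_I2)
      fix y
      have "((\<lambda>u. exp (- u * y)) has_real_derivative - y) (at 0)"
        by (auto intro!: derivative_eq_intros)
      then have "((\<lambda>u. (exp (- u * y) - exp (- 0 * y)) / (u - 0)) \<longlongrightarrow> - y) (at 0)"
        by (simp only: has_field_derivative_iff)
      moreover have "filterlim (\<lambda>n. \<sigma> * r n) (at 0) sequentially"
        unfolding filterlim_at
      proof
        show "(\<lambda>n. \<sigma> * r n) \<longlonglongrightarrow> 0" using tendsto_mult_right_zero[OF r_lim] by simp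
        show "eventually (\<lambda>n. \<sigma> * r n \<in> UNIV \<and> \<sigma> * r n \<noteq> 0) sequentially"
          using r \<sigma> by (auto intro!: always_eventually simp: less_imp_neq[symmetric])
      qed
      ultimately have "(\<lambda>n. (exp (- (\<sigma> * r n) * y) - exp (- 0 * y)) / (\<sigma> * r n - 0)) \<longlonglongrightarrow> - y"
        by (rule filterlim_compose)
      then show "(\<lambda>n. (exp (- (\<sigma> * r n) * y) - 1) / (\<sigma> * r n)) \<longlonglongrightarrow> - y" by simp
    qed
    show "AE y in tilted. norm ((exp (- (\<sigma> * r n) * y) - 1) / (\<sigma> * r n)) \<le> B y" for n
    proof (rule AE_I2)
      fix y
      have "\<bar>exp (- (\<sigma> * r n) * y) - 1\<bar> \<le> \<bar>- (\<sigma> * r n) * y\<bar> * exp \<bar>- (\<sigma> * r n) * y\<bar>"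
        by (rule abs_exp_minus_one_le)
      also have "\<bar>- (\<sigma> * r n) * y\<bar> = r n * \<bar>y\<bar>" using \<sigma> r[of n] by (simp add: abs_mult)
      finally have "norm ((exp (- (\<sigma> * r n) * y) - 1) / (\<sigma> * r n)) \<le> \<bar>y\<bar> * exp (r n * \<bar>y\<bar>)"
        using \<sigma> r[of n] by (simp add: abs_mult field_simps)
      also have "\<dots> \<le> \<bar>y\<bar> * exp (c * \<bar>y\<bar>)" using r[of n] by (intro mult_left_mono) (auto intro!: mult_right_mono)
      also have "\<dots> \<le> B y" by (rule B_bound)
      finally show "norm ((exp (- (\<sigma> * r n) * y) - 1) / (\<sigma> * r n)) \<le> B y" .
    qed
  qed measurable
  have val: "(\<integral>y. (exp (- u * y) - 1) / u \<partial>tilted) = ((\<integral>y. exp (- u * y) \<partial>tilted) - 1) / u"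
    if "-1 < u" "u < \<rho>" for u
    using tilted_expo(1)[OF that] by (simp add: tilted.prob_space)
  have pos: "((\<integral>y. exp (- r n * y) \<partial>tilted) - 1) / r n \<ge> 0" for n
    using tilted_expo(2)[of "r n"] r[of n] c by simp
  have neg: "((\<integral>y. exp (- (- r n) * y) \<partial>tilted) - 1) / (- r n) \<le> 0" for n
    using tilted_expo(2)[of "- r n"] r[of n] c by (simp add: divide_nonneg_pos)
  have "0 \<le> (\<integral>y. - y \<partial>tilted)"
  proof (rule LIMSEQ_le_const[OF lim[of 1]], simp, intro exI allI impI)
    fix n show "0 \<le> (\<integral>y. (exp (- (1 * r n) * y) - 1) / (1 * r n) \<partial>tilted)"
      using pos[of n] val[of "r n"] r[of n] c by simp
  qed
  moreover have "(\<integral>y. - y \<partial>tilted) \<le> 0"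
  proof (rule LIMSEQ_le_const2[OF lim[of "-1"]], simp, intro exI allI impI)
    fix n show "(\<integral>y. (exp (- (-1 * r n) * y) - 1) / (-1 * r n) \<partial>tilted) \<le> 0"
      using neg[of n] val[of "- r n"] r[of n] c by simp
  qed
  ultimately show "(\<integral>y. y \<partial>tilted) = 0" by simp
qed

text \<open>As y has mean 0, equality would force exp (- r y) = 1 - r y almost surely. The strict
  tangent inequality then excludes y \<ge> 1, against the unboundedness of V.\<close>

lemma tilted_expo_gt_1:
  assumes "0 < r" "r < \<rho>"
  shows "(\<integral>y. exp (- r * y) \<partial>tilted) > 1"
proof (rule ccontr)
  assume "\<not> (\<integral>y. exp (- r * y) \<partial>tilted) > 1"
  then have "(\<integral>y. exp (- r * y) \<partial>tilted) = 1" using tilted_expo(2)[of r] assms by simp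
  then have "(\<integral>y. exp (- r * y) - 1 + r * y \<partial>tilted) = 0"
    using tilted_expo(1)[of r] tilted_mean assms by (simp add: tilted.prob_space)
  moreover have "integrable tilted (\<lambda>y. exp (- r * y) - 1 + r * y)"
    using tilted_expo(1)[of r] tilted_mean(1) assms by simp
  moreover have nonneg: "0 \<le> exp (- r * y) - 1 + r * y" for y
    using exp_ge_add_one_self[of "- r * y"] by simp
  ultimately have "AE y in tilted. exp (- r * y) - 1 + r * y = 0"
    by (subst (asm) integral_nonneg_eq_0_iff_AE) auto
  then have "AE y in tilted. y < 1"
  proof eventually_elim
    case (elim y)
    show "y < 1"
    proof (rule ccontr)
      assume "\<not> y < 1"
      then have "- r * y \<noteq> 0" using assms by auto
      then have "1 + (- r * y) < exp (- r * y)" by (rule one_plus_less_exp)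
      with elim show False by simp
    qed
  qed
  then have "AE x in \<mu>. V x < 1"
    unfolding tilted_def using m_pos by (subst (asm) AE_distr_iff) (auto simp: AE_density)
  moreover obtain w where "w > 1" "\<not> (AE x in \<mu>. V x < w)"
    using nondegenerate[of 1] unfolding V_def by auto
  moreover from this(1) \<open>AE x in \<mu>. V x < 1\<close> have "AE x in \<mu>. V x < w"
    by (auto elim!: eventually_mono)
  ultimately show False by blast
qed

end

section \<open>Laplace transforms of branching sums\<close>

context critical_brw
begin

abbreviation env :: "(nat list + nat list \<Rightarrow> real) measure" where
  "env \<equiv> env_law p \<mu>"

sublocale env: prob_space env
  by (rule prob_space_env_law) (rule prob_mu)

lemmas env_measurable [measurable] =
  measurable_root_offspring[OF prob_mu sets_mu, of p]
  measurable_child_step[OF prob_mu sets_mu, of _ p]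
  measurable_subtree_env[OF prob_mu sets_mu, of _ p]

lemma child_step_measurable_mu [measurable]: "child_step i \<in> env \<rightarrow>\<^sub>M \<mu>"
  using env_measurable(2) by (simp add: measurable_cong_sets[OF refl sets_mu])

lemma AE_subtree:
  assumes "AE z in env. P z"
  shows "AE z in env. \<forall>i. P (subtree_env i z)"
proof -
  have "AE z in env. P (subtree_env i z)" for i
  proof -
    have "AE z in distr env env (subtree_env i). P z"
      by (subst distr_subtree_env[OF prob_mu sets_mu]) (rule assms)
    from AE_distrD[OF env_measurable(3) this] show ?thesis .
  qed
  then show ?thesis by (simp add: AE_all_countable)
qed

lemma integral_branching:
  assumes [measurable]: "g \<in> borel_measurable (\<mu> \<Otimes>\<^sub>M env)" and g: "\<And>y. 0 \<le> g y" "\<And>y. g y \<le> 1"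
  shows "(\<integral>z. (\<Prod>i<root_offspring z. g (child_step i z, subtree_env i z)) \<partial>env)
    = pgf (\<integral>y. g y \<partial>(\<mu> \<Otimes>\<^sub>M env))" (is "?L = pgf ?G")
proof -
  interpret P: pair_prob_space \<mu> env ..
  have G: "0 \<le> ?G" "?G \<le> 1"
  proof -
    show "0 \<le> ?G" using g by simp
    have "?G \<le> (\<integral>y. 1 \<partial>(\<mu> \<Otimes>\<^sub>M env))"
      using g by (intro integral_mono P.integrable_const_bound[of _ 1]) auto
    then show "?G \<le> 1" by (simp add: P.prob_space)
  qed
  have m1: "(\<lambda>z. \<Prod>i<root_offspring z. g (child_step i z, subtree_env i z)) \<in> borel_measurable env"
  proof (rule measurable_compose_countable[OF _ env_measurable(1)])
    fix n show "(\<lambda>z. \<Prod>i<n. g (child_step i z, subtree_env i z)) \<in> borel_measurable env"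
      by measurable
  qed
  have prod_bounds: "0 \<le> (\<Prod>i<k. g (f i))" "(\<Prod>i<k. g (f i)) \<le> 1" for k :: nat and f
    using g by (simp_all add: prod_nonneg abs_prod abs_of_nonneg prod_le_1)
  have "ennreal ?L = (\<integral>\<^sup>+z. ennreal (\<Prod>i<root_offspring z. g (child_step i z, subtree_env i z)) \<partial>env)"
    using g m1 by (intro nn_integral_eq_integral[symmetric] env.integrable_const_bound[of _ 1])
      (simp_all add: prod_bounds abs_of_nonneg)
  also have "\<dots> = (\<integral>\<^sup>+z. 1 * (\<Prod>i<root_offspring z. ennreal (g (child_step i z, subtree_env i z))) \<partial>env)"
    using g by (simp add: prod_ennreal)
  also have "\<dots> = (\<integral>\<^sup>+k. 1 * (\<integral>\<^sup>+y. ennreal (g y) \<partial>(\<mu> \<Otimes>\<^sub>M env)) ^ k \<partial>measure_pmf p)"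
    by (rule nn_integral_branching[OF prob_mu sets_mu, where c = "\<lambda>_. 1"]) measurable
  also have "(\<integral>\<^sup>+y. ennreal (g y) \<partial>(\<mu> \<Otimes>\<^sub>M env)) = ennreal ?G"
    using g by (intro nn_integral_eq_integral P.integrable_const_bound[of _ 1]) auto
  also have "(\<integral>\<^sup>+k. 1 * ennreal ?G ^ k \<partial>measure_pmf p) = ennreal (pgf ?G)"
    unfolding pgf_def using G
    by (subst nn_integral_eq_integral[symmetric]) (auto simp: ennreal_power)
  finally show ?thesis
    using pgf_bounds[of ?G] G g by (subst (asm) ennreal_inj) (auto intro!: integral_nonneg_AE prod_nonneg)
qed

text \<open>The sum of \<open>F (x + \<theta> (n s - S\<^sub>u))\<close> over the generation \<open>n\<close>, see \<open>branching_sum_tree\<close>.\<close>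

primrec branching_sum :: "(real \<Rightarrow> real) \<Rightarrow> nat \<Rightarrow> real \<Rightarrow> (nat list + nat list \<Rightarrow> real) \<Rightarrow> real" where
  "branching_sum F 0 x z = F x"
| "branching_sum F (Suc n) x z =
     (\<Sum>i<root_offspring z. branching_sum F n (x + V (child_step i z)) (subtree_env i z))"

lemma branching_sum_measurable:
  assumes [measurable]: "F \<in> borel_measurable borel"
  shows "(\<lambda>(x, z). branching_sum F n x z) \<in> borel_measurable (borel \<Otimes>\<^sub>M env)"
proof (induction n)
  case 0
  show ?case by simp
next
  case (Suc n)
  note Suc.IH [measurable]
  have "(\<lambda>y. \<Sum>i<root_offspring (snd y).
      (\<lambda>(x, z). branching_sum F n x z) (fst y + V (child_step i (snd y)), subtree_env i (snd y)))
      \<in> borel_measurable (borel \<Otimes>\<^sub>M env)"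
  proof (rule measurable_compose_countable[where g="\<lambda>y. root_offspring (snd y)"])
    fix k show "(\<lambda>y. \<Sum>i<k. (\<lambda>(x, z). branching_sum F n x z)
        (fst y + V (child_step i (snd y)), subtree_env i (snd y))) \<in> borel_measurable (borel \<Otimes>\<^sub>M env)"
      by measurable
  qed measurable
  then show ?case by (simp add: case_prod_beta')
qed

lemma branching_sum_measurable' [measurable (raw)]:
  assumes "F \<in> borel_measurable borel" "f \<in> borel_measurable N" "g \<in> N \<rightarrow>\<^sub>M env"
  shows "(\<lambda>x. branching_sum F n (f x) (g x)) \<in> borel_measurable N"
  using measurable_compose[OF measurable_Pair[OF assms(2,3)] branching_sum_measurable[OF assms(1)]]
  by simp

lemma branching_sum_nonneg: "(\<And>x. 0 \<le> F x) \<Longrightarrow> 0 \<le> branching_sum F n x z"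
  by (induction n arbitrary: x z) (auto intro!: sum_nonneg)

text \<open>The starting point x plays the part of the Laplace parameter: for \<open>FW\<close> this
  is 1 minus the transform of the additive martingale at exp (- x). Taking 1 minus the transform
  gives nonnegative functions to which subsolution arguments apply.\<close>

definition laplace :: "(real \<Rightarrow> real) \<Rightarrow> nat \<Rightarrow> real \<Rightarrow> real" where
  "laplace F n x = (\<integral>z. 1 - exp (- branching_sum F n x z) \<partial>env)"

lemma
  assumes [measurable]: "F \<in> borel_measurable borel" and F: "\<And>x. 0 \<le> F x"
  shows laplace_measurable: "laplace F n \<in> borel_measurable borel"
    and laplace_nonneg: "0 \<le> laplace F n x"
    and laplace_le_1: "laplace F n x \<le> 1"
    and laplace_0: "laplace F 0 x = 1 - exp (- F x)"
    and laplace_Suc: "laplace F (Suc n) x = 1 - pgf (1 - (\<integral>u. laplace F n (x + V u) \<partial>\<mu>))"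
proof -
  note nonneg = branching_sum_nonneg[OF F]
  have int_exp: "integrable env (\<lambda>z. exp (- branching_sum F n x z))" for n x
    by (rule env.integrable_const_bound[of _ 1]) (use nonneg in auto)
  then have int: "integrable env (\<lambda>z. 1 - exp (- branching_sum F n x z))" for n x by simp
  show meas: "laplace F n \<in> borel_measurable borel" for n
    unfolding laplace_def[abs_def] by measurable
  show bounds: "0 \<le> laplace F n x" "laplace F n x \<le> 1" for n x
  proof -
    show "0 \<le> laplace F n x" unfolding laplace_def using nonneg by (intro integral_nonneg_AE) auto
    have "laplace F n x \<le> (\<integral>z. 1 \<partial>env)"
      unfolding laplace_def using int by (intro integral_mono) auto
    then show "laplace F n x \<le> 1" by (simp add: env.prob_space)
  qed
  show "laplace F 0 x = 1 - exp (- F x)"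
    by (simp add: laplace_def env.prob_space)
  interpret P: pair_prob_space \<mu> env ..
  let ?g = "\<lambda>(u, z). exp (- branching_sum F n (x + V u) z)"
  have "(\<lambda>y. branching_sum F n (x + V (fst y)) (snd y)) \<in> borel_measurable (\<mu> \<Otimes>\<^sub>M env)"
  proof (rule branching_sum_measurable'[OF assms(1) _ measurable_snd])
    have "fst \<in> borel_measurable (\<mu> \<Otimes>\<^sub>M env)"
      using measurable_fst[of \<mu> env] by (simp only: measurable_cong_sets[OF refl sets_mu])
    from measurable_compose[OF this V_measurable]
    show "(\<lambda>y. x + V (fst y)) \<in> borel_measurable (\<mu> \<Otimes>\<^sub>M env)" by simp
  qed
  then have g_meas: "?g \<in> borel_measurable (\<mu> \<Otimes>\<^sub>M env)"
    by (simp add: case_prod_beta')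
  have "laplace F (Suc n) x = 1 - (\<integral>z. (\<Prod>i<root_offspring z. ?g (child_step i z, subtree_env i z)) \<partial>env)"
    using int_exp[of "Suc n" x] by (simp add: laplace_def env.prob_space exp_sum sum_negf[symmetric])
  also have "\<dots> = 1 - pgf (\<integral>y. ?g y \<partial>(\<mu> \<Otimes>\<^sub>M env))"
    by (subst integral_branching[OF g_meas]) (use nonneg in auto)
  also have "(\<integral>y. ?g y \<partial>(\<mu> \<Otimes>\<^sub>M env)) = (\<integral>u. \<integral>z. exp (- branching_sum F n (x + V u) z) \<partial>env \<partial>\<mu>)"
  proof -
    have "integrable (\<mu> \<Otimes>\<^sub>M env) ?g"
      by (rule P.integrable_const_bound[of _ 1]) (use nonneg g_meas in auto)
    from P.integral_fst'[OF this] show ?thesis by simp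
  qed
  also have "\<dots> = (\<integral>u. 1 - laplace F n (x + V u) \<partial>\<mu>)"
    by (rule Bochner_Integration.integral_cong) (use int_exp in \<open>auto simp: laplace_def env.prob_space\<close>)
  also have "\<dots> = 1 - (\<integral>u. laplace F n (x + V u) \<partial>\<mu>)"
  proof -
    have "integrable \<mu> (\<lambda>u. laplace F n (x + V u))"
      by (rule mu.integrable_const_bound[of _ 1]) (use bounds meas in auto)
    then show ?thesis by (simp add: mu.prob_space)
  qed
  finally show "laplace F (Suc n) x = 1 - pgf (1 - (\<integral>u. laplace F n (x + V u) \<partial>\<mu>))" .
qed

text \<open>\<open>FW\<close> and \<open>FD\<close> generate the additive and the derivative martingale; \<open>FU\<close> is the positive part of \<open>FD\<close> and
  gives the same sum as soon as the additive martingale is below \<open>1\<close>.\<close>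

abbreviation FW :: "real \<Rightarrow> real" where "FW v \<equiv> exp (- v)"
abbreviation FD :: "real \<Rightarrow> real" where "FD v \<equiv> v * exp (- v)"
abbreviation FU :: "real \<Rightarrow> real" where "FU v \<equiv> max v 0 * exp (- v)"

lemma branching_sum_W: "branching_sum FW n x z = exp (- x) * branching_sum FW n 0 z"
proof (induction n arbitrary: x z)
  case (Suc n)
  have e: "exp (- x - v) = exp (- x) * exp (- v)" for v by (simp add: exp_add[symmetric])
  show ?case
    by (simp add: Suc.IH[of "x + _"] Suc.IH[of "V _"] sum_distrib_left e mult_ac)
qed simp

text \<open>Shifting the start adds x times the additive martingale. This term must be shown to
  vanish before the limit satisfies a fixed point equation.\<close>

lemma branching_sum_D:
  "branching_sum FD n x z = exp (- x) * (branching_sum FD n 0 z + x * branching_sum FW n 0 z)"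
proof (induction n arbitrary: x z)
  case (Suc n)
  have e: "exp (- x - v) = exp (- x) * exp (- v)" for v by (simp add: exp_add[symmetric])
  show ?case
    by (simp add: Suc.IH[of "x + _"] Suc.IH[of "V _"] branching_sum_W[of n "V _"] sum_distrib_left
        sum.distrib[symmetric] e algebra_simps)
qed simp

text \<open>If the nonnegative terms exp (- v) sum to less than 1, each is below 1, so every v is
  positive and truncation changes nothing.\<close>

lemma branching_sum_U:
  assumes "branching_sum FW n x z < 1"
  shows "branching_sum FU n x z = branching_sum FD n x z" "0 \<le> branching_sum FD n x z"
proof -
  show eq: "branching_sum FU n x z = branching_sum FD n x z"
    using assms
  proof (induction n arbitrary: x z)
    case (Suc n)
    have "branching_sum FW n (x + V (child_step i z)) (subtree_env i z) < 1" if "i < root_offspring z" for i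
    proof -
      have "branching_sum FW n (x + V (child_step i z)) (subtree_env i z) \<le> branching_sum FW (Suc n) x z"
        unfolding branching_sum.simps using that
        by (intro member_le_sum branching_sum_nonneg) auto
      with Suc.prems show ?thesis by simp
    qed
    then show ?case by (simp add: Suc.IH)
  qed simp
  show "0 \<le> branching_sum FD n x z"
    unfolding eq[symmetric] by (rule branching_sum_nonneg) simp
qed

lemma integrable_exp_V: "integrable \<mu> (\<lambda>u. exp (- V u))" "(\<integral>u. exp (- V u) \<partial>\<mu>) = 1 / m"
  using expo[of 1] \<rho>_pos normalised m_pos by (auto simp: V_def field_simps)


section \<open>Vanishing of the additive martingale\<close>

lemma FW_measurable: "FW \<in> borel_measurable borel" by measurable
lemma FU_measurable: "FU \<in> borel_measurable borel" by measurable

lemmas laplace_W = laplace_measurable[OF FW_measurable exp_ge_zero] laplace_nonneg[OF FW_measurable exp_ge_zero]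
  laplace_le_1[OF FW_measurable exp_ge_zero] laplace_0[OF FW_measurable exp_ge_zero] laplace_Suc[OF FW_measurable exp_ge_zero]

lemma shift_integrable:
  assumes [measurable]: "f \<in> borel_measurable borel" and "\<And>x. 0 \<le> f x" "\<And>x. f x \<le> (1::real)"
  shows "integrable \<mu> (\<lambda>u. f (x + V u))"
  by (rule mu.integrable_const_bound[of _ 1]) (use assms(2,3) in auto)

lemma shift_integral_bounds:
  assumes "f \<in> borel_measurable borel" "\<And>x. 0 \<le> f x" "\<And>x. f x \<le> (1::real)"
  shows "0 \<le> (\<integral>u. f (x + V u) \<partial>\<mu>)" "(\<integral>u. f (x + V u) \<partial>\<mu>) \<le> 1"
proof -
  show "0 \<le> (\<integral>u. f (x + V u) \<partial>\<mu>)" using assms by simp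
  have "(\<integral>u. f (x + V u) \<partial>\<mu>) \<le> (\<integral>u. 1 \<partial>\<mu>)"
    using assms by (intro integral_mono shift_integrable) auto
  then show "(\<integral>u. f (x + V u) \<partial>\<mu>) \<le> 1" by (simp add: mu.prob_space)
qed

text \<open>Since the recursion is monotone, only the first step needs an argument. There Jensen is
  applied twice, to the displacement and to the offspring number.\<close>

lemma laplace_W_decreasing: "laplace FW (Suc n) x \<le> laplace FW n x"
proof (induction n arbitrary: x)
  case 0
  define y where "y = exp (- x) / m"
  have y: "y \<ge> 0" using m_pos by (simp add: y_def)
  have e: "exp (- (x + V u)) = exp (- x) * exp (- V u)" for u by (simp add: exp_add[symmetric])
  have int: "integrable \<mu> (\<lambda>u. exp (- (x + V u)))" "(\<integral>u. exp (- (x + V u)) \<partial>\<mu>) = y"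
    unfolding e using integrable_exp_V by (simp_all add: y_def)
  have "exp (- (\<integral>u. exp (- (x + V u)) \<partial>\<mu>)) \<le> (\<integral>u. exp (- exp (- (x + V u))) \<partial>\<mu>)"
    by (rule mu.exp_jensen[OF int(1)]) simp
  then have c: "exp (- y) \<le> (\<integral>u. exp (- exp (- (x + V u))) \<partial>\<mu>)" by (simp only: int)
  have "integrable \<mu> (\<lambda>u. exp (- exp (- (x + V u))))"
    by (rule shift_integrable[where f="\<lambda>x. exp (- exp (- x))"]) auto
  then have eq: "1 - (\<integral>u. laplace FW 0 (x + V u) \<partial>\<mu>) = (\<integral>u. exp (- exp (- (x + V u))) \<partial>\<mu>)"
    by (simp add: laplace_W mu.prob_space)
  have "exp (- exp (- x)) = exp (- (\<integral>k. real k * y \<partial>measure_pmf p))"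
    using offspring_mean m_pos by (simp add: y_def)
  also have "\<dots> \<le> (\<integral>k. exp (- (real k * y)) \<partial>measure_pmf p)"
    by (rule measure_pmf.exp_jensen) (use offspring_mean y in auto)
  also have "\<dots> = pgf (exp (- y))"
    by (simp add: pgf_def exp_of_nat_mult[symmetric])
  also have "\<dots> \<le> pgf (1 - (\<integral>u. laplace FW 0 (x + V u) \<partial>\<mu>))"
    using c shift_integral_bounds(1)[OF laplace_W(1-3), of 0 x] unfolding eq[symmetric] by (intro pgf_mono) auto
  finally show ?case by (simp only: laplace_W)
next
  case (Suc n)
  have "(\<integral>u. laplace FW (Suc n) (x + V u) \<partial>\<mu>) \<le> (\<integral>u. laplace FW n (x + V u) \<partial>\<mu>)"
    by (intro integral_mono shift_integrable laplace_W(1-3) Suc.IH)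
  then have "pgf (1 - (\<integral>u. laplace FW n (x + V u) \<partial>\<mu>)) \<le> pgf (1 - (\<integral>u. laplace FW (Suc n) (x + V u) \<partial>\<mu>))"
    using shift_integral_bounds[OF laplace_W(1-3), of n x] shift_integral_bounds[OF laplace_W(1-3), of "Suc n" x]
    by (intro pgf_mono) auto
  then show ?case by (simp only: laplace_W(5)) 
qed

lemma laplace_W_le_exp: "laplace FW n x \<le> exp (- x)"
proof (induction n arbitrary: x)
  case 0
  show ?case using exp_ge_add_one_self[of "- exp (- x)"] by (simp add: laplace_W)
next
  case (Suc n)
  let ?a = "\<integral>u. laplace FW n (x + V u) \<partial>\<mu>"
  have e: "exp (- (x + V u)) = exp (- x) * exp (- V u)" for u by (simp add: exp_add[symmetric])
  have "integrable \<mu> (\<lambda>u. exp (- (x + V u)))" unfolding e using integrable_exp_V by simp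
  then have "?a \<le> (\<integral>u. exp (- (x + V u)) \<partial>\<mu>)"
    by (intro integral_mono shift_integrable[OF laplace_W(1-3)] Suc.IH)
  also have "\<dots> = exp (- x) / m" unfolding e using integrable_exp_V by simp
  finally have "m * ?a \<le> exp (- x)" using m_pos by (simp add: field_simps)
  moreover have "1 - pgf (1 - ?a) \<le> m * ?a - ?a\<^sup>2"
    by (intro pgf_upper shift_integral_bounds laplace_W)
  ultimately show ?case by (simp add: laplace_W(5)) (smt (verit) zero_le_power2)
qed

text \<open>With l = exp (- x) the quantity is (1 - E exp (- l W)) / l, which decreases in l by
  concavity.\<close>

lemma laplace_W_scaled_mono:
  assumes "x \<le> y"
  shows "exp x * laplace FW n x \<le> exp y * laplace FW n y"
proof -
  have int: "integrable env (\<lambda>z. 1 - exp (- branching_sum FW n x z))" for x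
  proof (rule env.integrable_const_bound)
    show "AE z in env. norm (1 - exp (- branching_sum FW n x z)) \<le> 1"
      using branching_sum_nonneg[of FW n x] by (auto intro!: AE_I2)
  qed measurable
  have "exp x * laplace FW n x = (\<integral>z. exp x * (1 - exp (- branching_sum FW n x z)) \<partial>env)"
    by (simp add: laplace_def)
  also have "\<dots> \<le> (\<integral>z. exp y * (1 - exp (- branching_sum FW n y z)) \<partial>env)"
  proof (intro integral_mono integrable_mult_right int)
    fix z
    let ?w = "branching_sum FW n 0 z"
    have e: "exp (- y) = exp (x - y) * exp (- x)" by (simp add: exp_add[symmetric])
    have "exp (x - y) * (1 - exp (- (exp (- x) * ?w))) \<le> 1 - exp (- (exp (x - y) * (exp (- x) * ?w)))"
      using assms by (intro one_minus_exp_scaled) auto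
    then have "exp y * (exp (x - y) * (1 - exp (- (exp (- x) * ?w)))) \<le> exp y * (1 - exp (- (exp (- y) * ?w)))"
      unfolding e by (intro mult_left_mono) (simp_all add: mult.assoc)
    also have "exp y * (exp (x - y) * (1 - exp (- (exp (- x) * ?w)))) = exp x * (1 - exp (- (exp (- x) * ?w)))"
      by (simp only: mult.assoc[symmetric] exp_add[symmetric]) simp
    finally show "exp x * (1 - exp (- branching_sum FW n x z)) \<le> exp y * (1 - exp (- branching_sum FW n y z))"
      by (subst (1 2) branching_sum_W)
  qed
  also have "\<dots> = exp y * laplace FW n y"
    by (simp add: laplace_def)
  finally show ?thesis .
qed

text \<open>The limit A of the transforms and its average a over one displacement satisfy A \<le> m
  a - a^2. If the square vanishes, so does A; hence it suffices that the square is an impossible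
  defect.\<close>

theorem laplace_W_tendsto_0: "(\<lambda>n. laplace FW n x) \<longlonglongrightarrow> 0"
proof -
  define A where "A x = (INF n. laplace FW n x)" for x
  have dec: "decseq (\<lambda>n. laplace FW n x)" for x
    by (rule decseq_SucI) (rule laplace_W_decreasing)
  have bdd: "bdd_below (range (\<lambda>n. laplace FW n x))" for x
    by (rule bdd_belowI[of _ 0]) (auto simp: laplace_W)
  have A_lim: "(\<lambda>n. laplace FW n x) \<longlonglongrightarrow> A x" for x
    unfolding A_def by (rule LIMSEQ_decseq_INF[OF bdd dec])
  have A_le: "A x \<le> laplace FW n x" for x n
    unfolding A_def by (rule cINF_lower[OF bdd]) simp
  have A_meas [measurable]: "A \<in> borel_measurable borel"
    by (rule borel_measurable_LIMSEQ_metric[OF laplace_W(1) A_lim])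
  have A_nonneg: "0 \<le> A x" for x
    by (rule LIMSEQ_le_const[OF A_lim]) (auto simp: laplace_W)
  have A_1: "A x \<le> 1" for x
    using A_le[of x 0] laplace_W(3)[of 0 x] by linarith
  define a where "a x = (\<integral>u. A (x + V u) \<partial>\<mu>)" for x
  have a_nonneg: "0 \<le> a x" for x unfolding a_def using A_nonneg by simp
  have a_meas [measurable]: "a \<in> borel_measurable borel"
    unfolding a_def[abs_def] by measurable
  have a_lim: "(\<lambda>n. \<integral>u. laplace FW n (x + V u) \<partial>\<mu>) \<longlonglongrightarrow> a x" for x
    unfolding a_def
  proof (rule integral_dominated_convergence[where w="\<lambda>_. 1"])
    note laplace_W(1)[measurable]
    show "(\<lambda>u. laplace FW n (x + V u)) \<in> borel_measurable \<mu>" for n by measurable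
    show "(\<lambda>u. A (x + V u)) \<in> borel_measurable \<mu>" by measurable
  qed (use A_lim laplace_W in auto)
  have A_sub: "A x \<le> m * a x - (a x)\<^sup>2" for x
  proof (rule LIMSEQ_le_const)
    show "(\<lambda>n. m * (\<integral>u. laplace FW n (x + V u) \<partial>\<mu>) - (\<integral>u. laplace FW n (x + V u) \<partial>\<mu>)\<^sup>2)
        \<longlonglongrightarrow> m * a x - (a x)\<^sup>2"
      by (intro tendsto_intros a_lim)
    show "\<exists>N. \<forall>n\<ge>N. A x \<le> m * (\<integral>u. laplace FW n (x + V u) \<partial>\<mu>) - (\<integral>u. laplace FW n (x + V u) \<partial>\<mu>)\<^sup>2"
    proof (intro exI allI impI)
      fix n :: nat
      let ?a = "\<integral>u. laplace FW n (x + V u) \<partial>\<mu>"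
      have "A x \<le> laplace FW (Suc n) x" by (rule A_le)
      also have "\<dots> = 1 - pgf (1 - ?a)" by (rule laplace_W)
      also have "\<dots> \<le> m * ?a - ?a\<^sup>2"
        by (intro pgf_upper shift_integral_bounds laplace_W)
      finally show "A x \<le> m * ?a - ?a\<^sup>2" .
    qed
  qed
  \<comment> \<open>The factor exp x converts m times a mean under \<mu> into a mean under the
    tilted law, making \<open>h\<close> subharmonic for the centred walk with defect
    \<open>d\<close>.\<close>
  define h where "h x = exp x * A x" for x
  define d where "d x = exp x * (a x)\<^sup>2" for x
  have h_mono: "mono h"
  proof
    fix x y :: real assume "x \<le> y"
    then show "h x \<le> h y"
      unfolding h_def by (intro LIMSEQ_le[OF tendsto_mult_left[OF A_lim] tendsto_mult_left[OF A_lim]])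
        (auto intro: laplace_W_scaled_mono)
  qed
  have "AE x in lborel. d x = 0"
  proof (rule subharmonic_deficit_zero[OF prob_space_tilted sets_tilted tilted_mean tilted_exp h_mono])
    show "0 \<le> h x" for x using A_nonneg by (simp add: h_def)
    show "h x \<le> exp x" for x using A_1[of x] by (simp add: h_def)
    show "h x \<le> 1" for x
    proof -
      have "A x \<le> exp (- x)" using A_le[of x 0] laplace_W_le_exp[of 0 x] by linarith
      then have "exp x * A x \<le> exp x * exp (- x)" by (intro mult_left_mono) auto
      then show ?thesis by (simp add: h_def exp_add[symmetric])
    qed
    show "d \<in> borel_measurable borel" unfolding d_def[abs_def] by measurable
    show "0 \<le> d x" for x by (simp add: d_def)
    show "h x + d x \<le> (\<integral>y. h (x + y) \<partial>tilted)" for x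
    proof -
      have h_meas: "(\<lambda>y. h (x + y)) \<in> borel_measurable borel"
        unfolding h_def by measurable
      have e: "m * exp (- V u) * h (x + V u) = (m * exp x) * A (x + V u)" for u
        by (simp add: h_def exp_add[symmetric] mult_ac)
      have "(\<integral>y. h (x + y) \<partial>tilted) = (m * exp x) * a x"
        unfolding integral_tilted[OF h_meas] e a_def by simp
      moreover have "exp x * A x \<le> exp x * (m * a x - (a x)\<^sup>2)"
        using A_sub by (intro mult_left_mono) auto
      ultimately show ?thesis by (simp add: h_def d_def algebra_simps)
    qed
  qed
  then have ae: "AE x in lborel. A x = 0"
  proof eventually_elim
    case (elim x)
    then have "a x = 0" by (simp add: d_def)
    with A_sub[of x] A_nonneg[of x] show ?case by simp
  qed
  \<comment> \<open>From almost every x to every x: some y > x is a zero, and \<open>h\<close> is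
    monotone and nonnegative.\<close>
  have "A x = 0"
  proof -
    have "\<exists>y>x. A y = 0"
    proof (rule ccontr)
      assume "\<not> (\<exists>y>x. A y = 0)"
      then have "{x<..<x + 1} \<subseteq> {y. A y \<noteq> 0}" by auto
      moreover have "{y. A y \<noteq> 0} \<in> null_sets lborel"
        by (subst AE_iff_null_sets) (use ae in auto)
      ultimately have "emeasure lborel {x<..<x + 1} = 0"
        using emeasure_mono[of "{x<..<x + 1}" "{y. A y \<noteq> 0}" lborel] by auto
      then show False by simp
    qed
    then obtain y where "y > x" "A y = 0" by blast
    then have "h x \<le> 0" using monoD[OF h_mono, of x y] by (simp add: h_def)
    then show ?thesis using A_nonneg[of x] by (simp add: h_def mult_le_0_iff)
  qed
  with A_lim[of x] show ?thesis by simp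
qed

text \<open>The transform at 0 is the L1 norm of 1 - exp (- W_n). A subsequence is enough later,
  because D_n converges along the full sequence.\<close>

lemma W_subsequence:
  obtains r :: "nat \<Rightarrow> nat" where "strict_mono r"
    "AE z in env. (\<lambda>n. branching_sum FW (r n) 0 z) \<longlonglongrightarrow> 0"
proof -
  let ?u = "\<lambda>n z. 1 - exp (- branching_sum FW n 0 z)"
  have nonneg: "0 \<le> branching_sum FW n 0 z" for n z by (rule branching_sum_nonneg) simp
  have int: "integrable env (?u n)" for n
  proof (rule env.integrable_const_bound)
    show "AE z in env. norm (?u n z) \<le> 1" using nonneg by (auto intro!: AE_I2)
  qed measurable
  have "(\<integral>z. norm (?u n z) \<partial>env) = laplace FW n 0" for n
    unfolding laplace_def using nonneg by (intro Bochner_Integration.integral_cong) auto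
  then have "(\<lambda>n. \<integral>z. norm (?u n z) \<partial>env) \<longlonglongrightarrow> 0"
    using laplace_W_tendsto_0[of 0] by simp
  from tendsto_L1_AE_subseq[OF int this] obtain r where r: "strict_mono r"
    "AE z in env. (\<lambda>n. ?u (r n) z) \<longlonglongrightarrow> 0" by blast
  from r(2) have "AE z in env. (\<lambda>n. branching_sum FW (r n) 0 z) \<longlonglongrightarrow> 0"
  proof eventually_elim
    case (elim z)
    then have "(\<lambda>n. 1 - ?u (r n) z) \<longlonglongrightarrow> 1 - 0" by (intro tendsto_intros)
    then have "(\<lambda>n. - ln (exp (- branching_sum FW (r n) 0 z))) \<longlonglongrightarrow> - ln 1"
      by (intro tendsto_intros) auto
    then show ?case by simp
  qed
  with r(1) that show ?thesis by blast
qed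


section \<open>Transforms of the truncated derivative martingale stay away from zero\<close>

lemmas laplace_U = laplace_measurable[OF FU_measurable] laplace_nonneg[OF FU_measurable]
  laplace_le_1[OF FU_measurable] laplace_0[OF FU_measurable] laplace_Suc[OF FU_measurable]

lemma FU_nonneg: "0 \<le> FU x" by simp

text \<open>A fixed function f below the initial transform stays below all later ones if one step of
  the monotone recursion maps it above itself. The drift is handled by
  \<open>killed_subsolution\<close>, and its margin covers the nonlinear error of
  \<open>pgf_lower\<close>.\<close>

lemma laplace_U_lower:
  obtains x \<epsilon> :: real where "x > 0" "\<epsilon> > 0" "\<And>n. \<epsilon> \<le> laplace FU n x"
proof -
  \<comment> \<open>r' < \<rho> keeps the tilted moments finite and r < q - 1 gives \<kappa> < 1.
    The choice \<kappa> q = 1 + r matters: f is bounded by a multiple of exp (- \<kappa> z), so the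
    error a^q is of order exp (- x) exp (- r x), the shape of the available margin.\<close>
  define r' where "r' = min \<rho> (q - 1) / 2"
  define r where "r = r' / 2"
  define \<kappa> where "\<kappa> = (1 + r) / q"
  have r: "0 < r" "r < r'" "r' < \<rho>" "r < \<rho>" "r < q - 1" using \<rho>_pos q by (auto simp: r_def r'_def)
  have \<kappa>: "0 < \<kappa>" "\<kappa> < 1" "\<kappa> * q = 1 + r" using r q by (auto simp: \<kappa>_def)
  define I where "I = (\<integral>u. exp (- \<kappa> * V u) \<partial>\<mu>)"
  have I_int: "integrable \<mu> (\<lambda>u. exp (- \<kappa> * V u))"
    using expo[of \<kappa>] \<kappa> \<rho>_pos by (simp add: V_def)
  have I_nonneg: "I \<ge> 0" by (simp add: I_def)
  define C where "C = moment * (I / (1 - \<kappa>)) powr q"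
  obtain A c where Ac: "A > 0" "c > 1" "A * (c - 1) \<ge> 2"
    and sub: "\<And>x. x \<ge> 0 \<Longrightarrow> x - A * c + A * exp (- r * x) + C * exp (- r * x)
        \<le> (\<integral>y. (if x + y \<ge> 0 then max 0 (x + y - A * c + A * exp (- r * (x + y))) else 0) \<partial>tilted)"
    using killed_subsolution[OF prob_space_tilted sets_tilted tilted_mean r(1,2), of C]
      tilted_expo(1)[of r] tilted_expo(1)[of r'] tilted_expo_gt_1[of r] r by auto
  define k where "k z = (if z \<ge> 0 then max 0 (z - A * c + A * exp (- r * z)) else 0)" for z :: real
  define f where "f z = exp (- z) * k z" for z
  have k_meas [measurable]: "k \<in> borel_measurable borel" unfolding k_def[abs_def] by measurable
  have f_meas [measurable]: "f \<in> borel_measurable borel" unfolding f_def[abs_def] by measurable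
  have k_nonneg: "0 \<le> k z" for z by (simp add: k_def)
  have k_le: "k z \<le> max 0 (z - 2)" for z
  proof (cases "z \<ge> 0")
    case True
    then have "exp (- r * z) \<le> 1" using r by simp
    then have "A * exp (- r * z) \<le> A * 1" using Ac by (intro mult_left_mono) auto
    then show ?thesis using Ac(3) True by (auto simp: k_def algebra_simps)
  qed (simp add: k_def)
  have f_nonneg: "0 \<le> f z" for z using k_nonneg by (simp add: f_def)
  have f_le_FU: "f z \<le> FU z" for z
    using k_le[of z] by (auto simp: f_def mult.commute[of _ "exp (- z)"] intro!: mult_left_mono)
  have FU_le_1: "FU z \<le> 1" for z
  proof -
    have "max z 0 \<le> exp z"
      using exp_ge_add_one_self[of z] exp_gt_zero[of z] by linarith
    then have "max z 0 * exp (- z) \<le> exp z * exp (- z)"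
      by (intro mult_right_mono) auto
    then show ?thesis by (simp add: exp_add[symmetric])
  qed
  have f_le_1: "f z \<le> 1" for z using f_le_FU[of z] FU_le_1[of z] by linarith
  have f_le_exp: "f z \<le> exp (- \<kappa> * z) / (1 - \<kappa>)" for z
  proof -
    have "(1 - \<kappa>) * max z 0 \<le> exp ((1 - \<kappa>) * z)"
    proof (cases "z \<ge> 0")
      case True
      have "(1 - \<kappa>) * z \<le> exp ((1 - \<kappa>) * z)"
        using exp_ge_add_one_self[of "(1 - \<kappa>) * z"] by linarith
      then show ?thesis using True by simp
    qed simp
    then have "(1 - \<kappa>) * max z 0 * exp (- z) \<le> exp ((1 - \<kappa>) * z) * exp (- z)"
      by (intro mult_right_mono) auto
    also have "\<dots> = exp (- \<kappa> * z)" by (simp add: exp_add[symmetric] algebra_simps)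
    finally have "FU z \<le> exp (- \<kappa> * z) / (1 - \<kappa>)" using \<kappa> by (simp add: field_simps)
    with f_le_FU[of z] show ?thesis by linarith
  qed
  have "f x \<le> laplace FU n x" for n x
  proof (induction n arbitrary: x)
    case 0
    show ?case
    \<comment> \<open>The bound A (c - 1) \<ge> 2 was required for this start: f is at most (x - 2)
      exp (- x), and the missing 2 exp (- x) outweighs the quadratic error of 1 - exp (- t).\<close>
    proof (cases "x \<ge> 2")
      case True
      define t where "t = x * exp (- x)"
      have t: "t = FU x" using True by (simp add: t_def)
      have "exp (- t) \<le> 1 - t + t\<^sup>2"
        using FU_le_1[of x] FU_nonneg[of x] unfolding t by (intro exp_minus_upper) auto
      moreover have "t\<^sup>2 \<le> 2 * exp (- x)"
      proof -
        have "x\<^sup>2 \<le> 2 * exp x" using exp_lower_Taylor_quadratic[of x] True by simp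
        then have "x\<^sup>2 * (exp (- x) * exp (- x)) \<le> 2 * exp x * (exp (- x) * exp (- x))"
          by (intro mult_right_mono) auto
        also have "\<dots> = 2 * exp (- x)" by (simp add: exp_add[symmetric])
        finally show ?thesis by (simp add: t_def power2_eq_square mult_ac)
      qed
      moreover have "f x \<le> exp (- x) * (x - 2)"
        using k_le[of x] True by (simp add: f_def)
      moreover have "exp (- x) * (x - 2) = t - 2 * exp (- x)" by (simp add: t_def algebra_simps)
      ultimately show ?thesis
        unfolding laplace_U(4)[OF FU_nonneg] t[symmetric] by linarith
    next
      case False
      then have "k x \<le> 0" using k_le[of x] by simp
      then have "f x \<le> 0" by (simp add: f_def mult_le_0_iff)
      also have "0 \<le> laplace FU 0 x" by (rule laplace_U(2)[OF FU_nonneg])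
      finally show ?thesis .
    qed
  next
    case (Suc n)
    show ?case
    \<comment> \<open>Where f vanishes nothing is to be shown. Where it is positive, x \<ge> 0 and
      neither the killing nor the maximum is active.\<close>
    proof (cases "f x > 0")
      case True
      have x: "x \<ge> 0" and fx: "f x = exp (- x) * (x - A * c + A * exp (- r * x))"
        using True by (auto simp: f_def k_def max_def zero_less_mult_iff split: if_splits)
      define a where "a = (\<integral>u. f (x + V u) \<partial>\<mu>)"
      have a: "0 \<le> a" "a \<le> 1"
        unfolding a_def by (intro shift_integral_bounds f_meas f_nonneg f_le_1)+
      have a_le: "a \<le> (\<integral>u. laplace FU n (x + V u) \<partial>\<mu>)"
        unfolding a_def
        by (intro integral_mono shift_integrable[OF f_meas f_nonneg f_le_1]
            shift_integrable[OF laplace_U(1-3)[OF FU_nonneg]] Suc.IH)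
      have a_eq: "m * a = exp (- x) * (\<integral>y. k (x + y) \<partial>tilted)"
      proof -
        have k_meas': "(\<lambda>y. k (x + y)) \<in> borel_measurable borel" by measurable
        have eq: "m * exp (- V u) * k (x + V u) = m * exp x * f (x + V u)" for u
          by (simp add: f_def exp_add[symmetric])
        have "(\<integral>y. k (x + y) \<partial>tilted) = m * exp x * a"
          unfolding integral_tilted[OF k_meas'] a_def eq by simp
        then show ?thesis by (simp add: exp_minus)
      qed
      have "a \<le> (\<integral>u. exp (- \<kappa> * x) / (1 - \<kappa>) * exp (- \<kappa> * V u) \<partial>\<mu>)"
        unfolding a_def
      proof (rule integral_mono[OF shift_integrable[OF f_meas f_nonneg f_le_1]])
        show "f (x + V u) \<le> exp (- \<kappa> * x) / (1 - \<kappa>) * exp (- \<kappa> * V u)" for u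
          using f_le_exp[of "x + V u"] by (simp add: exp_add[symmetric] algebra_simps)
      qed (use I_int in simp)
      also have "\<dots> = exp (- \<kappa> * x) * (I / (1 - \<kappa>))" by (simp add: I_def)
      finally have "a powr q \<le> (exp (- \<kappa> * x) * (I / (1 - \<kappa>))) powr q"
        using a q by (intro powr_mono2) auto
      also have "\<dots> = exp (- \<kappa> * x) powr q * (I / (1 - \<kappa>)) powr q"
        by (rule powr_mult)
      also have "exp (- \<kappa> * x) powr q = exp (- x) * exp (- r * x)"
      proof -
        have "q * (\<kappa> * x) = (1 + r) * x" using \<kappa>(3) by (metis mult.assoc mult.commute)
        then show ?thesis by (simp add: powr_def exp_add[symmetric] algebra_simps)
      qed
      finally have "moment * a powr q \<le> exp (- x) * (C * exp (- r * x))"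
        using moment_nonneg by (simp add: C_def mult_left_mono mult_ac)
      moreover have "exp (- x) * (x - A * c + A * exp (- r * x) + C * exp (- r * x)) \<le> m * a"
        unfolding a_eq using sub[OF x] by (intro mult_left_mono) (auto simp: k_def)
      ultimately have "f x \<le> m * a - moment * a powr q"
        unfolding fx by (simp add: distrib_left right_diff_distrib)
      also have "\<dots> \<le> 1 - pgf (1 - a)" by (rule pgf_lower[OF a])
      also have "\<dots> \<le> 1 - pgf (1 - (\<integral>u. laplace FU n (x + V u) \<partial>\<mu>))"
        using a a_le shift_integral_bounds[OF laplace_U(1-3)[OF FU_nonneg], of n x]
        by (intro diff_left_mono pgf_mono) auto
      also have "\<dots> = laplace FU (Suc n) x" by (rule laplace_U(5)[OF FU_nonneg, symmetric])
      finally show ?thesis .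
    next
      case False
      then have "f x \<le> 0" by simp
      also have "0 \<le> laplace FU (Suc n) x" by (rule laplace_U(2)[OF FU_nonneg])
      finally show ?thesis .
    qed
  qed
  \<comment> \<open>At this point the linear part x - A c equals 1.\<close>
  moreover have "f (A * c + 1) > 0"
  proof -
    have "A * c + 1 \<ge> 0" using Ac by simp
    moreover have "1 + A * exp (- r * (A * c + 1)) > 0" using Ac by (intro add_pos_pos) auto
    ultimately have "k (A * c + 1) > 0" by (simp add: k_def less_max_iff_disj)
    then show ?thesis by (simp add: f_def)
  qed
  moreover have "A * c + 1 > 0" using Ac by (intro add_pos_pos mult_pos_pos) auto
  ultimately show ?thesis using that by blast
qed

end

section \<open>Fixed point equation, sign and non-triviality of the limit\<close>

locale critical_brw_limit = critical_brw +
  fixes D :: "(nat list + nat list \<Rightarrow> real) \<Rightarrow> real" and b :: nat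
  assumes D_measurable [measurable]: "D \<in> borel_measurable env"
    and D_limit: "AE z in env. (\<lambda>n. branching_sum FD n 0 z) \<longlonglongrightarrow> D z"
    and b_min: "b \<in> set_pmf p" "\<And>k. k \<in> set_pmf p \<Longrightarrow> b \<le> k"
begin

lemma b2: "b \<ge> 2"
  using offspring_ge_2 b_min by blast

text \<open>All three claims are read along the subsequence on which the additive martingale
  vanishes. There the extra term of the decomposition disappears, the sum is eventually nonnegative,
  and a limit 0 would send the transforms of \<open>FU\<close> to 0.\<close>

lemma D_properties:
  shows D_fixed_point: "AE z in env. D z = (\<Sum>i<root_offspring z. exp (- V (child_step i z)) * D (subtree_env i z))"
    and D_nonneg: "AE z in env. 0 \<le> D z"
    and D_nontrivial: "\<not> (AE z in env. D z = 0)"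
proof -
  obtain r where r: "strict_mono r" and W: "AE z in env. (\<lambda>n. branching_sum FW (r n) 0 z) \<longlonglongrightarrow> 0"
    using W_subsequence by blast
  show "AE z in env. D z = (\<Sum>i<root_offspring z. exp (- V (child_step i z)) * D (subtree_env i z))"
    using D_limit AE_subtree[OF D_limit] AE_subtree[OF W]
  proof eventually_elim
    case (elim z)
    have sub: "(\<lambda>n. branching_sum FD (r n) 0 (subtree_env i z)) \<longlonglongrightarrow> D (subtree_env i z)" for i
      using LIMSEQ_subseq_LIMSEQ[OF elim(2)[rule_format, of i] r] by (simp add: comp_def)
    have eq: "branching_sum FD (Suc k) 0 z = (\<Sum>i<root_offspring z. exp (- V (child_step i z))
        * (branching_sum FD k 0 (subtree_env i z) + V (child_step i z) * branching_sum FW k 0 (subtree_env i z)))" for k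
      by (simp add: branching_sum_D[of _ "V _"])
    have "(\<lambda>n. branching_sum FD (Suc (r n)) 0 z) \<longlonglongrightarrow>
      (\<Sum>i<root_offspring z. exp (- V (child_step i z)) * (D (subtree_env i z) + V (child_step i z) * 0))"
      unfolding eq by (intro tendsto_sum tendsto_mult tendsto_add tendsto_const sub elim(3)[rule_format])
    \<comment> \<open>The subtrees are read at generation r n, the whole tree one generation later;
      convergence of the full sequence makes the two limits comparable.\<close>
    moreover have "(\<lambda>n. branching_sum FD (Suc (r n)) 0 z) \<longlonglongrightarrow> D z"
      using LIMSEQ_subseq_LIMSEQ[OF elim(1), of "\<lambda>n. Suc (r n)"] r
      by (simp add: comp_def strict_mono_def)
    ultimately show ?case using LIMSEQ_unique by fastforce
  qed
  show "AE z in env. 0 \<le> D z"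
    using D_limit W
  proof eventually_elim
    case (elim z)
    have "eventually (\<lambda>n. branching_sum FW (r n) 0 z < 1) sequentially"
      using elim(2) by (rule order_tendstoD) simp
    then have "eventually (\<lambda>n. 0 \<le> branching_sum FD (r n) 0 z) sequentially"
      by eventually_elim (rule branching_sum_U)
    moreover have "(\<lambda>n. branching_sum FD (r n) 0 z) \<longlonglongrightarrow> D z"
      using LIMSEQ_subseq_LIMSEQ[OF elim(1) r] by (simp add: comp_def)
    ultimately show ?case by (intro tendsto_lowerbound) auto
  qed
  show "\<not> (AE z in env. D z = 0)"
  proof
    assume "AE z in env. D z = 0"
    obtain x \<epsilon> where x: "x > 0" "\<epsilon> > 0" "\<And>n. \<epsilon> \<le> laplace FU n x"
      using laplace_U_lower by blast
    have "(\<lambda>n. laplace FU (r n) x) \<longlonglongrightarrow> (\<integral>z. 0 \<partial>env)"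
      unfolding laplace_def
    proof (rule integral_dominated_convergence[where w="\<lambda>_. 1"])
      show "AE z in env. (\<lambda>n. 1 - exp (- branching_sum FU (r n) x z)) \<longlonglongrightarrow> 0"
        using D_limit W \<open>AE z in env. D z = 0\<close>
      proof eventually_elim
        case (elim z)
        have D: "(\<lambda>n. branching_sum FD (r n) 0 z) \<longlonglongrightarrow> 0"
          using LIMSEQ_subseq_LIMSEQ[OF elim(1) r] elim(3) by (simp add: comp_def)
        have "(\<lambda>n. exp (- x) * (branching_sum FD (r n) 0 z + x * branching_sum FW (r n) 0 z)) \<longlonglongrightarrow> exp (- x) * (0 + x * 0)"
          by (intro tendsto_intros D elim(2))
        then have lim: "(\<lambda>n. branching_sum FD (r n) x z) \<longlonglongrightarrow> 0"
          by (simp add: branching_sum_D[of _ x])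
        have "eventually (\<lambda>n. branching_sum FW (r n) 0 z < 1) sequentially"
          using elim(2) by (rule order_tendstoD) simp
        then have "eventually (\<lambda>n. branching_sum FD (r n) x z = branching_sum FU (r n) x z) sequentially"
        proof eventually_elim
          case (elim n)
          \<comment> \<open>Because x > 0, shifting the start only decreases the additive
            martingale, so the truncation remains inactive.\<close>
          have "exp (- x) * branching_sum FW (r n) 0 z \<le> 1 * branching_sum FW (r n) 0 z"
            using x by (intro mult_right_mono branching_sum_nonneg) auto
          then have "branching_sum FW (r n) x z < 1"
            using elim by (subst branching_sum_W) simp
          then show ?case by (simp add: branching_sum_U(1))
        qed
        from Lim_transform_eventually[OF lim this] have "(\<lambda>n. branching_sum FU (r n) x z) \<longlonglongrightarrow> 0" .
        then have "(\<lambda>n. 1 - exp (- branching_sum FU (r n) x z)) \<longlonglongrightarrow> 1 - exp (- 0)"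
          by (intro tendsto_intros)
        then show ?case by simp
      qed
      show "AE z in env. norm (1 - exp (- branching_sum FU (r n) x z)) \<le> 1" for n
        using branching_sum_nonneg[of FU "r n" x] by (auto intro!: AE_I2)
    qed measurable
    then have "(\<lambda>n. laplace FU (r n) x) \<longlonglongrightarrow> 0" by simp
    then have "\<epsilon> \<le> 0" by (rule LIMSEQ_le_const) (use x in auto)
    with x show False by simp
  qed
qed

end

section \<open>Small values of the derivative martingale limit\<close>

context critical_brw_limit
begin

lemma pgf_le_power:
  assumes "0 \<le> t" "t \<le> 1"
  shows "pgf t \<le> t ^ b"
proof -
  have "pgf t \<le> (\<integral>k. t ^ b \<partial>measure_pmf p)"
    unfolding pgf_def using assms b_min
    by (intro integral_mono_AE) (auto simp: AE_measure_pmf_iff intro!: power_decreasing)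
  then show ?thesis by simp
qed

lemma measurable_snd_D [measurable]: "(\<lambda>y. D (snd y)) \<in> borel_measurable (\<mu> \<Otimes>\<^sub>M env)"
  by (rule measurable_compose[OF measurable_snd D_measurable])

lemma measurable_fst_V [measurable]: "(\<lambda>y. V (fst y)) \<in> borel_measurable (\<mu> \<Otimes>\<^sub>M env)"
proof -
  have "V \<in> borel_measurable \<mu>" by measurable
  from measurable_compose[OF measurable_fst this] show ?thesis .
qed

text \<open>By the fixed point equation D vanishes exactly when it vanishes for every child, so P (D
  = 0) is a fixed point of the generating function. The latter lies below t^2, which leaves 0 and 1,
  and non-triviality excludes 1.\<close>

lemma D_pos: "AE z in env. 0 < D z"
proof -
  interpret P: pair_prob_space \<mu> env ..
  define g :: "real \<times> (nat list + nat list \<Rightarrow> real) \<Rightarrow> real" where "g y = (if D (snd y) = 0 then 1 else 0)" for y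
  define q0 :: real where "q0 = (\<integral>z. (if D z = 0 then 1 else 0) \<partial>env)"
  have int: "integrable env (\<lambda>z. if D z = 0 then 1 else 0 :: real)"
    by (rule env.integrable_const_bound[of _ 1]) auto
  have g_meas: "g \<in> borel_measurable (\<mu> \<Otimes>\<^sub>M env)"
    unfolding g_def[abs_def] by measurable
  have "integrable (\<mu> \<Otimes>\<^sub>M env) g"
    by (rule P.integrable_const_bound[of _ 1]) (auto simp: g_meas g_def)
  have "(\<integral>u. \<integral>z. g (u, z) \<partial>env \<partial>\<mu>) = q0"
    by (simp add: g_def q0_def mu.prob_space)
  with P.integral_fst'[OF \<open>integrable _ g\<close>] have Eg: "(\<integral>y. g y \<partial>(\<mu> \<Otimes>\<^sub>M env)) = q0"
    by simp
  have "q0 = (\<integral>z. (\<Prod>i<root_offspring z. g (child_step i z, subtree_env i z)) \<partial>env)"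
    unfolding q0_def
  proof (rule integral_cong_AE)
    show "(\<lambda>z. \<Prod>i<root_offspring z. g (child_step i z, subtree_env i z)) \<in> borel_measurable env"
    proof (rule measurable_compose_countable[OF _ env_measurable(1)])
      note g_meas [measurable]
      fix n show "(\<lambda>z. \<Prod>i<n. g (child_step i z, subtree_env i z)) \<in> borel_measurable env"
        by measurable
    qed
    show "AE z in env. (if D z = 0 then 1 else 0) = (\<Prod>i<root_offspring z. g (child_step i z, subtree_env i z))"
      using D_fixed_point AE_subtree[OF D_nonneg]
    proof eventually_elim
      case (elim z)
      have "D z = 0 \<longleftrightarrow> (\<forall>i<root_offspring z. exp (- V (child_step i z)) * D (subtree_env i z) = 0)"
        unfolding elim(1) using elim(2) by (subst sum_nonneg_eq_0_iff) auto
      then have iff: "D z = 0 \<longleftrightarrow> (\<forall>i<root_offspring z. D (subtree_env i z) = 0)" by simp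
      show ?case
      proof (cases "D z = 0")
        case False
        then obtain i where "i < root_offspring z" "D (subtree_env i z) \<noteq> 0" using iff by auto
        then have "(\<Prod>i<root_offspring z. g (child_step i z, subtree_env i z)) = 0"
          by (intro prod_zero) (auto simp: g_def)
        then show ?thesis using False by simp
      qed (use iff in \<open>simp add: g_def\<close>)
    qed
  qed measurable
  also have "\<dots> = pgf q0"
    by (subst integral_branching[OF g_meas]) (simp_all only: Eg, simp_all add: g_def)
  finally have q_fix: "q0 = pgf q0" .
  have q01: "0 \<le> q0" "q0 \<le> 1"
  proof -
    show "0 \<le> q0" unfolding q0_def by (rule integral_nonneg_AE) auto
    have "q0 \<le> (\<integral>z. 1 \<partial>env)" unfolding q0_def using int by (intro integral_mono) auto
    then show "q0 \<le> 1" by (simp add: env.prob_space)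
  qed
  have "q0 \<le> q0 ^ b" using pgf_le_power[OF q01] q_fix by simp
  also have "q0 ^ b \<le> q0 ^ 2" using q01 b2 by (intro power_decreasing) auto
  finally have "q0 * 1 \<le> q0 * q0" by (simp add: power2_eq_square)
  then have "q0 = 0 \<or> q0 \<ge> 1" using q01 by (cases "q0 = 0") (auto simp: mult_le_cancel_left_pos simp del: mult_1_right)
  then have "q0 = 0 \<or> q0 = 1" using q01 by auto
  moreover have "q0 \<noteq> 1"
  proof
    assume "q0 = 1"
    moreover have "(\<integral>z. 1 - (if D z = 0 then 1 else 0) \<partial>env) = (\<integral>z. 1 \<partial>env) - q0"
      unfolding q0_def by (rule Bochner_Integration.integral_diff[OF _ int]) simp
    ultimately have "(\<integral>z. 1 - (if D z = 0 then 1 else 0) \<partial>env) = (0 :: real)"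
      by (simp add: env.prob_space)
    then have "AE z in env. 1 - (if D z = 0 then 1 else 0 :: real) = 0"
      using int by (subst (asm) integral_nonneg_eq_0_iff_AE) auto
    then have "AE z in env. D z = 0" by eventually_elim (auto split: if_splits)
    with D_nontrivial show False by simp
  qed
  ultimately have "q0 = 0" by simp
  then have "AE z in env. (if D z = 0 then 1 else 0 :: real) = 0"
    unfolding q0_def using int by (subst (asm) integral_nonneg_eq_0_iff_AE) auto
  with D_nonneg show ?thesis by eventually_elim (auto split: if_splits)
qed

definition small_prob :: "real \<Rightarrow> real" where
  "small_prob L = env.prob {z \<in> space env. D z < exp (- L)}"

definition left_tail :: "real \<Rightarrow> real" where
  "left_tail z = measure \<mu> {..- z}"

lemma small_prob_integral: "small_prob L = (\<integral>z. (if D z < exp (- L) then 1 else 0) \<partial>env)"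
proof -
  have "small_prob L = (\<integral>z. indicator {z \<in> space env. D z < exp (- L)} z \<partial>env)"
    by (simp add: small_prob_def)
  also have "\<dots> = (\<integral>z. (if D z < exp (- L) then 1 else 0) \<partial>env)"
    by (intro Bochner_Integration.integral_cong) (auto split: split_indicator)
  finally show ?thesis .
qed

lemma left_tail_integral: "left_tail (v / \<theta> - s) = (\<integral>u. (if v \<le> V u then 1 else 0) \<partial>\<mu>)"
proof -
  have "left_tail (v / \<theta> - s) = (\<integral>u. indicator {..- (v / \<theta> - s)} u \<partial>\<mu>)"
    by (simp add: left_tail_def sets_mu)
  also have "\<dots> = (\<integral>u. (if v \<le> V u then 1 else 0) \<partial>\<mu>)"
    using \<theta>_pos by (intro Bochner_Integration.integral_cong) (auto simp: V_def field_simps split: split_indicator)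
  finally show ?thesis .
qed

lemma integrable_small: "integrable env (\<lambda>z. if D z < c then 1 else 0 :: real)"
  by (rule env.integrable_const_bound[of _ 1]) auto

lemma integrable_tail: "integrable \<mu> (\<lambda>u. if v \<le> V u then 1 else 0 :: real)"
  by (rule mu.integrable_const_bound[of _ 1]) auto

text \<open>Terms are nonnegative, so each of at least b children must contribute less than exp (-
  L). A child with V < v does so only if its own limit is below exp (- (L - v)).\<close>

lemma small_prob_rec_upper:
  "small_prob L \<le> (small_prob (L - v) + left_tail (v / \<theta> - s)) ^ b"
proof -
  interpret P: pair_prob_space \<mu> env ..
  define g :: "real \<times> (nat list + nat list \<Rightarrow> real) \<Rightarrow> real" where
    "g y = (if exp (- V (fst y)) * D (snd y) < exp (- L) then 1 else 0)" for y
  have g_meas [measurable]: "g \<in> borel_measurable (\<mu> \<Otimes>\<^sub>M env)"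
    unfolding g_def[abs_def] by measurable
  have g01: "0 \<le> g y" "g y \<le> 1" for y by (auto simp: g_def)
  have g_int: "integrable (\<mu> \<Otimes>\<^sub>M env) g"
    by (rule P.integrable_const_bound[of _ 1]) (auto simp: g01)
  have prod_meas: "(\<lambda>z. \<Prod>i<root_offspring z. g (child_step i z, subtree_env i z)) \<in> borel_measurable env"
  proof (rule measurable_compose_countable[OF _ env_measurable(1)])
    fix n show "(\<lambda>z. \<Prod>i<n. g (child_step i z, subtree_env i z)) \<in> borel_measurable env"
      by measurable
  qed
  have Eg: "0 \<le> (\<integral>y. g y \<partial>(\<mu> \<Otimes>\<^sub>M env))" "(\<integral>y. g y \<partial>(\<mu> \<Otimes>\<^sub>M env)) \<le> 1"
  proof -
    show "0 \<le> (\<integral>y. g y \<partial>(\<mu> \<Otimes>\<^sub>M env))" using g01 by simp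
    have "(\<integral>y. g y \<partial>(\<mu> \<Otimes>\<^sub>M env)) \<le> (\<integral>y. 1 \<partial>(\<mu> \<Otimes>\<^sub>M env))"
      using g01 g_int by (intro integral_mono) auto
    then show "(\<integral>y. g y \<partial>(\<mu> \<Otimes>\<^sub>M env)) \<le> 1" by (simp add: P.prob_space)
  qed
  have "small_prob L \<le> (\<integral>z. (\<Prod>i<root_offspring z. g (child_step i z, subtree_env i z)) \<partial>env)"
    unfolding small_prob_integral
  proof (rule integral_mono_AE[OF integrable_small])
    show "integrable env (\<lambda>z. \<Prod>i<root_offspring z. g (child_step i z, subtree_env i z))"
      by (rule env.integrable_const_bound[OF _ prod_meas, of 1])
        (auto intro!: AE_I2 prod_le_1 simp: abs_prod g_def)
    show "AE z in env. (if D z < exp (- L) then 1 else 0) \<le> (\<Prod>i<root_offspring z. g (child_step i z, subtree_env i z))"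
      using D_fixed_point AE_subtree[OF D_nonneg]
    proof eventually_elim
      case (elim z)
      show ?case
      proof (cases "D z < exp (- L)")
        case True
        have "exp (- V (child_step i z)) * D (subtree_env i z) < exp (- L)" if "i < root_offspring z" for i
        proof -
          have "exp (- V (child_step i z)) * D (subtree_env i z) \<le> D z"
            unfolding elim(1) using that elim(2)
            by (intro member_le_sum) auto
          with True show ?thesis by simp
        qed
        then show ?thesis by (simp add: g_def)
      qed (use g01 in \<open>auto intro: prod_nonneg\<close>)
    qed
  qed
  also have "\<dots> = pgf (\<integral>y. g y \<partial>(\<mu> \<Otimes>\<^sub>M env))"
    by (rule integral_branching[OF g_meas g01])
  also have "\<dots> \<le> (\<integral>y. g y \<partial>(\<mu> \<Otimes>\<^sub>M env)) ^ b" by (rule pgf_le_power[OF Eg])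
  also have "\<dots> \<le> (small_prob (L - v) + left_tail (v / \<theta> - s)) ^ b"
  proof (rule power_mono[OF _ Eg(1)])
    have "(\<integral>y. g y \<partial>(\<mu> \<Otimes>\<^sub>M env)) = (\<integral>u. \<integral>z. g (u, z) \<partial>env \<partial>\<mu>)"
      by (rule P.integral_fst'[OF g_int, symmetric])
    also have "\<dots> \<le> (\<integral>u. small_prob (L - v) + (if v \<le> V u then 1 else 0) \<partial>\<mu>)"
    proof (rule integral_mono)
      show "integrable \<mu> (\<lambda>u. \<integral>z. g (u, z) \<partial>env)" by (rule P.integrable_fst'[OF g_int])
      show "integrable \<mu> (\<lambda>u. small_prob (L - v) + (if v \<le> V u then 1 else 0))"
        using integrable_tail by simp
      fix u assume "u \<in> space \<mu>"
      have meas_u: "(\<lambda>z. g (u, z)) \<in> borel_measurable env"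
        unfolding g_def by measurable
      have int_u: "integrable env (\<lambda>z. g (u, z))"
        by (rule env.integrable_const_bound[OF _ meas_u, of 1]) (use g01 in auto)
      show "(\<integral>z. g (u, z) \<partial>env) \<le> small_prob (L - v) + (if v \<le> V u then 1 else 0)"
      proof (cases "v \<le> V u")
        case True
        have "(\<integral>z. g (u, z) \<partial>env) \<le> (\<integral>z. 1 \<partial>env)"
          using int_u g01 by (intro integral_mono) auto
        moreover have "0 \<le> small_prob (L - v)" by (simp add: small_prob_def)
        ultimately show ?thesis using True by (simp add: env.prob_space)
      next
        case False
        have "(\<integral>z. g (u, z) \<partial>env) \<le> small_prob (L - v)"
          unfolding small_prob_integral
        proof (rule integral_mono[OF int_u integrable_small])
          fix z
          have "D z < exp (- (L - v))" if "exp (- V u) * D z < exp (- L)"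
          proof -
            have "exp (V u) * (exp (- V u) * D z) < exp (V u) * exp (- L)"
              using that by (intro mult_strict_left_mono) auto
            also have "\<dots> \<le> exp (- (L - v))" using False by (simp add: exp_add[symmetric])
            finally show ?thesis by (simp add: mult.assoc[symmetric] exp_add[symmetric])
          qed
          then show "g (u, z) \<le> (if D z < exp (- (L - v)) then 1 else 0)"
            by (auto simp: g_def)
        qed
        then show ?thesis using False by simp
      qed
    qed
    also have "\<dots> = small_prob (L - v) + left_tail (v / \<theta> - s)"
      using integrable_tail by (simp add: left_tail_integral mu.prob_space)
    finally show "(\<integral>y. g y \<partial>(\<mu> \<Otimes>\<^sub>M env)) \<le> small_prob (L - v) + left_tail (v / \<theta> - s)" .
  qed
  finally show ?thesis .
qed

text \<open>The strategy is exactly b children, all with V \<ge> v and with limits so small that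
  each contributes less than exp (- L) / b; the division by b is the shift ln b.\<close>

lemma small_prob_rec_lower:
  "pmf p b * (left_tail (v / \<theta> - s) * small_prob (L - v + ln (real b))) ^ b \<le> small_prob L"
proof -
  interpret P: pair_prob_space \<mu> env ..
  define l where "l = exp (- (L - v + ln (real b)))"
  define g :: "real \<times> (nat list + nat list \<Rightarrow> real) \<Rightarrow> real" where
    "g y = (if v \<le> V (fst y) then 1 else 0) * (if D (snd y) < l then 1 else 0)" for y
  have g_meas [measurable]: "g \<in> borel_measurable (\<mu> \<Otimes>\<^sub>M env)"
    unfolding g_def[abs_def] by measurable
  have g01: "0 \<le> g y" "g y \<le> 1" for y by (auto simp: g_def)
  have g_int: "integrable (\<mu> \<Otimes>\<^sub>M env) g"
    by (rule P.integrable_const_bound[of _ 1]) (auto simp: g01)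
  define G where "G = left_tail (v / \<theta> - s) * small_prob (L - v + ln (real b))"
  have G: "G \<ge> 0" by (simp add: G_def left_tail_def small_prob_def)
  have Eg: "(\<integral>\<^sup>+y. ennreal (g y) \<partial>(\<mu> \<Otimes>\<^sub>M env)) = ennreal G"
  proof -
    have "(\<integral>\<^sup>+y. ennreal (g y) \<partial>(\<mu> \<Otimes>\<^sub>M env)) = ennreal (\<integral>y. g y \<partial>(\<mu> \<Otimes>\<^sub>M env))"
      using g01 g_int by (intro nn_integral_eq_integral) auto
    also have "(\<integral>y. g y \<partial>(\<mu> \<Otimes>\<^sub>M env)) = (\<integral>u. \<integral>z. g (u, z) \<partial>env \<partial>\<mu>)"
      by (rule P.integral_fst'[OF g_int, symmetric])
    also have "\<dots> = G"
      by (simp add: G_def g_def left_tail_integral small_prob_integral l_def del: minus_add_distrib minus_diff_eq)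
    finally show ?thesis .
  qed
  have "ennreal (pmf p b * G ^ b) = (\<integral>\<^sup>+k. indicator {b} k * ennreal G ^ k \<partial>measure_pmf p)"
  proof -
    have "(\<integral>\<^sup>+k. indicator {b} k * ennreal G ^ k \<partial>measure_pmf p)
        = (\<integral>\<^sup>+k. ennreal G ^ b * indicator {b} k \<partial>measure_pmf p)"
      by (intro nn_integral_cong) (auto split: split_indicator)
    also have "\<dots> = ennreal G ^ b * pmf p b"
      by (subst nn_integral_cmult_indicator) (auto simp: emeasure_pmf_single)
    also have "\<dots> = ennreal (pmf p b * G ^ b)"
      by (simp add: ennreal_mult ennreal_power[symmetric] mult.commute G)
    finally show ?thesis ..
  qed
  also have "\<dots> = (\<integral>\<^sup>+z. indicator {b} (root_offspring z)
      * (\<Prod>i<root_offspring z. ennreal (g (child_step i z, subtree_env i z))) \<partial>env)"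
    by (subst nn_integral_branching[OF prob_mu sets_mu]) (simp_all add: Eg)
  also have "\<dots> \<le> (\<integral>\<^sup>+z. ennreal (if D z < exp (- L) then 1 else 0) \<partial>env)"
  proof (rule nn_integral_mono_AE)
    show "AE z in env. indicator {b} (root_offspring z)
        * (\<Prod>i<root_offspring z. ennreal (g (child_step i z, subtree_env i z)))
        \<le> ennreal (if D z < exp (- L) then 1 else 0)"
      using D_fixed_point AE_subtree[OF D_nonneg]
    proof eventually_elim
      case (elim z)
      show ?case
      proof (cases "root_offspring z = b \<and> (\<forall>i<b. g (child_step i z, subtree_env i z) \<noteq> 0)")
        case True
        then have N: "root_offspring z = b"
          and child: "\<And>i. i < b \<Longrightarrow> v \<le> V (child_step i z) \<and> D (subtree_env i z) < l"
          by (auto simp: g_def split: if_splits)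
        have "D z < (\<Sum>i<b. exp (- L) / real b)"
          unfolding elim(1) N
        proof (rule sum_strict_mono)
          fix i assume "i \<in> {..<b}"
          then have i: "v \<le> V (child_step i z)" "D (subtree_env i z) < l" using child by auto
          have "exp (- V (child_step i z)) * D (subtree_env i z) \<le> exp (- v) * D (subtree_env i z)"
            using i elim(2) by (intro mult_right_mono) auto
          also have "\<dots> < exp (- v) * l" using i by (intro mult_strict_left_mono) auto
          also have "exp (- v) * l = exp (- L - ln (real b))"
            unfolding l_def exp_add[symmetric] by simp
          also have "\<dots> = exp (- L) / real b" using b2 by (simp add: exp_diff)
          finally show "exp (- V (child_step i z)) * D (subtree_env i z) < exp (- L) / real b" .
        qed (use b2 in \<open>simp_all add: lessThan_empty_iff\<close>)
        also have "\<dots> = exp (- L)" using b2 by simp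
        finally have "ennreal (if D z < exp (- L) then 1 else 0) = 1" by simp
        moreover have "(\<Prod>i<root_offspring z. ennreal (g (child_step i z, subtree_env i z))) \<le> 1"
          using g01 by (simp add: prod_ennreal prod_le_1)
        ultimately show ?thesis by (simp add: N)
      next
        case False
        have "indicator {b} (root_offspring z)
            * (\<Prod>i<root_offspring z. ennreal (g (child_step i z, subtree_env i z))) = 0"
        proof (cases "root_offspring z = b")
          case True
          with False obtain i where "i < root_offspring z" "g (child_step i z, subtree_env i z) = 0" by auto
          then have "(\<Prod>i<root_offspring z. ennreal (g (child_step i z, subtree_env i z))) = 0"
            by (intro prod_zero bexI[of _ i]) auto
          then show ?thesis by simp
        qed simp
        then show ?thesis by (simp only: zero_le)
      qed
    qed
  qed
  also have "\<dots> = ennreal (small_prob L)"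
    unfolding small_prob_integral using integrable_small
    by (intro nn_integral_eq_integral) auto
  finally show ?thesis
    by (subst (asm) ennreal_le_iff) (simp_all add: small_prob_def G_def)
qed

lemma small_prob_antimono: "antimono small_prob"
proof
  fix x y :: real assume "x \<le> y"
  then have "exp (- y) \<le> exp (- x)" by simp
  then show "small_prob y \<le> small_prob x"
    unfolding small_prob_def by (intro env.finite_measure_mono) (auto intro: order.strict_trans2)
qed

text \<open>Almost sure positivity of the limit enters here: an atom at 0 would keep the
  probabilities away from 0.\<close>

lemma small_prob_tendsto_0: "(small_prob \<longlongrightarrow> 0) at_top"
proof -
  have "((\<lambda>L. \<integral>z. (if D z < exp (- L) then 1 else 0 :: real) \<partial>env) \<longlongrightarrow> (\<integral>z. 0 \<partial>env)) at_top"
  proof (rule integral_dominated_convergence_at_top[where w="\<lambda>_. 1"])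
    show "AE z in env. ((\<lambda>L. if D z < exp (- L) then 1 else 0 :: real) \<longlongrightarrow> 0) at_top"
      using D_pos
    proof eventually_elim
      case (elim z)
      have "((\<lambda>L::real. exp (- L)) \<longlongrightarrow> 0) at_top" by real_asymp
      then have "eventually (\<lambda>L. exp (- L) < D z) at_top" using elim by (rule order_tendstoD)
      then have "eventually (\<lambda>L. (if D z < exp (- L) then 1 else 0 :: real) = 0) at_top"
        by eventually_elim auto
      then show ?case by (rule tendsto_eventually)
    qed
  qed auto
  then show ?thesis by (simp add: small_prob_integral[abs_def])
qed

text \<open>The limit is real-valued, hence below exp n for some n; the level L = - n may be
  negative.\<close>

lemma small_prob_pos_somewhere: "\<exists>L. small_prob L > 0"
proof (rule ccontr)
  assume "\<not> (\<exists>L. small_prob L > 0)"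
  moreover have "0 \<le> small_prob L" for L by (simp add: small_prob_def)
  ultimately have "small_prob L = 0" for L by (meson not_less order.antisym)
  then have "AE z in env. z \<notin> {z \<in> space env. D z < exp (- L)}" for L
    unfolding small_prob_def by (subst env.prob_eq_0[symmetric]) auto
  then have ae: "AE z in env. \<not> D z < exp (- L)" for L
    using AE_space by eventually_elim auto
  have ae': "AE z in env. \<forall>n::nat. \<not> D z < exp (- (- real n))"
    by (intro AE_all_countable[THEN iffD2] allI ae)
  have ex: "\<exists>n::nat. D z < exp (- (- real n))" for z
  proof -
    obtain n :: nat where "D z < real n" using reals_Archimedean2 by blast
    also have "real n \<le> exp (real n)" using exp_ge_add_one_self[of "real n"] by linarith
    finally show ?thesis by auto
  qed
  from ae' have "AE z in env. False" by eventually_elim (use ex in blast)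
  then show False by simp
qed

theorem small_deviation_rate:
  assumes \<alpha>: "\<alpha> > 0" and tail: "left_tail \<in> \<Theta>[at_top](\<lambda>z. exp (- exp (z powr \<alpha>)))"
  shows "((\<lambda>L. ln (- ln (small_prob L)) / L powr (\<alpha> / (\<alpha> + 1)))
     \<longlongrightarrow> ((1 + \<alpha>) / (\<theta> * \<alpha>) * ln b) powr (\<alpha> / (\<alpha> + 1))) at_top"
proof -
  obtain c1 where c1: "c1 > 0" "eventually (\<lambda>z. norm (left_tail z) \<ge> c1 * norm (exp (- exp (z powr \<alpha>)))) at_top"
    by (rule landau_omega.bigE[OF bigthetaD2[OF tail]])
  obtain c2 where c2: "c2 > 0" "eventually (\<lambda>z. norm (left_tail z) \<le> c2 * norm (exp (- exp (z powr \<alpha>)))) at_top"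
    by (rule landau_o.bigE[OF bigthetaD1[OF tail]])
  from c1 c2 have c: "c1 > 0" "c2 > 0" by auto
  from c1(2) c2(2)
  have "eventually (\<lambda>z. c1 * exp (- exp (z powr \<alpha>)) \<le> left_tail z \<and> left_tail z \<le> c2 * exp (- exp (z powr \<alpha>))) at_top"
  proof eventually_elim
    case (elim z)
    have "norm (left_tail z) = left_tail z" by (simp add: left_tail_def)
    moreover have "norm (exp (- exp (z powr \<alpha>))) = exp (- exp (z powr \<alpha>))" by (simp only: real_norm_def abs_exp_cancel)
    ultimately show ?case using elim by (simp only:)
  qed
  then obtain z0 where "\<And>z. z \<ge> z0 \<Longrightarrow> c1 * exp (- exp (z powr \<alpha>)) \<le> left_tail z \<and> left_tail z \<le> c2 * exp (- exp (z powr \<alpha>))"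
    unfolding eventually_at_top_linorder by blast
  then have z0: "z \<ge> z0 \<Longrightarrow> left_tail z \<le> c2 * exp (- exp (z powr \<alpha>))"
    "z \<ge> z0 \<Longrightarrow> c1 * exp (- exp (z powr \<alpha>)) \<le> left_tail z" for z by blast+
  interpret tail_recursion small_prob left_tail b \<alpha> \<theta> s "pmf p b" c1 c2 z0
  proof
    show "pmf p b > 0" using b_min by (simp add: pmf_positive)
    show "0 \<le> small_prob L" for L by (simp add: small_prob_def)
    show "0 \<le> left_tail z" for z by (simp add: left_tail_def)
  qed (rule b2 \<alpha> \<theta>_pos c z0 small_prob_antimono small_prob_tendsto_0 small_prob_pos_somewhere
      small_prob_rec_upper small_prob_rec_lower | assumption)+
  show ?thesis by (rule double_exponential_rate)
qed

end

section \<open>From the tree to the environment\<close>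

lemma gw_tree_snoc: "v @ [i] \<in> gw_tree c \<longleftrightarrow> v \<in> gw_tree c \<and> i < c v"
  by (auto elim: gw_tree.cases intro: gw_tree.child)

text \<open>The tree is generated by appending at the leaves, while the recursion decomposes at the
  root; the reverse induction changes from one view to the other.\<close>

lemma gw_tree_Cons: "i # u \<in> gw_tree c \<longleftrightarrow> i < c [] \<and> u \<in> gw_tree (\<lambda>v. c (i # v))"
proof (induction u rule: rev_induct)
  case Nil
  show ?case using gw_tree_snoc[of "[]" i c] by (auto intro: gw_tree.root)
next
  case (snoc j u)
  then show ?case
    using gw_tree_snoc[of "i # u" j c] gw_tree_snoc[of u j "\<lambda>v. c (i # v)"] by auto
qed

lemma gw_tree_generation_0: "{u \<in> gw_tree c. length u = 0} = {[]}"
  by (auto intro: gw_tree.root)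

lemma gw_tree_generation_Suc:
  "{u \<in> gw_tree c. length u = Suc n} = (\<Union>i<c []. (#) i ` {u \<in> gw_tree (\<lambda>v. c (i # v)). length u = n})"
proof (intro set_eqI iffI)
  fix u assume "u \<in> {u \<in> gw_tree c. length u = Suc n}"
  then obtain i w where "u = i # w" "length w = n" "i # w \<in> gw_tree c" by (auto simp: length_Suc_conv)
  then show "u \<in> (\<Union>i<c []. (#) i ` {u \<in> gw_tree (\<lambda>v. c (i # v)). length u = n})"
    by (auto simp: gw_tree_Cons)
qed (auto simp: gw_tree_Cons)

lemma finite_gw_tree_generation: "finite {u \<in> gw_tree c. length u = n}"
proof (induction n arbitrary: c)
  case 0
  then show ?case by (simp only: gw_tree_generation_0) simp
next
  case (Suc n)
  then show ?case by (simp only: gw_tree_generation_Suc) auto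
qed

lemma position_Nil: "position X [] \<omega> = 0"
proof -
  have "{u :: nat list. strict_prefix [] u \<and> prefix u []} = {}" by auto
  then show ?thesis by (simp only: position_def sum.empty)
qed

lemma position_Cons: "position X (i # u) \<omega> = X [i] \<omega> + position (\<lambda>v. X (i # v)) u \<omega>"
proof -
  let ?A = "{w. strict_prefix [] w \<and> prefix w u}"
  have fin: "finite ?A"
    by (rule finite_subset[of _ "set (prefixes u)"]) auto
  have "{w. strict_prefix [] w \<and> prefix w (i # u)} = insert [i] ((#) i ` ?A)"
    by (auto simp: prefix_Cons strict_prefix_def image_iff)
  moreover have "[i] \<notin> (#) i ` ?A" by auto
  ultimately have "position X (i # u) \<omega> = X [i] \<omega> + (\<Sum>w\<in>(#) i ` ?A. X w \<omega>)"
    using fin by (simp add: position_def)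
  also have "(\<Sum>w\<in>(#) i ` ?A. X w \<omega>) = position (\<lambda>v. X (i # v)) u \<omega>"
    unfolding position_def by (subst sum.reindex) (auto intro: inj_onI)
  finally show ?thesis .
qed

text \<open>A statement about one fixed tree: \<open>()\<close> stands in for the sample point that
  \<open>position\<close> expects. The offspring and displacement functions are arbitrary so that
  the induction can move to the relabelled subtrees.\<close>

lemma (in critical_brw) branching_sum_tree:
  assumes "\<And>v. c v = nat \<lfloor>z (Inl v)\<rfloor>" "\<And>v. v \<noteq> [] \<Longrightarrow> x v = z (Inr v)"
  shows "(\<Sum>u \<in> {u \<in> gw_tree c. length u = n}. F (y + \<theta> * (real n * s - position (\<lambda>v _. x v) u ())))
    = branching_sum F n y z"
  using assms
proof (induction n arbitrary: c x y z)
  case 0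
  show ?case by (simp only: gw_tree_generation_0) (simp add: position_Nil)
next
  case (Suc n)
  let ?G = "\<lambda>i. {u \<in> gw_tree (\<lambda>v. c (i # v)). length u = n}"
  let ?f = "\<lambda>u. F (y + \<theta> * (real (Suc n) * s - position (\<lambda>v _. x v) u ()))"
  have root: "c [] = root_offspring z" using Suc.prems by (simp add: root_offspring_def)
  have "(\<Sum>u \<in> {u \<in> gw_tree c. length u = Suc n}. ?f u) = (\<Sum>i<c []. \<Sum>u\<in>(#) i ` ?G i. ?f u)"
    unfolding gw_tree_generation_Suc
    by (rule sum.UNION_disjoint) (auto intro: finite_imageI finite_gw_tree_generation)
  also have "\<dots> = (\<Sum>i<c []. branching_sum F n (y + V (child_step i z)) (subtree_env i z))"
  proof (rule sum.cong[OF refl])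
    fix i
    have "(\<Sum>u\<in>(#) i ` ?G i. ?f u) = (\<Sum>u\<in>?G i. ?f (i # u))"
      by (subst sum.reindex) (auto intro: inj_onI)
    also have "\<dots> = (\<Sum>u\<in>?G i. F ((y + V (child_step i z)) + \<theta> * (real n * s - position (\<lambda>v _. x (i # v)) u ())))"
      using Suc.prems(2)[of "[i]"]
      by (intro sum.cong refl arg_cong[of _ _ F]) (simp add: position_Cons V_def child_step_def algebra_simps)
    also have "\<dots> = branching_sum F n (y + V (child_step i z)) (subtree_env i z)"
      by (rule Suc.IH) (simp_all add: Suc.prems subtree_env_def)
    finally show "(\<Sum>u\<in>(#) i ` ?G i. ?f u) = branching_sum F n (y + V (child_step i z)) (subtree_env i z)" .
  qed
  finally show ?case by (simp add: root)
qed

section \<open>The environment of a given branching random walk\<close>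

context branching_random_walk
begin

definition environment :: "'a \<Rightarrow> nat list + nat list \<Rightarrow> real" where
  "environment \<omega> = (\<lambda>j\<in>brw_index. case_sum (\<lambda>v \<omega>. real (N v \<omega>)) X j \<omega>)"

lemma displacement_law_space: "prob_space \<mu>" "sets \<mu> = sets borel"
proof -
  have "prob_space (distr M borel (X [0]))"
    by (rule prob_space_distr) (simp add: displacement_measurable)
  then show "prob_space \<mu>" using displacement_law[of "[0]"] by simp
  show "sets \<mu> = sets borel" using displacement_law[of "[0]"] by (metis list.distinct(1) sets_distr)
qed

lemma environment_law:
  "environment \<in> M \<rightarrow>\<^sub>M env_law p \<mu>" "distr M (env_law p \<mu>) environment = env_law p \<mu>"
proof -
  let ?Y = "case_sum (\<lambda>v \<omega>. real (N v \<omega>)) X"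
  have rv: "?Y j \<in> borel_measurable M" if "j \<in> brw_index" for j
    using that measurable_compose[OF offspring_measurable, of real borel] displacement_measurable
    by (cases j) auto
  show meas: "environment \<in> M \<rightarrow>\<^sub>M env_law p \<mu>"
    unfolding environment_def[abs_def] measurable_cong_sets[OF refl sets_env_law[OF displacement_law_space(2)]]
    by (intro measurable_restrict rv)
  have marginal: "distr M borel (?Y j) = env_marginal p \<mu> j" if "j \<in> brw_index" for j
  proof (cases j)
    case (Inl v)
    have "distr M borel (\<lambda>\<omega>. real (N v \<omega>)) = distr (distr M (count_space UNIV) (N v)) borel real"
      by (subst distr_distr) (auto simp: comp_def offspring_measurable)
    then show ?thesis by (simp add: Inl offspring_law env_marginal_def)
  next
    case (Inr v)
    then show ?thesis using that displacement_law[of v] by (simp add: env_marginal_def)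
  qed
  have "indep_vars (\<lambda>_. borel) ?Y brw_index"
    using independent unfolding brw_index_def .
  then have "distr M (PiM brw_index (\<lambda>_. borel)) (\<lambda>\<omega>. \<lambda>j\<in>brw_index. ?Y j \<omega>) = PiM brw_index (\<lambda>j. distr M borel (?Y j))"
    using rv by (subst (asm) indep_vars_iff_distr_eq_PiM') auto
  also have "\<dots> = env_law p \<mu>"
    unfolding env_law_def by (intro PiM_cong refl marginal)
  finally show "distr M (env_law p \<mu>) environment = env_law p \<mu>"
    using sets_env_law[OF displacement_law_space(2), of p]
    by (simp add: environment_def[abs_def] cong: distr_cong)
qed

end


text \<open>The rate function at the speed is a supremum over t, attained at \<theta> with value ln
  m. Exponentiating at t = u \<theta> turns the supremum inequality into \<open>critical\<close> and
  its equality case into \<open>normalised\<close>. The moment exponent is capped at 2, and \<delta>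
  / \<theta> is the room above u = 1.\<close>

lemma critical_brwI:
  fixes p :: "nat pmf" and \<mu> :: "real measure" and \<xi> \<theta> \<delta> \<alpha> :: real and K :: ereal
  assumes mu: "prob_space \<mu>" "sets \<mu> = sets borel"
    and moment: "\<xi> > 0" "summable (\<lambda>k. real k powr (1 + \<xi>) * pmf p k)"
    and mean: "offspring_mean p > 1"
    and K: "K > 0"
    and rate: "\<theta> > 0"
      "rate_function \<mu> (speed p \<mu>) = ereal (\<theta> * speed p \<mu>) - ext_ln (mgf \<mu> \<theta>)"
      "rate_function \<mu> (speed p \<mu>) = ereal (ln (offspring_mean p))"
    and finite: "\<delta> > 0" "\<And>t::real. - K < ereal t \<Longrightarrow> t < \<theta> + \<delta> \<Longrightarrow> mgf \<mu> t < \<infinity>"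
    and min: "min_offspring p \<ge> 2"
    and tail: "(\<lambda>z. measure \<mu> {..-z}) \<in> \<Theta>[at_top](\<lambda>z. exp (- exp (z powr \<alpha>)))"
  shows "critical_brw p \<mu> \<theta> (speed p \<mu>) (offspring_mean p) (1 + min \<xi> 1) (\<delta> / \<theta>)"
proof -
  interpret prob_space \<mu> by fact
  note mu(2) [measurable_cong]
  let ?s = "speed p \<mu>" and ?m = "offspring_mean p"
  define \<psi> where "\<psi> t = (\<integral>x. exp (t * x) \<partial>\<mu>)" for t
  have psi: "integrable \<mu> (\<lambda>x. exp (t * x))" "\<psi> t > 0" "ext_ln (mgf \<mu> t) = ereal (ln (\<psi> t))"
    if "0 < t" "t < \<theta> + \<delta>" for t
  proof -
    have "- K < ereal t" using K that by (cases K) auto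
    from ext_ln_mgf[OF mu finite(2)[OF this that(2)]]
    show "integrable \<mu> (\<lambda>x. exp (t * x))" "\<psi> t > 0" "ext_ln (mgf \<mu> t) = ereal (ln (\<psi> t))"
      by (simp_all add: \<psi>_def)
  qed
  have theta: "0 < \<theta>" "\<theta> < \<theta> + \<delta>" using rate finite by auto
  have eq: "\<theta> * ?s - ln (\<psi> \<theta>) = ln ?m"
    using rate(2,3) psi(3)[OF theta] by simp
  have le: "t * ?s - ln (\<psi> t) \<le> ln ?m" if "0 < t" "t < \<theta> + \<delta>" for t
  proof -
    have "ereal (t * ?s) - ext_ln (mgf \<mu> t) \<le> rate_function \<mu> ?s"
      unfolding rate_function_def by (rule SUP_upper) simp
    then show ?thesis using psi(3)[OF that] rate(3) by simp
  qed
  have shifted: "(\<lambda>x. exp (- u * (\<theta> * (?s - x)))) = (\<lambda>x. exp (- (u * \<theta> * ?s)) * exp ((u * \<theta>) * x))" for u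
    by (auto simp: exp_add[symmetric] algebra_simps)
  have shifted_integral: "?m * (\<integral>x. exp (- u * (\<theta> * (?s - x))) \<partial>\<mu>) = exp (ln ?m - (u * \<theta> * ?s - ln (\<psi> (u * \<theta>))))"
    if "0 < u * \<theta>" "u * \<theta> < \<theta> + \<delta>" for u
    unfolding shifted using psi(2)[OF that] mean
    by (simp add: exp_diff exp_add exp_minus field_simps \<psi>_def)
  have range: "0 < u * \<theta>" "u * \<theta> < \<theta> + \<delta>" if "0 < u" "u < 1 + \<delta> / \<theta>" for u
  proof -
    show "0 < u * \<theta>" using that theta by simp
    have "u * \<theta> < (1 + \<delta> / \<theta>) * \<theta>" using that theta by (intro mult_strict_right_mono) auto
    then show "u * \<theta> < \<theta> + \<delta>" using theta by (simp add: distrib_right)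
  qed
  show ?thesis
  proof
    show "2 \<le> k" if "k \<in> set_pmf p" for k
    proof -
      have "min_offspring p \<le> k"
        unfolding min_offspring_def using that by (intro Least_le) (rule pmf_positive)
      with min show ?thesis by simp
    qed
    have m1: "summable (\<lambda>k. real k powr 1 * pmf p k)"
      by (rule summable_lower_moment[OF moment(2)]) (use moment in auto)
    then have m1': "summable (\<lambda>k. real k * pmf p k)" by simp
    show "integrable (measure_pmf p) real" "(\<integral>k. real k \<partial>measure_pmf p) = ?m"
      using pmf_nat_series[OF _ m1'] by (simp_all add: offspring_mean_def)
    show "integrable (measure_pmf p) (\<lambda>k. real k powr (1 + min \<xi> 1))"
      by (intro pmf_nat_series summable_lower_moment[OF moment(2)]) (use moment in auto)
    show "integrable \<mu> (\<lambda>x. exp (- u * (\<theta> * (?s - x))))" if "0 < u" "u < 1 + \<delta> / \<theta>" for u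
      unfolding shifted using psi(1)[OF range[OF that]] by simp
    show "?m * (\<integral>x. exp (- (\<theta> * (?s - x))) \<partial>\<mu>) = 1"
      using shifted_integral[of 1] theta eq by simp
    show "1 \<le> ?m * (\<integral>x. exp (- u * (\<theta> * (?s - x))) \<partial>\<mu>)" if "0 < u" "u < 1 + \<delta> / \<theta>" for u
      unfolding shifted_integral[OF range[OF that]] using le[OF range[OF that]] by simp
    show "\<exists>w>v. \<not> (AE x in \<mu>. \<theta> * (?s - x) < w)" for v
    proof (intro exI conjI notI)
      show "v < v + 1" by simp
      assume ae: "AE x in \<mu>. \<theta> * (?s - x) < v + 1"
      obtain c where c: "c > 0" "eventually (\<lambda>z. norm (measure \<mu> {..-z}) \<ge> c * norm (exp (- exp (z powr \<alpha>)))) at_top"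
        by (rule landau_omega.bigE[OF bigthetaD2[OF tail]])
      have "eventually (\<lambda>z. norm (measure \<mu> {..-z}) \<ge> c * norm (exp (- exp (z powr \<alpha>)))
          \<and> z \<ge> (v + 1) / \<theta> - ?s) at_top"
        using c(2) eventually_ge_at_top by (rule eventually_conj)
      then obtain z where z: "norm (measure \<mu> {..-z}) \<ge> c * norm (exp (- exp (z powr \<alpha>)))" "z \<ge> (v + 1) / \<theta> - ?s"
        using eventually_happens' trivial_limit_at_top_linorder by blast
      have "0 < c * norm (exp (- exp (z powr \<alpha>)))" using c(1) by simp
      with z(1) have "measure \<mu> {..-z} \<noteq> 0" by auto
      moreover have "AE x in \<mu>. x \<notin> {..-z}"
        using ae
      proof eventually_elim
        case (elim x)
        show ?case
        proof
          assume "x \<in> {..-z}"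
          then have "(v + 1) / \<theta> \<le> ?s - x" using z(2) by simp
          then have "v + 1 \<le> \<theta> * (?s - x)" using theta by (simp add: field_simps)
          with elim show False by simp
        qed
      qed
      then have "measure \<mu> {..-z} = 0" by (subst prob_eq_0) (auto simp: mu(2))
      ultimately show False by simp
    qed
  qed (use mu theta finite moment in auto)
qed

section \<open>Transfer to the original probability space\<close>

lemma min_offspring_le: "k \<in> set_pmf p \<Longrightarrow> min_offspring p \<le> k"
  unfolding min_offspring_def by (intro Least_le) (rule pmf_positive)

lemma min_offspring_in_set_pmf: "min_offspring p \<in> set_pmf p"
proof -
  obtain k where "k \<in> set_pmf p" using set_pmf_not_empty[of p] by blast
  then have "pmf p k > 0" by (rule pmf_positive)
  then have "pmf p (min_offspring p) > 0" unfolding min_offspring_def by (rule LeastI)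
  then show ?thesis by (simp add: set_pmf_iff)
qed

theorem proposition1p6:
  fixes M :: "'a measure"
    and N :: "nat list \<Rightarrow> 'a \<Rightarrow> nat"
    and X :: "nat list \<Rightarrow> 'a \<Rightarrow> real"
    and p :: "nat pmf"
    and \<mu> :: "real measure"
    and \<xi> \<theta> \<delta> \<alpha> :: real
    and K :: ereal
    and D_inf :: "'a \<Rightarrow> real"
  assumes brw: "branching_random_walk M N X p \<mu>"
    and i_moment: "\<xi> > 0" "summable (\<lambda>k. real k powr (1 + \<xi>) * pmf p k)"
    and i_mean: "offspring_mean p > 1"
    and ii_centred: "has_bochner_integral \<mu> (\<lambda>x. x) 0"
    and ii_mgf: "K > 0" "\<And>t::real. - K < ereal t \<Longrightarrow> ereal t < K \<Longrightarrow> mgf \<mu> t < \<infinity>"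
    and iii: "\<theta> > 0"
      "rate_function \<mu> (speed p \<mu>) = ereal (\<theta> * speed p \<mu>) - ext_ln (mgf \<mu> \<theta>)"
      "rate_function \<mu> (speed p \<mu>) = ereal (ln (offspring_mean p))"
    and iv: "\<delta> > 0" "\<And>t::real. - K < ereal t \<Longrightarrow> t < \<theta> + \<delta> \<Longrightarrow> mgf \<mu> t < \<infinity>"
    and v: "min_offspring p \<ge> 2"
    and vi: "\<alpha> > 0"
      "(\<lambda>z. measure \<mu> {..-z}) \<in> \<Theta>[at_top](\<lambda>z. exp (- exp (z powr \<alpha>)))"
    and D_inf: "D_inf \<in> borel_measurable M"
      "AE \<omega> in M. (\<lambda>n. derivative_martingale N X \<theta> (speed p \<mu>) n \<omega>) \<longlonglongrightarrow> D_inf \<omega>"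
  shows "((\<lambda>\<epsilon>. 1 / (- ln \<epsilon>) powr (\<alpha> / (\<alpha> + 1)) *
            ln (- ln (measure M {\<omega> \<in> space M. D_inf \<omega> < \<epsilon>})))
          \<longlongrightarrow> ((1 + \<alpha>) / (\<theta> * \<alpha>) * ln (real (min_offspring p))) powr (\<alpha> / (\<alpha> + 1)))
         (at_right 0)"
proof -
  interpret branching_random_walk M N X p \<mu> by (rule brw)
  let ?s = "speed p \<mu>" and ?b = "min_offspring p"
  interpret critical_brw p \<mu> \<theta> ?s "offspring_mean p" "1 + min \<xi> 1" "\<delta> / \<theta>"
    by (rule critical_brwI[OF displacement_law_space i_moment i_mean ii_mgf(1) iii iv v vi(2)])
  \<comment> \<open>The given limit lives on \<open>M\<close>, so a version on the canonical space
    is needed. \<open>lim\<close> supplies a measurable one, with arbitrary values where the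
    sequence diverges.\<close>
  define D where "D z = lim (\<lambda>n. branching_sum FD n 0 z)" for z
  have D_meas [measurable]: "D \<in> borel_measurable env"
    unfolding D_def[abs_def] by measurable
  have martingale: "derivative_martingale N X \<theta> ?s n \<omega> = branching_sum FD n 0 (environment \<omega>)" for n \<omega>
  proof -
    let ?x = "\<lambda>v. X v \<omega>"
    have "position X u \<omega> = position (\<lambda>v _. ?x v) u ()" for u by (simp add: position_def)
    then have "derivative_martingale N X \<theta> ?s n \<omega>
        = (\<Sum>u \<in> {u \<in> gw_tree (\<lambda>v. N v \<omega>). length u = n}. FD (0 + \<theta> * (real n * ?s - position (\<lambda>v _. ?x v) u ())))"
      unfolding derivative_martingale_def by (intro sum.cong refl) (simp add: algebra_simps)
    also have "\<dots> = branching_sum FD n 0 (environment \<omega>)"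
      by (rule branching_sum_tree) (simp_all add: environment_def)
    finally show ?thesis .
  qed
  have conv: "AE \<omega> in M. convergent (\<lambda>n. branching_sum FD n 0 (environment \<omega>)) \<and> D_inf \<omega> = D (environment \<omega>)"
    using D_inf(2) unfolding martingale
    by eventually_elim (auto simp: D_def convergent_def limI[symmetric])
  \<comment> \<open>The Cauchy property is measurable and does not mention the limit, so it can be
    carried through the image measure.\<close>
  have "AE \<omega> in M. Cauchy (\<lambda>n. branching_sum FD n 0 (environment \<omega>))"
    using conv by eventually_elim (auto simp: Cauchy_convergent_iff)
  then have "AE z in distr M env environment. Cauchy (\<lambda>n. branching_sum FD n 0 z)"
    by (subst AE_distr_iff) (auto simp: environment_law(1))
  then have lim: "AE z in env. (\<lambda>n. branching_sum FD n 0 z) \<longlonglongrightarrow> D z"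
    unfolding environment_law(2) D_def
    by eventually_elim (simp add: Cauchy_convergent_iff convergent_LIMSEQ_iff)
  interpret critical_brw_limit p \<mu> \<theta> ?s "offspring_mean p" "1 + min \<xi> 1" "\<delta> / \<theta>" D ?b
    by unfold_locales (simp_all only: D_meas lim min_offspring_in_set_pmf min_offspring_le)
  have prob: "measure M {\<omega> \<in> space M. D_inf \<omega> < \<epsilon>} = small_prob (- ln \<epsilon>)" if "\<epsilon> > 0" for \<epsilon>
  proof -
    have "measure M {\<omega> \<in> space M. D_inf \<omega> < \<epsilon>} = measure M {\<omega> \<in> space M. D (environment \<omega>) < \<epsilon>}"
    proof (rule measure_eq_AE)
      show "AE \<omega> in M. (\<omega> \<in> {\<omega> \<in> space M. D_inf \<omega> < \<epsilon>}) = (\<omega> \<in> {\<omega> \<in> space M. D (environment \<omega>) < \<epsilon>})"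
        using conv by eventually_elim auto
      have "(\<lambda>\<omega>. D (environment \<omega>)) \<in> borel_measurable M"
        by (rule measurable_compose[OF environment_law(1) D_meas])
      then show "{\<omega> \<in> space M. D (environment \<omega>) < \<epsilon>} \<in> sets M" by measurable
      show "{\<omega> \<in> space M. D_inf \<omega> < \<epsilon>} \<in> sets M" using D_inf(1) by measurable
    qed
    also have "\<dots> = measure (distr M env environment) {z \<in> space env. D z < \<epsilon>}"
      by (subst measure_distr)
        (auto simp: environment_law(1) dest: measurable_space[OF environment_law(1)] intro!: arg_cong[of _ _ "measure M"])
    also have "\<dots> = small_prob (- ln \<epsilon>)"
      using that by (simp add: environment_law(2) small_prob_def)
    finally show ?thesis .
  qed
  have "left_tail \<in> \<Theta>[at_top](\<lambda>z. exp (- exp (z powr \<alpha>)))"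
    using vi(2) by (simp add: left_tail_def[abs_def])
  note rate = small_deviation_rate[OF vi(1) this]
  \<comment> \<open>The substitution L = - ln \<epsilon> turns the rate at infinity into the claim
    at 0.\<close>
  have "filterlim (\<lambda>\<epsilon>::real. - ln \<epsilon>) at_top (at_right 0)" by real_asymp
  from filterlim_compose[OF rate this] show ?thesis
  proof (rule Lim_transform_eventually)
    have "eventually (\<lambda>\<epsilon>::real. \<epsilon> > 0) (at_right 0)" by (rule eventually_at_right_less)
    then show "eventually (\<lambda>\<epsilon>. ln (- ln (small_prob (- ln \<epsilon>))) / (- ln \<epsilon>) powr (\<alpha> / (\<alpha> + 1))
        = 1 / (- ln \<epsilon>) powr (\<alpha> / (\<alpha> + 1)) * ln (- ln (measure M {\<omega> \<in> space M. D_inf \<omega> < \<epsilon>}))) (at_right 0)"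
      by eventually_elim (simp add: prob)
  qed
qed

end
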